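(* Let $X'$ be a topological cell complex, i.e. $X'=\operatorname{colim}Z'$ for a $\delta$-sequence $Z'\colon\delta\to\mathbf{Top}$ with $Z'_0=\emptyset$ and each $Z'_{\beta+1}$ ($\beta+1<\delta$) obtained from $Z'_\beta$ as a pushout attaching a cube $I^{n_{\beta+1}}$ along a continuous map $\partial I^{n_{\beta+1}}\to Z'_\beta$. Then there exists a gathered cell complex $X$ (a gathered smooth relative cell complex $(X,\emptyset)$) such that $X'$ is continuously homotopy equivalent to $TX$.
   Context: $\mathbf{Diff}$ denotes the category of diffeological spaces and smooth maps; it is complete and cocomplete. For a diffeological space $X$, its $D$-topology is the finest topology on the underlying set making all plots continuous, and $T\colon\mathbf{Diff}\to\mathbf{Top}$ is the functor sending $X$ to its underlying set with the $D$-topology. $I=[0,1]$, $I^n$ is the $n$-cube and $\partial I^n$ its boundary, with the subspace diffeology from $\mathbf{R}^n$ (standard diffeology) in $\mathbf{Diff}$, and with the Euclidean topology in $\mathbf{Top}$. For a cocomplete category $\mathcal C$ and an ordinal $\delta$, a $\delta$-sequence is a functor $Z\colon\delta\to\mathcal C$ such that for every limit ordinal $\beta<\delta$ the induced map $\operatorname{colim}_{\alpha<\beta}Z_\alpha\to Z_\beta$ is an isomorphism. A pair $(X,A)$ of diffeological spaces is a smooth relative cell complex if there is an ordinal $\delta$ and a $\delta$-sequence $Z\colon\delta\to\mathbf{Diff}$ such that the inclusion $A\to X$ is the canonical map $Z_0\to\operatorname{colim}Z$, and for each $\beta$ with $\beta+1<\delta$ there is $n_{\beta+1}\ge0$ and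 a pushout square in $\mathbf{Diff}$ exhibiting $Z_{\beta+1}=Z_\beta\cup_{\phi_{\beta+1}}I^{n_{\beta+1}}$ for a smooth attaching map $\phi_{\beta+1}\colon\partial I^{n_{\beta+1}}\to Z_\beta$; it is a smooth cell complex if $A=\emptyset$. For $0<\epsilon\le1/2$, a smooth map $f\colon\partial I^n\to Z$ is $\epsilon$-tame if $f(t_1,\dots,t_j,\dots,t_n)=f(t_1,\dots,t_{j-1},\alpha,t_{j+1},\dots,t_n)$ for all $(t_1,\dots,t_n)\in\partial I^n$, all $j$, and all $\alpha\in\{0,1\}$ with $|t_j-\alpha|\le\epsilon$; "tame" means $\epsilon$-tame for some $\epsilon>0$. A smooth (relative) cell complex is gathered if all its attaching maps are tame. *)

theory Defs
  imports "HOL-Analysis.Analysis"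
begin

text \<open>R^n is modelled inside the type nat => real as the functions vanishing from index n on,
  with the (subspace of the) product topology, which is the Euclidean topology of R^n.\<close>

definition euc :: "nat \<Rightarrow> (nat \<Rightarrow> real) set" where
  "euc n = {x. \<forall>i\<ge>n. x i = 0}"

definition euclid :: "nat \<Rightarrow> (nat \<Rightarrow> real) topology" where
  "euclid n = subtopology euclidean (euc n)"

definition cube :: "nat \<Rightarrow> (nat \<Rightarrow> real) set" where
  "cube n = {x. (\<forall>i\<ge>n. x i = 0) \<and> (\<forall>i<n. 0 \<le> x i \<and> x i \<le> 1)}"

definition bdry :: "nat \<Rightarrow> (nat \<Rightarrow> real) set" where
  "bdry n = {x \<in> cube n. \<exists>i<n. x i = 0 \<or> x i = 1}"

definition smooth_fun :: "nat \<Rightarrow> (nat \<Rightarrow> real) set \<Rightarrow> ((nat \<Rightarrow> real) \<Rightarrow> real) \<Rightarrow> bool" where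
  "smooth_fun k V g \<longleftrightarrow>
     (\<exists>D :: nat list \<Rightarrow> (nat \<Rightarrow> real) \<Rightarrow> real.
        (\<forall>x\<in>V. D [] x = g x) \<and>
        (\<forall>ks. continuous_on V (D ks)) \<and>
        (\<forall>ks. \<forall>i<k. \<forall>x\<in>V.
            ((\<lambda>h. D ks (x(i := x i + h))) has_real_derivative D (i # ks) x) (at 0)))"

definition smooth_map_eu :: "nat \<Rightarrow> (nat \<Rightarrow> real) set \<Rightarrow> nat \<Rightarrow> ((nat \<Rightarrow> real) \<Rightarrow> (nat \<Rightarrow> real)) \<Rightarrow> bool" where
  "smooth_map_eu k V n F \<longleftrightarrow> F ` V \<subseteq> euc n \<and> (\<forall>j<n. smooth_fun k V (\<lambda>x. F x j))"

text \<open>A plot is a triple (n, U, p) with U open in R^n and p : U -> X.\<close>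
record 'a diffeology =
  dcarrier :: "'a set"
  dplots :: "(nat \<times> (nat \<Rightarrow> real) set \<times> ((nat \<Rightarrow> real) \<Rightarrow> 'a)) set"

definition diffeological :: "'a diffeology \<Rightarrow> bool" where
  "diffeological X \<longleftrightarrow>
     (\<forall>n U p. (n, U, p) \<in> dplots X \<longrightarrow> openin (euclid n) U \<and> p ` U \<subseteq> dcarrier X) \<and>
     (\<forall>n U p q. (n, U, p) \<in> dplots X \<and> (\<forall>u\<in>U. p u = q u) \<longrightarrow> (n, U, q) \<in> dplots X) \<and>
     (\<forall>n U x. openin (euclid n) U \<and> x \<in> dcarrier X \<longrightarrow> (n, U, \<lambda>_. x) \<in> dplots X) \<and>
     (\<forall>n U p. openin (euclid n) U \<and> p ` U \<subseteq> dcarrier X \<and>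
        (\<forall>u\<in>U. \<exists>V. openin (euclid n) V \<and> u \<in> V \<and> V \<subseteq> U \<and> (n, V, p) \<in> dplots X)
        \<longrightarrow> (n, U, p) \<in> dplots X) \<and>
     (\<forall>n U p k V F. (n, U, p) \<in> dplots X \<and> openin (euclid k) V \<and> F ` V \<subseteq> U \<and>
        smooth_map_eu k V n F \<longrightarrow> (k, V, p \<circ> F) \<in> dplots X)"

definition smooth_map :: "'a diffeology \<Rightarrow> 'b diffeology \<Rightarrow> ('a \<Rightarrow> 'b) \<Rightarrow> bool" where
  "smooth_map X Y f \<longleftrightarrow> f ` dcarrier X \<subseteq> dcarrier Y \<and>
     (\<forall>n U p. (n, U, p) \<in> dplots X \<longrightarrow> (n, U, f \<circ> p) \<in> dplots Y)"

definition std_sub :: "nat \<Rightarrow> (nat \<Rightarrow> real) set \<Rightarrow> (nat \<Rightarrow> real) diffeology" where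
  "std_sub n S = \<lparr>dcarrier = S,
     dplots = {(k, U, p). openin (euclid k) U \<and> p ` U \<subseteq> S \<and> smooth_map_eu k U n p}\<rparr>"

definition cube_diff :: "nat \<Rightarrow> (nat \<Rightarrow> real) diffeology" where
  "cube_diff n = std_sub n (cube n)"

definition bdry_diff :: "nat \<Rightarrow> (nat \<Rightarrow> real) diffeology" where
  "bdry_diff n = std_sub n (bdry n)"

definition dtop :: "'a diffeology \<Rightarrow> 'a topology" where
  "dtop X = topology (\<lambda>A. A \<subseteq> dcarrier X \<and>
     (\<forall>n U p. (n, U, p) \<in> dplots X \<longrightarrow> openin (euclid n) {u \<in> U. p u \<in> A}))"

definition lifts_through :: "(nat \<Rightarrow> real) set \<Rightarrow> nat \<Rightarrow> ((nat \<Rightarrow> real) \<Rightarrow> 'b) \<Rightarrow> 'a diffeology \<Rightarrow> ('a \<Rightarrow> 'b) \<Rightarrow> bool" where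
  "lifts_through V n p Y h \<longleftrightarrow> (\<exists>q. (n, V, q) \<in> dplots Y \<and> (\<forall>v\<in>V. p v = h (q v)))"

definition is_zero :: "'i rel \<Rightarrow> 'i \<Rightarrow> bool" where
  "is_zero r a \<longleftrightarrow> a \<in> Field r \<and> (\<forall>c\<in>Field r. (a, c) \<in> r)"

definition is_succ :: "'i rel \<Rightarrow> 'i \<Rightarrow> 'i \<Rightarrow> bool" where
  "is_succ r a b \<longleftrightarrow> (a, b) \<in> r \<and> a \<noteq> b \<and> (\<forall>c. (a, c) \<in> r \<and> c \<noteq> a \<longrightarrow> (b, c) \<in> r)"

definition is_limit :: "'i rel \<Rightarrow> 'i \<Rightarrow> bool" where
  "is_limit r b \<longleftrightarrow> b \<in> Field r \<and> (\<exists>a. (a, b) \<in> r \<and> a \<noteq> b) \<and> \<not> (\<exists>a. is_succ r a b)"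

definition below :: "'i rel \<Rightarrow> 'i \<Rightarrow> 'i set" where
  "below r b = {a. (a, b) \<in> r \<and> a \<noteq> b}"

text \<open>(L, g) is a colimit in Diff of the chain Z restricted to the index set S: the underlying set
  is the set-theoretic (directed) colimit and L carries the final diffeology.\<close>
definition diff_colim :: "'i set \<Rightarrow> 'i rel \<Rightarrow> ('i \<Rightarrow> 'z diffeology) \<Rightarrow> ('i \<Rightarrow> 'i \<Rightarrow> 'z \<Rightarrow> 'z)
    \<Rightarrow> 'x diffeology \<Rightarrow> ('i \<Rightarrow> 'z \<Rightarrow> 'x) \<Rightarrow> bool" where
  "diff_colim S r Z f L g \<longleftrightarrow>
     diffeological L \<and>
     (\<forall>a\<in>S. smooth_map (Z a) L (g a)) \<and>
     (\<forall>a\<in>S. \<forall>b\<in>S. (a, b) \<in> r \<longrightarrow> (\<forall>x\<in>dcarrier (Z a). g b (f a b x) = g a x)) \<and>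
     dcarrier L = (\<Union>a\<in>S. g a ` dcarrier (Z a)) \<and>
     (\<forall>a\<in>S. \<forall>b\<in>S. \<forall>x\<in>dcarrier (Z a). \<forall>y\<in>dcarrier (Z b).
        g a x = g b y \<longleftrightarrow> (\<exists>c\<in>S. (a, c) \<in> r \<and> (b, c) \<in> r \<and> f a c x = f b c y)) \<and>
     (\<forall>n U p. (n, U, p) \<in> dplots L \<longleftrightarrow>
        openin (euclid n) U \<and> p ` U \<subseteq> dcarrier L \<and>
        (\<forall>u\<in>U. \<exists>V. openin (euclid n) V \<and> u \<in> V \<and> V \<subseteq> U \<and>
           ((\<exists>y. \<forall>v\<in>V. p v = y) \<or> (\<exists>a\<in>S. lifts_through V n p (Z a) (g a)))))"

definition diff_pushout :: "nat \<Rightarrow> 'z diffeology \<Rightarrow> ((nat \<Rightarrow> real) \<Rightarrow> 'z) \<Rightarrow> 'x diffeology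
    \<Rightarrow> ('z \<Rightarrow> 'x) \<Rightarrow> ((nat \<Rightarrow> real) \<Rightarrow> 'x) \<Rightarrow> bool" where
  "diff_pushout n A \<phi> P i \<Phi> \<longleftrightarrow>
     diffeological P \<and>
     smooth_map (bdry_diff n) A \<phi> \<and> smooth_map A P i \<and> smooth_map (cube_diff n) P \<Phi> \<and>
     (\<forall>t\<in>bdry n. \<Phi> t = i (\<phi> t)) \<and>
     inj_on i (dcarrier A) \<and> inj_on \<Phi> (cube n - bdry n) \<and>
     i ` dcarrier A \<inter> \<Phi> ` (cube n - bdry n) = {} \<and>
     dcarrier P = i ` dcarrier A \<union> \<Phi> ` cube n \<and>
     (\<forall>k U p. (k, U, p) \<in> dplots P \<longleftrightarrow>
        openin (euclid k) U \<and> p ` U \<subseteq> dcarrier P \<and>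
        (\<forall>u\<in>U. \<exists>V. openin (euclid k) V \<and> u \<in> V \<and> V \<subseteq> U \<and>
           ((\<exists>y. \<forall>v\<in>V. p v = y) \<or> lifts_through V k p A i \<or> lifts_through V k p (cube_diff n) \<Phi>)))"

definition diff_seq :: "'i rel \<Rightarrow> ('i \<Rightarrow> 'z diffeology) \<Rightarrow> ('i \<Rightarrow> 'i \<Rightarrow> 'z \<Rightarrow> 'z) \<Rightarrow> bool" where
  "diff_seq r Z f \<longleftrightarrow>
     Well_order r \<and>
     (\<forall>a\<in>Field r. diffeological (Z a)) \<and>
     (\<forall>a b. (a, b) \<in> r \<longrightarrow> smooth_map (Z a) (Z b) (f a b)) \<and>
     (\<forall>a\<in>Field r. \<forall>x\<in>dcarrier (Z a). f a a x = x) \<and>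
     (\<forall>a b c. (a, b) \<in> r \<longrightarrow> (b, c) \<in> r \<longrightarrow> (\<forall>x\<in>dcarrier (Z a). f b c (f a b x) = f a c x)) \<and>
     (\<forall>b. is_limit r b \<longrightarrow> diff_colim (below r b) r Z f (Z b) (\<lambda>a. f a b))"

definition tame :: "nat \<Rightarrow> ((nat \<Rightarrow> real) \<Rightarrow> 'z) \<Rightarrow> bool" where
  "tame n \<phi> \<longleftrightarrow> (\<exists>\<epsilon>::real. 0 < \<epsilon> \<and> \<epsilon> \<le> 1/2 \<and>
     (\<forall>t\<in>bdry n. \<forall>j<n. \<forall>\<alpha>\<in>{0, 1}. \<bar>t j - \<alpha>\<bar> \<le> \<epsilon> \<longrightarrow> \<phi> t = \<phi> (t(j := \<alpha>))))"

definition gathered_smooth_cell_complex :: "'x diffeology \<Rightarrow> bool" where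
  "gathered_smooth_cell_complex X \<longleftrightarrow>
     (\<exists>(r :: 'x rel) (Z :: 'x \<Rightarrow> 'x diffeology) f g.
        diff_seq r Z f \<and>
        (\<forall>a. is_zero r a \<longrightarrow> dcarrier (Z a) = {}) \<and>
        diff_colim (Field r) r Z f X g \<and>
        (\<forall>a b. is_succ r a b \<longrightarrow>
           (\<exists>n \<phi> \<Phi>. diff_pushout n (Z a) \<phi> (Z b) (f a b) \<Phi> \<and> tame n \<phi>)))"

definition cube_top :: "nat \<Rightarrow> (nat \<Rightarrow> real) topology" where
  "cube_top n = subtopology euclidean (cube n)"

definition bdry_top :: "nat \<Rightarrow> (nat \<Rightarrow> real) topology" where
  "bdry_top n = subtopology euclidean (bdry n)"

definition top_colim :: "'i set \<Rightarrow> 'i rel \<Rightarrow> ('i \<Rightarrow> 'z topology) \<Rightarrow> ('i \<Rightarrow> 'i \<Rightarrow> 'z \<Rightarrow> 'z)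
    \<Rightarrow> 'x topology \<Rightarrow> ('i \<Rightarrow> 'z \<Rightarrow> 'x) \<Rightarrow> bool" where
  "top_colim S r Z f L g \<longleftrightarrow>
     (\<forall>a\<in>S. continuous_map (Z a) L (g a)) \<and>
     (\<forall>a\<in>S. \<forall>b\<in>S. (a, b) \<in> r \<longrightarrow> (\<forall>x\<in>topspace (Z a). g b (f a b x) = g a x)) \<and>
     topspace L = (\<Union>a\<in>S. g a ` topspace (Z a)) \<and>
     (\<forall>a\<in>S. \<forall>b\<in>S. \<forall>x\<in>topspace (Z a). \<forall>y\<in>topspace (Z b).
        g a x = g b y \<longleftrightarrow> (\<exists>c\<in>S. (a, c) \<in> r \<and> (b, c) \<in> r \<and> f a c x = f b c y)) \<and>
     (\<forall>V. openin L V \<longleftrightarrow> V \<subseteq> topspace L \<and>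
        (\<forall>a\<in>S. openin (Z a) {x \<in> topspace (Z a). g a x \<in> V}))"

definition top_pushout :: "nat \<Rightarrow> 'z topology \<Rightarrow> ((nat \<Rightarrow> real) \<Rightarrow> 'z) \<Rightarrow> 'x topology
    \<Rightarrow> ('z \<Rightarrow> 'x) \<Rightarrow> ((nat \<Rightarrow> real) \<Rightarrow> 'x) \<Rightarrow> bool" where
  "top_pushout n A \<phi> P i \<Phi> \<longleftrightarrow>
     continuous_map (bdry_top n) A \<phi> \<and> continuous_map A P i \<and> continuous_map (cube_top n) P \<Phi> \<and>
     (\<forall>t\<in>bdry n. \<Phi> t = i (\<phi> t)) \<and>
     inj_on i (topspace A) \<and> inj_on \<Phi> (cube n - bdry n) \<and>
     i ` topspace A \<inter> \<Phi> ` (cube n - bdry n) = {} \<and>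
     topspace P = i ` topspace A \<union> \<Phi> ` cube n \<and>
     (\<forall>V. openin P V \<longleftrightarrow> V \<subseteq> topspace P \<and>
        openin A {x \<in> topspace A. i x \<in> V} \<and> openin (cube_top n) {t \<in> cube n. \<Phi> t \<in> V})"

definition top_seq :: "'i rel \<Rightarrow> ('i \<Rightarrow> 'z topology) \<Rightarrow> ('i \<Rightarrow> 'i \<Rightarrow> 'z \<Rightarrow> 'z) \<Rightarrow> bool" where
  "top_seq r Z f \<longleftrightarrow>
     Well_order r \<and>
     (\<forall>a b. (a, b) \<in> r \<longrightarrow> continuous_map (Z a) (Z b) (f a b)) \<and>
     (\<forall>a\<in>Field r. \<forall>x\<in>topspace (Z a). f a a x = x) \<and>
     (\<forall>a b c. (a, b) \<in> r \<longrightarrow> (b, c) \<in> r \<longrightarrow> (\<forall>x\<in>topspace (Z a). f b c (f a b x) = f a c x)) \<and>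
     (\<forall>b. is_limit r b \<longrightarrow> top_colim (below r b) r Z f (Z b) (\<lambda>a. f a b))"

definition top_cell_complex :: "'i rel \<Rightarrow> ('i \<Rightarrow> 'z topology) \<Rightarrow> ('i \<Rightarrow> 'i \<Rightarrow> 'z \<Rightarrow> 'z)
    \<Rightarrow> 'x topology \<Rightarrow> ('i \<Rightarrow> 'z \<Rightarrow> 'x) \<Rightarrow> bool" where
  "top_cell_complex r Z f X g \<longleftrightarrow>
     top_seq r Z f \<and>
     (\<forall>a. is_zero r a \<longrightarrow> topspace (Z a) = {}) \<and>
     top_colim (Field r) r Z f X g \<and>
     (\<forall>a b. is_succ r a b \<longrightarrow> (\<exists>n \<phi> \<Phi>. top_pushout n (Z a) \<phi> (Z b) (f a b) \<Phi>))"

end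

theory Submission
  imports Defs
begin

text \<open>The cells of X' are kept and only their attaching maps are changed, by recursion over the cells. A third complex W with one
  cell \<open>I\<^sup>n \<times> [0,1]\<close> for each cell of X' contains X' as its bottom and the new complex X as its top: the wall \<open>\<partial>I\<^sup>n \<times> [0,1]\<close> of
  each cell is attached along a homotopy from the given attaching map to a tame smooth one. The part of W built so far deforms onto
  its top, so the given attaching map can be moved there, and there every continuous map from the boundary of a cube is homotopic
  to a tame smooth map. Both deformations of W, onto the bottom and onto the top, are defined cell by cell and extend each other, so
  they survive at limit stages; hence X' and the D-topology of X are homotopy equivalent to W.

  Smooth approximation is a relative statement proved by induction over the highest cell met by a map from a compact set, with
  polynomial approximation inside that cell. Tameness enters by allowing a collar of a cell to be
  pushed onto its boundary without moving the image of the boundary, and by making the attaching maps extend smoothly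
  off the boundary.\<close>

section \<open>Smooth functions of several variables\<close>

text \<open>The obstacle at limits is coherence: homotopy equivalences picked one stage at a time
  need not agree strictly. In W the only choices are the wall maps; both deformations are then
  forced by one formula, projection from a point beyond the far end of each cylinder, above its
  centre.

  A map into a complex is smooth when it lifts near each point to one closed cell. What makes
  approximation hard is the passage from the interior of the top cell c to the lower stage A, where
  lifts to c and to a lower cell would have to be reconciled. Pushing a collar of c onto its
  boundary removes this passage: the preimage T of A grows, and each point on the frontier of T is
  either one where the map was smooth before, or one in the part of c where the map is given by
  polynomials. So the map is smooth along the frontier already, and T can be treated by induction
  relative to it. The push is compatible with the attaching map of c because that map is tame, which
  is why tameness has to be built in during the recursion.\<close>

lemma openin_euclid_iff: "openin (euclid n) U \<longleftrightarrow> (\<exists>T. open T \<and> U = euc n \<inter> T)"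
  by (auto simp: euclid_def openin_open)

lemma continuous_on_coord: "continuous_on S (\<lambda>x. (x i::real))"
  by (rule continuous_on_subset[OF continuous_on_product_coordinates]) auto

lemma continuous_on_fun_upd_line:
  "continuous_on UNIV (\<lambda>t. (x::nat \<Rightarrow> real)(i := t))"
proof (rule continuous_on_coordinatewise_then_product)
  fix j show "continuous_on UNIV (\<lambda>t. (x(i := t)) j)" by (cases "j = i") auto
qed

lemma partial_shift:
  "((\<lambda>h. g (x(i := x i + h))) has_real_derivative d) (at 0) \<longleftrightarrow>
   ((\<lambda>t. g ((x::nat \<Rightarrow> real)(i := t))) has_real_derivative d) (at (x i))"
  using DERIV_shift[of "\<lambda>t. g (x(i := t))" d 0 "x i"] by (simp add: add.commute)

lemma eventually_line_in_open:
  assumes "openin (euclid k) V" "x \<in> V" "i < k"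
  shows "eventually (\<lambda>t. x(i := t) \<in> V) (nhds (x i))"
proof -
  obtain T where T: "open T" "V = euc k \<inter> T" using assms(1) openin_euclid_iff by blast
  have "open ((\<lambda>t. x(i := t)) -` T)"
    using continuous_open_vimage[OF T(1), of "\<lambda>t. x(i := t)"] continuous_on_fun_upd_line[of x i]
    by (metis T(1) continuous_on_open_vimage open_UNIV inf_top.right_neutral)
  moreover have "x i \<in> (\<lambda>t. x(i := t)) -` T" using assms T by simp
  moreover have "x(i := t) \<in> euc k" for t using assms T by (auto simp: euc_def)
  ultimately show ?thesis unfolding eventually_nhds using T by (intro exI[of _ "(\<lambda>t. x(i := t)) -` T"]) auto
qed

text \<open>A basic open set of the product topology gives a radius for every coordinate. Points of
  \<open>euc n\<close> all vanish from index \<open>n\<close> on, so only the first \<open>n\<close>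
  radii matter and their minimum works.\<close>

lemma open_contains_box:
  assumes "openin (euclid n) U" "x \<in> U"
  obtains e where "e > 0" "\<And>y. y \<in> euc n \<Longrightarrow> (\<And>j. j < n \<Longrightarrow> \<bar>y j - x j\<bar> < e) \<Longrightarrow> y \<in> U"
proof -
  obtain T where T: "open T" "U = euc n \<inter> T" using assms(1) openin_euclid_iff by blast
  have "openin (product_topology (\<lambda>i::nat. euclidean::real topology) UNIV) T"
    using T(1) by (simp add: euclidean_product_topology)
  moreover have "x \<in> T" using assms(2) T(2) by auto
  ultimately obtain W where W: "\<And>i. open (W i)" "x \<in> Pi\<^sub>E UNIV W" "Pi\<^sub>E UNIV W \<subseteq> T"
    unfolding openin_product_topology_alt by (metis UNIV_I open_openin)
  have "\<exists>e>0. \<forall>y. \<bar>y - x j\<bar> < e \<longrightarrow> y \<in> W j" for j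
  proof -
    have "x j \<in> W j" using W(2) by auto
    then show ?thesis using W(1)[of j] unfolding open_dist dist_real_def by blast
  qed
  then obtain E where E: "\<And>j. E j > 0" "\<And>j y. \<bar>y - x j\<bar> < E j \<Longrightarrow> y \<in> W j" by metis
  \<comment> \<open>The inserted 1 keeps the minimum defined when \<open>n\<close> is 0.\<close>
  define e where "e = Min (insert 1 (E ` {..<n}))"
  have "e > 0" unfolding e_def using E(1) by (subst Min_gr_iff) auto
  moreover have le: "e \<le> E j" if "j < n" for j unfolding e_def using that by (intro Min_le) auto
  moreover have "y \<in> U" if y: "y \<in> euc n" "\<And>j. j < n \<Longrightarrow> \<bar>y j - x j\<bar> < e" for y
  proof -
    have "y j \<in> W j" for j
    proof (cases "j < n")
      case True then show ?thesis using E(2) y(2) le by fastforce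
    next
      case False
      then have "y j = x j" using y(1) assms(2) T(2) by (auto simp: euc_def)
      then show ?thesis using W(2) by auto
    qed
    then show ?thesis using W(3) T(2) y(1) by auto
  qed
  ultimately show ?thesis using that by blast
qed

section \<open>The chain rule from continuous partial derivatives\<close>

lemma mean_value_between:
  fixes f f' :: "real \<Rightarrow> real"
  assumes "\<And>t. min a b \<le> t \<Longrightarrow> t \<le> max a b \<Longrightarrow> (f has_real_derivative f' t) (at t)"
  shows "\<exists>z. \<bar>z - a\<bar> \<le> \<bar>b - a\<bar> \<and> min a b \<le> z \<and> z \<le> max a b \<and> f b - f a = f' z * (b - a)"
proof -
  consider "a = b" | "a < b" | "b < a" by linarith
  then show ?thesis
  proof cases
    case 2
    then obtain z where "a < z" "z < b" "f b - f a = (b - a) * f' z"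
      using MVT2[of a b f f'] assms by auto
    then show ?thesis using 2 by (intro exI[of _ z]) (auto simp: algebra_simps)
  next
    case 3
    then obtain z where "b < z" "z < a" "f a - f b = (a - b) * f' z"
      using MVT2[of b a f f'] assms by auto
    then show ?thesis using 3 by (intro exI[of _ z]) (auto simp: algebra_simps)
  qed auto
qed

text \<open>The ambient function space carries no norm here, so the argument uses partial
  derivatives alone: pass from \<open>c 0\<close> to \<open>c h\<close> by changing one coordinate
  at a time, apply the mean value theorem to each change, and let the intermediate points converge,
  using continuity of the partials.\<close>

lemma chain_rule_partials:
  fixes G :: "(nat \<Rightarrow> real) \<Rightarrow> real" and G' :: "nat \<Rightarrow> (nat \<Rightarrow> real) \<Rightarrow> real" and c :: "real \<Rightarrow> nat \<Rightarrow> real"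
  assumes U: "openin (euclid n) U"
    and G: "\<And>j y. j < n \<Longrightarrow> y \<in> U \<Longrightarrow> ((\<lambda>h. G (y(j := y j + h))) has_real_derivative G' j y) (at 0)"
    and G'c: "\<And>j. j < n \<Longrightarrow> continuous_on U (G' j)"
    and c0: "c 0 \<in> U" and ev: "eventually (\<lambda>h. c h \<in> U) (nhds 0)"
    and c': "\<And>j. j < n \<Longrightarrow> ((\<lambda>h. c h j) has_real_derivative d j) (at 0)"
  shows "((\<lambda>h. G (c h)) has_real_derivative (\<Sum>j<n. G' j (c 0) * d j)) (at 0)"
proof -
  define x where "x = c 0"
  have xU: "x \<in> U" using c0 x_def by simp
  obtain e where e: "e > 0" "\<And>y. y \<in> euc n \<Longrightarrow> (\<And>j. j < n \<Longrightarrow> \<bar>y j - x j\<bar> < e) \<Longrightarrow> y \<in> U"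
    using open_contains_box[OF U xU] by blast
  have Ue: "U \<subseteq> euc n" using U openin_euclid_iff by auto
  have xe: "x j = 0" if "j \<ge> n" for j using xU Ue that by (auto simp: euc_def)
  have key: "\<exists>p. (\<forall>m<n. p m \<in> U \<and> (\<forall>i. \<bar>p m i - x i\<bar> \<le> \<bar>y i - x i\<bar>)) \<and> G y - G x = (\<Sum>m<n. G' m (p m) * (y m - x m))"
    if y: "y \<in> euc n" "\<And>j. j < n \<Longrightarrow> \<bar>y j - x j\<bar> < e" for y
  proof -
    define z where "z m = (\<lambda>i. if i < m then y i else x i)" for m
    have zs: "z (Suc m) = (z m)(m := y m)" "z m m = x m" for m by (auto simp: z_def fun_eq_iff)
    have step: "\<exists>p. p \<in> U \<and> (\<forall>i. \<bar>p i - x i\<bar> \<le> \<bar>y i - x i\<bar>) \<and> G (z (Suc m)) - G (z m) = G' m p * (y m - x m)"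
      if m: "m < n" for m
    proof -
      have inU: "(z m)(m := t) \<in> U \<and> (\<forall>i. \<bar>((z m)(m := t)) i - x i\<bar> \<le> \<bar>y i - x i\<bar>)"
        if t: "min (x m) (y m) \<le> t" "t \<le> max (x m) (y m)" for t
      proof
        have tt: "\<bar>t - x m\<bar> \<le> \<bar>y m - x m\<bar>" using t by linarith
        show "\<forall>i. \<bar>((z m)(m := t)) i - x i\<bar> \<le> \<bar>y i - x i\<bar>" using tt by (auto simp: z_def)
        show "(z m)(m := t) \<in> U"
        proof (rule e(2))
          show "(z m)(m := t) \<in> euc n" using y(1) xe m by (auto simp: euc_def z_def)
        next
          fix j assume "j < n" then show "\<bar>((z m)(m := t)) j - x j\<bar> < e"
            using y(2)[of j] tt e(1) by (auto simp: z_def)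
        qed
      qed
      have "\<exists>w. \<bar>w - x m\<bar> \<le> \<bar>y m - x m\<bar> \<and> min (x m) (y m) \<le> w \<and> w \<le> max (x m) (y m) \<and>
         G ((z m)(m := y m)) - G ((z m)(m := x m)) = G' m ((z m)(m := w)) * (y m - x m)"
      proof (rule mean_value_between)
        fix t assume "min (x m) (y m) \<le> t" "t \<le> max (x m) (y m)"
        then have "(z m)(m := t) \<in> U" using inU by blast
        from G[OF m this] show "((\<lambda>t. G ((z m)(m := t))) has_real_derivative G' m ((z m)(m := t))) (at t)"
          unfolding partial_shift by simp
      qed
      then obtain w where w: "min (x m) (y m) \<le> w" "w \<le> max (x m) (y m)"
         "G ((z m)(m := y m)) - G ((z m)(m := x m)) = G' m ((z m)(m := w)) * (y m - x m)" by blast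
      have "(z m)(m := x m) = z m" using zs(2)[of m] by (auto simp: fun_eq_iff)
      then show ?thesis using w inU[OF w(1,2)] zs(1)[of m] by auto
    qed
    then obtain p where p: "\<And>m. m < n \<Longrightarrow> p m \<in> U \<and> (\<forall>i. \<bar>p m i - x i\<bar> \<le> \<bar>y i - x i\<bar>) \<and> G (z (Suc m)) - G (z m) = G' m (p m) * (y m - x m)"
      by metis
    have "z n = y" using y(1) xe by (auto simp: z_def fun_eq_iff euc_def)
    moreover have "z 0 = x" by (auto simp: z_def)
    moreover have "G (z n) - G (z 0) = (\<Sum>m<n. G (z (Suc m)) - G (z m))"
      by (rule sum_lessThan_telescope[symmetric])
    ultimately have "G y - G x = (\<Sum>m<n. G' m (p m) * (y m - x m))" using p by simp
    then show ?thesis using p by blast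
  qed
  have cont_c: "((\<lambda>h. c h j) \<longlongrightarrow> x j) (at 0)" if "j < n" for j
    using DERIV_isCont[OF c'[OF that]] unfolding isCont_def x_def by simp
  have ev_box: "eventually (\<lambda>h. \<forall>j\<in>{..<n}. \<bar>c h j - x j\<bar> < e) (at 0)"
    by (intro eventually_ball_finite ballI) (use cont_c e(1) in \<open>auto simp: tendsto_iff dist_real_def\<close>)
  have ev': "eventually (\<lambda>h. c h \<in> U) (at 0)" using ev by (simp add: eventually_nhds_conv_at)
  \<comment> \<open>The intermediate points are chosen for every \<open>h\<close>, with default
    \<open>x\<close> when \<open>c h\<close> is not in the box. They thus always lie in
    \<open>U\<close>, and the limit at 0 can be taken without restricting the filter.\<close>
  have "\<exists>p. \<forall>m<n. p m \<in> U \<and> (c h \<in> U \<and> (\<forall>j\<in>{..<n}. \<bar>c h j - x j\<bar> < e) \<longrightarrow> (\<forall>i. \<bar>p m i - x i\<bar> \<le> \<bar>c h i - x i\<bar>) \<and> 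
      G (c h) - G x = (\<Sum>m<n. G' m (p m) * (c h m - x m)))" for h
  proof (cases "c h \<in> U \<and> (\<forall>j\<in>{..<n}. \<bar>c h j - x j\<bar> < e)")
    case True
    then have "c h \<in> euc n" using Ue by auto
    from key[OF this] True show ?thesis by blast
  next
    case False then show ?thesis using xU by (intro exI[of _ "\<lambda>_. x"]) auto
  qed
  then have "\<exists>p. \<forall>h. \<forall>m<n. p h m \<in> U \<and> (c h \<in> U \<and> (\<forall>j\<in>{..<n}. \<bar>c h j - x j\<bar> < e) \<longrightarrow> (\<forall>i. \<bar>p h m i - x i\<bar> \<le> \<bar>c h i - x i\<bar>) \<and>
      G (c h) - G x = (\<Sum>m<n. G' m (p h m) * (c h m - x m)))" by (intro choice allI)
  then obtain p where p: "\<And>h m. m < n \<Longrightarrow> p h m \<in> U \<and> (c h \<in> U \<and> (\<forall>j\<in>{..<n}. \<bar>c h j - x j\<bar> < e) \<longrightarrow> (\<forall>i. \<bar>p h m i - x i\<bar> \<le> \<bar>c h i - x i\<bar>) \<and>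
      G (c h) - G x = (\<Sum>m<n. G' m (p h m) * (c h m - x m)))" by blast
  have ptend: "((\<lambda>h. p h m) \<longlongrightarrow> x) (at 0)" if m: "m < n" for m
  proof -
    have "((\<lambda>h. p h m i) \<longlongrightarrow> x i) (at 0)" for i
    proof (cases "i < n")
      case True
      have "((\<lambda>h. c h i - x i) \<longlongrightarrow> 0) (at 0)" using cont_c[OF True] by (simp add: LIM_zero)
      then have "((\<lambda>h. p h m i - x i) \<longlongrightarrow> 0) (at 0)"
      proof (rule Lim_null_comparison[rotated, OF tendsto_rabs_zero])
        show "\<forall>\<^sub>F h in at 0. norm (p h m i - x i) \<le> \<bar>c h i - x i\<bar>"
          using ev_box ev' by eventually_elim (use p[OF m] in auto)
      qed
      then show ?thesis by (simp add: LIM_zero_cancel)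
    next
      case False
      then have "p h m i = x i" for h using p[OF m, of h] Ue xe by (auto simp: euc_def)
      then show ?thesis by simp
    qed
    then show ?thesis
      using limitin_componentwise[of "\<lambda>_. euclidean::real topology" UNIV "\<lambda>h. p h m" x "at 0"]
      by (simp add: euclidean_product_topology)
  qed
  have G't: "((\<lambda>h. G' m (p h m)) \<longlongrightarrow> G' m x) (at 0)" if m: "m < n" for m
    using continuous_on_tendsto_compose[OF G'c[OF m] ptend[OF m] xU] p[OF m] by simp
  have "((\<lambda>h. (\<Sum>m<n. G' m (p h m) * ((c h m - c 0 m) / h))) \<longlongrightarrow> (\<Sum>m<n. G' m x * d m)) (at 0)"
    by (intro tendsto_sum tendsto_mult G't) (use c' in \<open>auto simp: has_field_derivative_iff\<close>)
  then have "((\<lambda>h. (G (c h) - G (c 0)) / h) \<longlongrightarrow> (\<Sum>m<n. G' m x * d m)) (at 0)"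
  proof (rule Lim_transform_eventually)
    show "\<forall>\<^sub>F h in at 0. (\<Sum>m<n. G' m (p h m) * ((c h m - c 0 m) / h)) = (G (c h) - G (c 0)) / h"
      using ev_box ev'
    proof eventually_elim
      case (elim h)
      show ?case
      \<comment> \<open>The telescoping identity was recorded under some index \<open>m < n\<close>,
        hence says nothing for \<open>n = 0\<close>; there \<open>euc 0\<close> is a single point
        and both sides vanish.\<close>
      proof (cases "n = 0")
        case True
        then have "c h \<in> euc 0" "c 0 \<in> euc 0" using elim(2) xU Ue by (auto simp: x_def)
        then have "c h = c 0" by (auto simp: euc_def fun_eq_iff)
        then show ?thesis using True by simp
      next
        case False
        then have "G (c h) - G x = (\<Sum>m<n. G' m (p h m) * (c h m - x m))" using p[of 0 h] elim by auto
        then show ?thesis by (simp add: x_def sum_divide_distrib)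
      qed
    qed
  qed
  then show ?thesis by (simp add: has_field_derivative_iff x_def)
qed

text \<open>Choosing one derivative inside \<open>S\<close> for each function and index, and
  iterating the choice along a list of indices, yields the family \<open>D\<close> that smoothness
  asks for. Smoothness is thus proved by exhibiting a class closed under partial
  derivatives.\<close>

lemma smooth_funI:
  assumes "g \<in> S" "\<And>g. g \<in> S \<Longrightarrow> continuous_on V g"
    and "\<And>g i. g \<in> S \<Longrightarrow> i < k \<Longrightarrow> \<exists>g'\<in>S. \<forall>x\<in>V. ((\<lambda>h. g (x(i := x i + h))) has_real_derivative g' x) (at 0)"
  shows "smooth_fun k V g"
proof -
  obtain N where N: "\<And>g i. g \<in> S \<Longrightarrow> i < k \<Longrightarrow> N g i \<in> S \<and> (\<forall>x\<in>V. ((\<lambda>h. g (x(i := x i + h))) has_real_derivative N g i x) (at 0))"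
    using assms(3) by metis
  define D where "D ks = foldr (\<lambda>i g. if i < k then N g i else g) ks g" for ks
  have DS: "D ks \<in> S" for ks by (induction ks) (use assms(1) N in \<open>auto simp: D_def\<close>)
  have "((\<lambda>h. D ks (x(i := x i + h))) has_real_derivative D (i # ks) x) (at 0)" if "i < k" "x \<in> V" for ks i x
    using N[OF DS that(1), of ks] that by (simp add: D_def)
  moreover have "D [] = g" by (simp add: D_def)
  ultimately show ?thesis unfolding smooth_fun_def using DS assms(2) by (intro exI[of _ D]) auto
qed

lemma smooth_fun_continuous: "smooth_fun k V g \<Longrightarrow> continuous_on V g"
  unfolding smooth_fun_def by (metis continuous_on_cong)

lemma smooth_fun_partial:
  assumes V: "openin (euclid k) V" and "smooth_fun k V g" "i < k"
  shows "\<exists>g'. smooth_fun k V g' \<and> (\<forall>x\<in>V. ((\<lambda>h. g (x(i := x i + h))) has_real_derivative g' x) (at 0))"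
proof -
  obtain D where D: "\<And>x. x \<in> V \<Longrightarrow> D [] x = g x" "\<And>ks. continuous_on V (D ks)"
    "\<And>ks i x. i < k \<Longrightarrow> x \<in> V \<Longrightarrow> ((\<lambda>h. D ks (x(i := x i + h))) has_real_derivative D (i # ks) x) (at 0)"
    using assms(2) unfolding smooth_fun_def by metis
  have "smooth_fun k V (D [i])"
    \<comment> \<open>New differentiations enter at the front of the list, so the one already
      performed sits at its end.\<close>
    unfolding smooth_fun_def by (rule exI[of _ "\<lambda>ks. D (ks @ [i])"]) (use D in auto)
  moreover have "((\<lambda>h. g (x(i := x i + h))) has_real_derivative D [i] x) (at 0)" if x: "x \<in> V" for x
  proof -
    have "((\<lambda>t. D [] (x(i := t))) has_real_derivative D [i] x) (at (x i))"
      using D(3)[OF assms(3) x, of "[]"] by (simp add: partial_shift)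
    \<comment> \<open>\<open>D []\<close> agrees with \<open>g\<close> only on \<open>V\<close>, so
      a short segment through \<open>x\<close> has to stay in \<open>V\<close> before the derivative
      can be transferred.\<close>
    moreover have "eventually (\<lambda>t. D [] (x(i := t)) = g (x(i := t))) (nhds (x i))"
      using eventually_line_in_open[OF V x assms(3)] by eventually_elim (use D(1) in auto)
    ultimately have "((\<lambda>t. g (x(i := t))) has_real_derivative D [i] x) (at (x i))"
      using DERIV_cong_ev[OF refl _ refl, of "\<lambda>t. D [] (x(i := t))" "\<lambda>t. g (x(i := t))" "x i"] by simp
    then show ?thesis by (simp add: partial_shift)
  qed
  ultimately show ?thesis by blast
qed

lemma smooth_fun_subset: "smooth_fun k V g \<Longrightarrow> V' \<subseteq> V \<Longrightarrow> smooth_fun k V' g"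
  unfolding smooth_fun_def by (elim ex_forward) (auto intro: continuous_on_subset)

lemma smooth_fun_const [simp]: "smooth_fun k V (\<lambda>_. c)"
  by (rule smooth_funI[of _ "range (\<lambda>c _. c)"]) (auto intro: exI[of _ "0::real"])

lemma smooth_fun_coord [simp]: "smooth_fun k V (\<lambda>x. x j)"
proof (rule smooth_funI[of _ "insert (\<lambda>x. x j) (range (\<lambda>c _. c))"])
  fix g :: "(nat \<Rightarrow> real) \<Rightarrow> real" and i
  assume g: "g \<in> insert (\<lambda>x. x j) (range (\<lambda>c _. c))"
  have "((\<lambda>h. x j + h) has_real_derivative 1) (at 0)" for x :: "nat \<Rightarrow> real" by (auto intro!: derivative_eq_intros)
  then show "\<exists>g'\<in>insert (\<lambda>x. x j) (range (\<lambda>c _. c)). \<forall>x\<in>V. ((\<lambda>h. g (x(i := x i + h))) has_real_derivative g' x) (at 0)"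
    using g by (cases "i = j") (auto intro: exI[of _ "0::real"] exI[of _ "1::real"])
qed (auto intro: continuous_on_coord)

text \<open>The closure of smooth functions and of composites with a smooth map under sums and products
  is closed under partial derivatives, by the chain rule; this yields smoothness of all its members.\<close>
inductive_set smooth_closure :: "nat \<Rightarrow> (nat \<Rightarrow> real) set \<Rightarrow> nat \<Rightarrow> (nat \<Rightarrow> real) set \<Rightarrow> ((nat \<Rightarrow> real) \<Rightarrow> nat \<Rightarrow> real) \<Rightarrow> ((nat \<Rightarrow> real) \<Rightarrow> real) set"
  for k V n U F where
  "smooth_fun k V g \<Longrightarrow> g \<in> smooth_closure k V n U F"
| "smooth_fun n U g \<Longrightarrow> (\<lambda>x. g (F x)) \<in> smooth_closure k V n U F"
| "g \<in> smooth_closure k V n U F \<Longrightarrow> h \<in> smooth_closure k V n U F \<Longrightarrow> (\<lambda>x. g x + h x) \<in> smooth_closure k V n U F"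
| "g \<in> smooth_closure k V n U F \<Longrightarrow> h \<in> smooth_closure k V n U F \<Longrightarrow> (\<lambda>x. g x * h x) \<in> smooth_closure k V n U F"

lemma smooth_closure_sum:
  assumes "\<And>j. j < m \<Longrightarrow> g j \<in> smooth_closure k V n U F"
  shows "(\<lambda>x. \<Sum>j<(m::nat). g j x) \<in> smooth_closure k V n U F"
  using assms by (induction m) (auto intro: smooth_closure.intros)

lemma continuous_on_euc_map:
  assumes "F ` V \<subseteq> euc n" "\<And>j. j < n \<Longrightarrow> continuous_on V (\<lambda>x. F x j)"
  shows "continuous_on V F"
proof (rule continuous_on_coordinatewise_then_product)
  fix j show "continuous_on V (\<lambda>x. F x j)"
  proof (cases "j < n")
    case False
    then have "\<And>x. x \<in> V \<Longrightarrow> F x j = 0" using assms(1) by (auto simp: euc_def)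
    then show ?thesis by (metis (no_types, lifting) continuous_on_cong continuous_on_const)
  qed (use assms in auto)
qed

lemma smooth_map_eu_continuous: "smooth_map_eu k V n F \<Longrightarrow> continuous_on V F"
proof (rule continuous_on_euc_map[of F V n])
  assume F: "smooth_map_eu k V n F"
  then show "F ` V \<subseteq> euc n" by (simp add: smooth_map_eu_def)
  fix j assume "j < n"
  with F have "smooth_fun k V (\<lambda>x. F x j)" by (simp add: smooth_map_eu_def)
  then show "continuous_on V (\<lambda>x. F x j)" by (rule smooth_fun_continuous)
qed

lemma smooth_closure_smooth:
  assumes V: "openin (euclid k) V" and U: "openin (euclid n) U" and F: "smooth_map_eu k V n F" "F ` V \<subseteq> U"
    and g: "g \<in> smooth_closure k V n U F"
  shows "smooth_fun k V g"
proof (rule smooth_funI[OF g])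
  fix g assume "g \<in> smooth_closure k V n U F"
  then show "continuous_on V g"
  proof induction
    case (2 g)
    show ?case by (rule continuous_on_compose2[OF smooth_fun_continuous[OF 2] smooth_map_eu_continuous[OF F(1)] F(2)])
  qed (auto intro: smooth_fun_continuous continuous_intros)
next
  fix g i assume g: "g \<in> smooth_closure k V n U F" and i: "i < k"
  show "\<exists>g'\<in>smooth_closure k V n U F. \<forall>x\<in>V. ((\<lambda>h. g (x(i := x i + h))) has_real_derivative g' x) (at 0)"
    using g
  proof induction
    case (1 g)
    then show ?case using smooth_fun_partial[OF V _ i] smooth_closure.intros(1) by meson
  next
    case (2 g)
    obtain G' where G': "\<And>j. j < n \<Longrightarrow> smooth_fun n U (G' j)"
      "\<And>j x. j < n \<Longrightarrow> x \<in> U \<Longrightarrow> ((\<lambda>h. g (x(j := x j + h))) has_real_derivative G' j x) (at 0)"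
      using smooth_fun_partial[OF U 2] by metis
    obtain F' where F': "\<And>j. j < n \<Longrightarrow> smooth_fun k V (F' j)"
      "\<And>j x. j < n \<Longrightarrow> x \<in> V \<Longrightarrow> ((\<lambda>h. F (x(i := x i + h)) j) has_real_derivative F' j x) (at 0)"
    proof -
      have "\<forall>j. \<exists>f'. j < n \<longrightarrow> smooth_fun k V f' \<and> (\<forall>x\<in>V. ((\<lambda>h. F (x(i := x i + h)) j) has_real_derivative f' x) (at 0))"
      proof
        fix j show "\<exists>f'. j < n \<longrightarrow> smooth_fun k V f' \<and> (\<forall>x\<in>V. ((\<lambda>h. F (x(i := x i + h)) j) has_real_derivative f' x) (at 0))"
          using smooth_fun_partial[OF V _ i, of "\<lambda>x. F x j"] F(1) unfolding smooth_map_eu_def by (cases "j < n") auto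
      qed
      from choice[OF this] show ?thesis using that by blast
    qed
    have "(\<lambda>x. G' j (F x) * F' j x) \<in> smooth_closure k V n U F" if "j < n" for j
      by (rule smooth_closure.intros(4)[OF smooth_closure.intros(2) smooth_closure.intros(1)]) (use G' F' that in auto)
    then have "(\<lambda>x. \<Sum>j<n. G' j (F x) * F' j x) \<in> smooth_closure k V n U F"
      by (intro smooth_closure_sum)
    moreover have "((\<lambda>h. g (F (x(i := x i + h)))) has_real_derivative (\<Sum>j<n. G' j (F x) * F' j x)) (at 0)" if x: "x \<in> V" for x
    proof -
      have "((\<lambda>h. g (F (x(i := x i + h)))) has_real_derivative (\<Sum>j<n. G' j (F (x(i := x i + 0))) * F' j x)) (at 0)"
      proof (rule chain_rule_partials[OF U G'(2)])
        show "F (x(i := x i + 0)) \<in> U" using x F(2) by auto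
        have "\<forall>\<^sub>F t in nhds (x i). x(i := t) \<in> V" by (rule eventually_line_in_open[OF V x i])
        then have "\<forall>\<^sub>F h in nhds 0. x(i := x i + h) \<in> V"
          unfolding eventually_nhds_metric dist_real_def
          by (metis (no_types, opaque_lifting) add.commute add_diff_cancel_right' diff_zero)
        then show "\<forall>\<^sub>F h in nhds 0. F (x(i := x i + h)) \<in> U"
          by (rule eventually_mono) (use F(2) in auto)
        show "continuous_on U (G' j)" if "j < n" for j using G'(1)[OF that] by (rule smooth_fun_continuous)
        show "((\<lambda>h. F (x(i := x i + h)) j) has_real_derivative F' j x) (at 0)" if "j < n" for j
          using F'(2)[OF that x] .
      qed
      then show ?thesis by simp
    qed
    ultimately show ?case by (intro bexI[of _ "\<lambda>x. \<Sum>j<n. G' j (F x) * F' j x"] ballI)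
  next
    case (3 g h)
    then obtain g' h' where *: "g' \<in> smooth_closure k V n U F" "h' \<in> smooth_closure k V n U F"
      "\<And>x. x \<in> V \<Longrightarrow> ((\<lambda>h. g (x(i := x i + h))) has_real_derivative g' x) (at 0)"
      "\<And>x. x \<in> V \<Longrightarrow> ((\<lambda>t. h (x(i := x i + t))) has_real_derivative h' x) (at 0)" by blast
    show ?case
    proof (intro bexI[of _ "\<lambda>x. g' x + h' x"] ballI)
      show "((\<lambda>t. g (x(i := x i + t)) + h (x(i := x i + t))) has_real_derivative g' x + h' x) (at 0)" if "x \<in> V" for x
        by (rule DERIV_add[OF *(3)[OF that] *(4)[OF that]])
    qed (rule smooth_closure.intros(3)[OF *(1,2)])
  next
    case (4 g h)
    then obtain g' h' where *: "g' \<in> smooth_closure k V n U F" "h' \<in> smooth_closure k V n U F"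
      "\<And>x. x \<in> V \<Longrightarrow> ((\<lambda>h. g (x(i := x i + h))) has_real_derivative g' x) (at 0)"
      "\<And>x. x \<in> V \<Longrightarrow> ((\<lambda>t. h (x(i := x i + t))) has_real_derivative h' x) (at 0)" by blast
    have "((\<lambda>t. g (x(i := x i + t)) * h (x(i := x i + t))) has_real_derivative g' x * h x + h' x * g x) (at 0)" if "x \<in> V" for x
      using DERIV_mult[OF *(3)[OF that] *(4)[OF that]] by simp
    moreover have "(\<lambda>x. g' x * h x + h' x * g x) \<in> smooth_closure k V n U F"
      by (intro smooth_closure.intros(3) smooth_closure.intros(4)[OF *(1) 4(2)] smooth_closure.intros(4)[OF *(2) 4(1)])
    ultimately show ?case by (intro bexI[of _ "\<lambda>x. g' x * h x + h' x * g x"] ballI)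
  qed
qed

section \<open>Closure properties of smooth functions and maps\<close>

lemma smooth_fun_compose:
  assumes "openin (euclid k) V" "openin (euclid n) U" "smooth_map_eu k V n F" "F ` V \<subseteq> U" "smooth_fun n U g"
  shows "smooth_fun k V (\<lambda>x. g (F x))"
  using smooth_closure_smooth[OF assms(1-4)] assms(5) smooth_closure.intros(2) by blast

lemma openin_euclid_euc [simp]: "openin (euclid n) (euc n)"
  by (simp add: euclid_def)

lemma smooth_fun_add:
  assumes V: "openin (euclid k) V" and "smooth_fun k V f" "smooth_fun k V g"
  shows "smooth_fun k V (\<lambda>x. f x + g x)" and "smooth_fun k V (\<lambda>x. f x * g x)"
proof -
  have F: "smooth_map_eu k V k (\<lambda>x. x)" "(\<lambda>x. x) ` V \<subseteq> V"
    using V by (auto simp: smooth_map_eu_def openin_euclid_iff)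
  have "f \<in> smooth_closure k V k V (\<lambda>x. x)" "g \<in> smooth_closure k V k V (\<lambda>x. x)"
    using assms by (auto intro: smooth_closure.intros)
  then show "smooth_fun k V (\<lambda>x. f x + g x)" "smooth_fun k V (\<lambda>x. f x * g x)"
    using smooth_closure_smooth[OF V V F] by (blast intro: smooth_closure.intros)+
qed

lemmas smooth_fun_mult = smooth_fun_add(2)

lemma smooth_fun_diff:
  assumes V: "openin (euclid k) V" and "smooth_fun k V f" "smooth_fun k V g"
  shows "smooth_fun k V (\<lambda>x. f x - g x)"
  using smooth_fun_add(1)[OF V assms(2) smooth_fun_mult[OF V smooth_fun_const[of k V "-1"] assms(3)]] by simp

lemma smooth_fun_prod:
  assumes V: "openin (euclid k) V" and "\<And>j. j < m \<Longrightarrow> smooth_fun k V (f j)"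
  shows "smooth_fun k V (\<lambda>x. \<Prod>j<(m::nat). f j x)"
  using assms(2) by (induction m) (auto intro!: smooth_fun_mult[OF V])

lemma smooth_map_eu_compose:
  assumes "openin (euclid k) V" "openin (euclid n) U" "smooth_map_eu k V n F" "F ` V \<subseteq> U" "smooth_map_eu n U m G"
  shows "smooth_map_eu k V m (\<lambda>x. G (F x))"
  using smooth_fun_compose[OF assms(1-4)] assms(4,5) unfolding smooth_map_eu_def by blast

lemma smooth_map_eu_subset: "smooth_map_eu k V n F \<Longrightarrow> V' \<subseteq> V \<Longrightarrow> smooth_map_eu k V' n F"
  unfolding smooth_map_eu_def using smooth_fun_subset by blast

definition smooth_real :: "(real \<Rightarrow> real) \<Rightarrow> bool" where
  "smooth_real f \<longleftrightarrow> smooth_fun 1 (euc 1) (\<lambda>x. f (x 0))"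

lemma smooth_fun_real_compose:
  assumes V: "openin (euclid k) V" and "smooth_real f" "smooth_fun k V g"
  shows "smooth_fun k V (\<lambda>x. f (g x))"
proof -
  let ?F = "\<lambda>x (i::nat). if i = 0 then g x else 0"
  have F: "smooth_map_eu k V 1 ?F" "?F ` V \<subseteq> euc 1"
    using assms(3) by (auto simp: smooth_map_eu_def euc_def)
  from smooth_fun_compose[OF V openin_euclid_euc F assms(2)[unfolded smooth_real_def]]
  show ?thesis by simp
qed

lemma smooth_realI:
  assumes "f \<in> S" "\<And>g. g \<in> S \<Longrightarrow> \<exists>g'\<in>S. \<forall>x. (g has_real_derivative g' x) (at x)"
  shows "smooth_real f"
  unfolding smooth_real_def
proof (rule smooth_funI[of _ "(\<lambda>g x. g (x 0)) ` S"])
  fix g :: "(nat \<Rightarrow> real) \<Rightarrow> real" assume "g \<in> (\<lambda>g x. g (x 0)) ` S"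
  then obtain g0 where g0: "g0 \<in> S" "g = (\<lambda>x. g0 (x 0))" by auto
  obtain g' where g': "g' \<in> S" "\<And>x. (g0 has_real_derivative g' x) (at x)" using assms(2)[OF g0(1)] by blast
  have "continuous_on UNIV g0" using g'(2) by (meson DERIV_isCont continuous_at_imp_continuous_on)
  then show "continuous_on (euc 1) g" unfolding g0(2)
    by (rule continuous_on_compose2[OF _ continuous_on_coord]) auto
  fix i :: nat assume i: "i < 1"
  have "((\<lambda>h. g0 (a + h)) has_real_derivative g' a) (at 0)" for a
    using DERIV_shift[of g0 "g' a" 0 a] g'(2)[of a] by (simp add: add.commute)
  then show "\<exists>g'\<in>(\<lambda>g x. g (x 0)) ` S. \<forall>x\<in>euc 1. ((\<lambda>h. g (x(i := x i + h))) has_real_derivative g' x) (at 0)"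
    using i g'(1) by (intro bexI[of _ "\<lambda>x. g' (x 0)"]) (auto simp: g0(2))
qed (use assms in auto)

section \<open>Smooth step and cutoff functions\<close>

lemma poly_over_exp_tendsto_0: "((\<lambda>y. poly p y * exp (- y)) \<longlongrightarrow> (0::real)) at_top"
proof -
  have "((\<lambda>y. \<Sum>i\<le>degree p. coeff p i * (y ^ i / exp y)) \<longlongrightarrow> (\<Sum>i\<le>degree p. coeff p i * 0)) at_top"
    by (intro tendsto_intros tendsto_power_div_exp_0)
  moreover have "(\<Sum>i\<le>degree p. coeff p i * (y ^ i / exp y)) = poly p y * exp (- y)" for y :: real
    by (simp add: poly_altdef exp_minus field_simps sum_distrib_right sum_divide_distrib)
  ultimately show ?thesis by simp
qed

text \<open>The functions p(1/x) exp(-1/x), extended by 0. Admitting all polynomials p makes the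
  family closed under differentiation: p is replaced by (p - p') times the square of the
  variable.\<close>

definition flat_poly :: "real poly \<Rightarrow> real \<Rightarrow> real" where
  "flat_poly p x = (if 0 < x then poly p (1 / x) * exp (- (1 / x)) else 0)"

lemma flat_poly_deriv:
  "(flat_poly p has_real_derivative flat_poly ((p - pderiv p) * [:0, 0, 1:]) x) (at x)"
proof -
  consider "x > 0" | "x < 0" | "x = 0" by linarith
  then show ?thesis
  proof cases
    case 1
    have "((\<lambda>x. poly p (1 / x) * exp (- (1 / x))) has_real_derivative flat_poly ((p - pderiv p) * [:0, 0, 1:]) x) (at x)"
      using 1 by (auto intro!: derivative_eq_intros simp: flat_poly_def field_simps power2_eq_square)
    moreover have "\<forall>\<^sub>F y in nhds x. poly p (1 / y) * exp (- (1 / y)) = flat_poly p y"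
      using 1 unfolding eventually_nhds by (intro exI[of _ "{0<..}"]) (auto simp: flat_poly_def)
    ultimately show ?thesis by (rule DERIV_cong_ev[OF refl _ refl, THEN iffD1, rotated])
  next
    case 2
    have "((\<lambda>x. 0) has_real_derivative flat_poly ((p - pderiv p) * [:0, 0, 1:]) x) (at x)"
      using 2 by (simp add: flat_poly_def)
    moreover have "\<forall>\<^sub>F y in nhds x. 0 = flat_poly p y"
      using 2 unfolding eventually_nhds by (intro exI[of _ "{..<0}"]) (auto simp: flat_poly_def)
    ultimately show ?thesis by (rule DERIV_cong_ev[OF refl _ refl, THEN iffD1, rotated])
  next
    case 3
    \<comment> \<open>Dividing by \<open>h\<close> multiplies the polynomial in \<open>1/h\<close>
      by its variable, so the difference quotient at 0 is again a polynomial against a decaying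
      exponential.\<close>
    have "((\<lambda>h. poly (p * [:0, 1:]) (inverse h) * exp (- inverse h)) \<longlongrightarrow> 0) (at_right 0)"
      by (rule filterlim_compose[OF poly_over_exp_tendsto_0 filterlim_inverse_at_top_right])
    then have "((\<lambda>h. flat_poly p h / h) \<longlongrightarrow> 0) (at_right 0)"
    proof (rule Lim_transform_eventually)
      show "\<forall>\<^sub>F h in at_right 0. poly (p * [:0, 1:]) (inverse h) * exp (- inverse h) = flat_poly p h / h"
        unfolding eventually_at_right_field
        by (intro exI[of _ 1]) (auto simp: flat_poly_def field_simps)
    qed
    moreover have "((\<lambda>h. flat_poly p h / h) \<longlongrightarrow> 0) (at_left 0)"
    proof (rule Lim_transform_eventually[OF tendsto_const])
      show "\<forall>\<^sub>F h in at_left 0. 0 = flat_poly p h / h"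
        unfolding eventually_at_left_field by (intro exI[of _ "-1"]) (auto simp: flat_poly_def)
    qed
    ultimately have "((\<lambda>h. flat_poly p h / h) \<longlongrightarrow> 0) (at 0)" by (simp add: filterlim_at_split)
    then show ?thesis using 3 by (simp add: has_field_derivative_iff flat_poly_def)
  qed
qed

lemma smooth_real_flat_poly: "smooth_real (flat_poly p)"
  by (rule smooth_realI[of _ "range flat_poly"]) (use flat_poly_deriv in blast)+

text \<open>Equals 0 on the left of 1/3 and 1 on the right of 2/3: the inner term is
  at least the threshold, respectively vanishes, there.\<close>
definition sstep :: "real \<Rightarrow> real" where
  "sstep x = flat_poly 1 (flat_poly 1 (1/3) - flat_poly 1 (2/3 - x)) / flat_poly 1 (flat_poly 1 (1/3))"

lemma flat_1_mono: "x \<le> y \<Longrightarrow> flat_poly 1 x \<le> flat_poly 1 y"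
  by (auto simp: flat_poly_def frac_le)

lemma flat_1_pos: "x > 0 \<Longrightarrow> flat_poly 1 x > 0"
  by (auto simp: flat_poly_def)

lemma flat_1_nonneg: "flat_poly 1 x \<ge> 0"
  by (auto simp: flat_poly_def)

lemma flat_1_0: "x \<le> 0 \<Longrightarrow> flat_poly 1 x = 0"
  by (auto simp: flat_poly_def)

lemma sstep_0: "x \<le> 1/3 \<Longrightarrow> sstep x = 0"
  unfolding sstep_def using flat_1_mono[of "1/3" "2/3 - x"] by (simp add: flat_1_0)

lemma sstep_1: "x \<ge> 2/3 \<Longrightarrow> sstep x = 1"
  unfolding sstep_def using flat_1_pos[OF flat_1_pos[of "1/3"]] by (simp add: flat_1_0)

lemma sstep_range: "0 \<le> sstep x" "sstep x \<le> 1"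
  unfolding sstep_def using flat_1_pos[OF flat_1_pos[of "1/3"]] flat_1_nonneg[of "2/3 - x"]
  by (auto simp: divide_simps flat_1_nonneg intro!: flat_1_mono)

lemma smooth_sstep: "smooth_real sstep"
proof -
  let ?V = "euc 1"
  note flat = smooth_fun_real_compose[OF openin_euclid_euc smooth_real_flat_poly[of 1], of 1]
  have "smooth_fun 1 ?V (\<lambda>x. flat_poly 1 (2/3 - x 0))"
    by (rule flat[OF smooth_fun_diff[OF openin_euclid_euc smooth_fun_const smooth_fun_coord]])
  then have "smooth_fun 1 ?V (\<lambda>x. flat_poly 1 (flat_poly 1 (1/3) - flat_poly 1 (2/3 - x 0)))"
    by (rule flat[OF smooth_fun_diff[OF openin_euclid_euc smooth_fun_const]])
  from smooth_fun_mult[OF openin_euclid_euc this smooth_fun_const[of _ _ "1 / flat_poly 1 (flat_poly 1 (1/3))"]]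
  show ?thesis unfolding smooth_real_def sstep_def by simp
qed

lemmas smooth_fun_sstep = smooth_fun_real_compose[OF _ smooth_sstep]

lemma smooth_real_continuous: "smooth_real f \<Longrightarrow> continuous_on UNIV f"
proof -
  assume "smooth_real f"
  then have c: "continuous_on (euc 1) (\<lambda>x. f (x 0))" unfolding smooth_real_def by (rule smooth_fun_continuous)
  have "continuous_on UNIV (\<lambda>t. (\<lambda>i::nat. if i = 0 then t else (0::real)))"
    by (rule continuous_on_coordinatewise_then_product) (rename_tac i, case_tac "i = 0", auto)
  then have "continuous_on UNIV (\<lambda>t. f ((\<lambda>i::nat. if i = 0 then t else (0::real)) 0))"
    by (rule continuous_on_compose2[OF c]) (auto simp: euc_def)
  then show ?thesis by simp
qed

lemma continuous_on_sstep: "continuous_on S f \<Longrightarrow> continuous_on S (\<lambda>x. sstep (f x))"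
  using continuous_on_compose2[OF smooth_real_continuous[OF smooth_sstep]] by blast

section \<open>Polynomial approximation and smooth cutoffs\<close>

inductive is_polynomial :: "nat \<Rightarrow> ((nat \<Rightarrow> real) \<Rightarrow> real) \<Rightarrow> bool" for n where
  "is_polynomial n (\<lambda>_. c)"
| "is_polynomial n (\<lambda>x. x i)"
| "is_polynomial n f \<Longrightarrow> is_polynomial n g \<Longrightarrow> is_polynomial n (\<lambda>x. f x + g x)"
| "is_polynomial n f \<Longrightarrow> is_polynomial n g \<Longrightarrow> is_polynomial n (\<lambda>x. f x * g x)"

lemma is_polynomial_smooth: "is_polynomial n f \<Longrightarrow> openin (euclid k) V \<Longrightarrow> smooth_fun k V f"
  by (induction rule: is_polynomial.induct) (auto intro: smooth_fun_add smooth_fun_mult)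

lemma is_polynomial_continuous: "is_polynomial n f \<Longrightarrow> continuous_on S f"
  by (induction rule: is_polynomial.induct) (auto intro: continuous_on_coord continuous_intros)

lemma polynomial_approximation:
  assumes "compact P" "continuous_on P f" "(e::real) > 0"
  obtains g where "is_polynomial n g" "\<And>x. x \<in> P \<Longrightarrow> \<bar>f x - g x\<bar> < e"
proof -
  interpret function_ring_on "Collect (is_polynomial n)" P
  proof
    fix x y :: "nat \<Rightarrow> real" assume "x \<noteq> y"
    then obtain i where "x i \<noteq> y i" by auto
    then show "\<exists>f\<in>Collect (is_polynomial n). f x \<noteq> f y"
      by (intro bexI[of _ "\<lambda>x. x i"]) (auto intro: is_polynomial.intros)
  qed (use assms is_polynomial_continuous in \<open>auto intro: is_polynomial.intros\<close>)
  show ?thesis using Stone_Weierstrass_basic[OF assms(2,3)] that by auto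
qed

text \<open>A Urysohn function for \<open>A\<close> and \<open>B\<close> is approximated on
  \<open>P\<close> within 1/3 by a polynomial g, and \<open>sstep\<close> is applied to g. Since
  \<open>sstep\<close> is constant below 1/3 and above 2/3, the result is exactly 0 and 1 on open
  neighbourhoods, and it is smooth on all of the space and not only on \<open>P\<close>.\<close>

lemma smooth_cutoff:
  assumes "compact P" "closed A" "closed B" "A \<subseteq> P" "B \<subseteq> P" "A \<inter> B = {}"
  obtains \<beta> O0 O1 where "\<And>k V. openin (euclid k) V \<Longrightarrow> smooth_fun k V \<beta>" "\<And>x. 0 \<le> \<beta> x \<and> \<beta> x \<le> 1"
    "continuous_on UNIV \<beta>"
    "open O0" "A \<subseteq> O0" "\<And>x. x \<in> O0 \<Longrightarrow> \<beta> x = 0" "open O1" "B \<subseteq> O1" "\<And>x. x \<in> O1 \<Longrightarrow> \<beta> x = 1"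
proof -
  have "normal_space (top_of_set P)"
    using assms(1) compact_Hausdorff_or_regular_imp_normal_space[of "top_of_set P"]
    by (simp add: Hausdorff_space_subtopology compact_space_subtopology)
  moreover have "closedin (top_of_set P) A" "closedin (top_of_set P) B"
    using assms by (auto intro: closed_subset)
  ultimately obtain f :: "(nat \<Rightarrow> real) \<Rightarrow> real" where f: "continuous_map (top_of_set P) euclideanreal f" "f ` A \<subseteq> {0}" "f ` B \<subseteq> {1}"
    using Urysohn_lemma_alt[of "top_of_set P" A B 0 1] assms(6) by (auto simp: disjnt_def)
  have "continuous_on P f" using f(1) by simp
  then obtain g where g: "is_polynomial 0 g" "\<And>x. x \<in> P \<Longrightarrow> \<bar>f x - g x\<bar> < 1/3"
    using polynomial_approximation[OF assms(1), of f "1/3" 0] by auto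
  have cg: "continuous_on UNIV g" by (rule is_polynomial_continuous[OF g(1)])
  show ?thesis
  proof (rule that[of "\<lambda>x. sstep (g x)" "{x. g x < 1/3}" "{x. 2/3 < g x}"])
    show "smooth_fun k V (\<lambda>x. sstep (g x))" if "openin (euclid k) V" for k V
      by (rule smooth_fun_sstep[OF that is_polynomial_smooth[OF g(1) that]])
    show "A \<subseteq> {x. g x < 1/3}"
    proof
      fix x assume x: "x \<in> A"
      then have "f x = 0" "x \<in> P" using f(2) assms(4) by auto
      then show "x \<in> {x. g x < 1/3}" using g(2)[of x] by auto
    qed
    show "B \<subseteq> {x. 2/3 < g x}"
    proof
      fix x assume x: "x \<in> B"
      then have "f x = 1" "x \<in> P" using f(3) assms(5) by auto
      then show "x \<in> {x. 2/3 < g x}" using g(2)[of x] unfolding abs_less_iff by simp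
    qed
    show "open {x. g x < 1/3}" "open {x. 2/3 < g x}"
      by (intro open_Collect_less cg continuous_intros)+
  qed (use cg sstep_range sstep_0 sstep_1 in \<open>auto intro: continuous_on_sstep\<close>)
qed

section \<open>Cell complexes over a well-ordered set of cells\<close>

text \<open>A cell complex is encoded by its cells, well-ordered by R, with models \<open>K c\<close> (the closed cell) and \<open>bd c\<close> (its boundary)
  and attaching maps \<open>att c\<close>. Its points are the pairs of a cell and a point of the interior of its model, so the underlying
  sets do not depend on the attaching maps, and the stages are the sub-unions over initial sets of cells.\<close>
definition cbelow :: "'c set \<Rightarrow> ('c \<times> 'c) set \<Rightarrow> 'c \<Rightarrow> 'c set" where
  "cbelow C R c = {d \<in> C. (d, c) \<in> R}"

definition cmap :: "('c \<Rightarrow> 'k set) \<Rightarrow> ('c \<Rightarrow> 'k \<Rightarrow> 'c \<times> 'k) \<Rightarrow> 'c \<Rightarrow> 'k \<Rightarrow> 'c \<times> 'k" where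
  "cmap bd att c t = (if t \<in> bd c then att c t else (c, t))"

definition cpts :: "'c set \<Rightarrow> ('c \<Rightarrow> 'k topology) \<Rightarrow> ('c \<Rightarrow> 'k set) \<Rightarrow> ('c \<times> 'k) set" where
  "cpts C K bd = Sigma C (\<lambda>c. topspace (K c) - bd c)"

definition ctop :: "'c set \<Rightarrow> ('c \<Rightarrow> 'k topology) \<Rightarrow> ('c \<Rightarrow> 'k set) \<Rightarrow> ('c \<Rightarrow> 'k \<Rightarrow> 'c \<times> 'k) \<Rightarrow> ('c \<times> 'k) topology" where
  "ctop C K bd att = topology (\<lambda>U. U \<subseteq> cpts C K bd \<and>
     (\<forall>c\<in>C. openin (K c) {t \<in> topspace (K c). cmap bd att c t \<in> U}))"

lemma cpts_mono: "B \<subseteq> B' \<Longrightarrow> cpts B K bd \<subseteq> cpts B' K bd"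
  by (auto simp: cpts_def)

lemma openin_ctop:
  "openin (ctop C K bd att) U \<longleftrightarrow> U \<subseteq> cpts C K bd \<and>
     (\<forall>c\<in>C. openin (K c) {t \<in> topspace (K c). cmap bd att c t \<in> U})"
proof -
  have "istopology (\<lambda>U. U \<subseteq> cpts C K bd \<and> (\<forall>c\<in>C. openin (K c) {t \<in> topspace (K c). cmap bd att c t \<in> U}))"
    unfolding istopology_def
  proof (intro conjI allI impI ballI)
    fix S T c assume "S \<subseteq> cpts C K bd \<and> (\<forall>c\<in>C. openin (K c) {t \<in> topspace (K c). cmap bd att c t \<in> S})"
      "T \<subseteq> cpts C K bd \<and> (\<forall>c\<in>C. openin (K c) {t \<in> topspace (K c). cmap bd att c t \<in> T})" "c \<in> C"
    then have "openin (K c) ({t \<in> topspace (K c). cmap bd att c t \<in> S} \<inter> {t \<in> topspace (K c). cmap bd att c t \<in> T})"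
      by (intro openin_Int) auto
    then show "openin (K c) {t \<in> topspace (K c). cmap bd att c t \<in> S \<inter> T}"
      by (rule back_subst[of "openin (K c)"]) auto
  next
    fix \<U> c assume U: "\<forall>K'\<in>\<U>. K' \<subseteq> cpts C K bd \<and> (\<forall>c\<in>C. openin (K c) {t \<in> topspace (K c). cmap bd att c t \<in> K'})" "c \<in> C"
    then have "openin (K c) (\<Union>V\<in>\<U>. {t \<in> topspace (K c). cmap bd att c t \<in> V})" by auto
    then show "openin (K c) {t \<in> topspace (K c). cmap bd att c t \<in> \<Union>\<U>}"
      by (rule back_subst[of "openin (K c)"]) auto
  qed auto
  then show ?thesis unfolding ctop_def by simp
qed

lemma cmap_cong: "(\<And>t. t \<in> bd c \<Longrightarrow> att c t = att' c t) \<Longrightarrow> cmap bd att c t = cmap bd att' c t"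
  by (simp add: cmap_def)

lemma ctop_cong:
  assumes "\<And>c t. c \<in> C \<Longrightarrow> t \<in> bd c \<Longrightarrow> att c t = att' c t"
  shows "ctop C K bd att = ctop C K bd att'"
  unfolding topology_eq openin_ctop using cmap_cong[of bd _ att att'] assms by (metis (no_types, lifting) Collect_cong)

definition initial :: "'c set \<Rightarrow> ('c \<times> 'c) set \<Rightarrow> 'c set \<Rightarrow> bool" where
  "initial C R B \<longleftrightarrow> B \<subseteq> C \<and> (\<forall>c\<in>B. cbelow C R c \<subseteq> B)"

lemma initial_refl [simp]: "initial C R C"
  by (auto simp: initial_def cbelow_def)

lemma initial_cbelow: "trans R \<Longrightarrow> initial C R (cbelow C R c)"
  by (auto simp: initial_def cbelow_def dest: transD)

lemma cbelow_initial: "initial C R B \<Longrightarrow> c \<in> B \<Longrightarrow> cbelow B R c = cbelow C R c"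
  by (auto simp: initial_def cbelow_def)

text \<open>Models and boundaries are left abstract because two kinds of cells occur: cubes, and
  cubes times an interval. The T1 condition makes finite subsets of a cell closed, on which the
  finiteness of compact sets rests.\<close>

locale cellspace =
  fixes C :: "'c set" and R :: "('c \<times> 'c) set" and K :: "'c \<Rightarrow> 'k topology"
    and bd :: "'c \<Rightarrow> 'k set" and att :: "'c \<Rightarrow> 'k \<Rightarrow> 'c \<times> 'k"
  assumes wfR: "wf R" and transR: "trans R" and totR: "total_on C R"
    and bd_closed: "c \<in> C \<Longrightarrow> closedin (K c) (bd c)"
    and T1: "c \<in> C \<Longrightarrow> t1_space (K c)"
    and att_in: "c \<in> C \<Longrightarrow> t \<in> bd c \<Longrightarrow> att c t \<in> cpts (cbelow C R c) K bd"
    and att_cont: "c \<in> C \<Longrightarrow> continuous_map (subtopology (K c) (bd c)) (ctop (cbelow C R c) K bd att) (att c)"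
begin

abbreviation "pts B \<equiv> cpts B K bd"
abbreviation "tp B \<equiv> ctop B K bd att"
abbreviation "\<Phi> \<equiv> cmap bd att"

lemma cellspace_initial: "initial C R B \<Longrightarrow> cellspace B R K bd att"
proof unfold_locales
  assume B: "initial C R B"
  have BC: "c \<in> C" if "c \<in> B" for c using B that by (auto simp: initial_def)
  show "wf R" "trans R" by (fact wfR transR)+
  show "total_on B R" using totR BC by (simp add: total_on_def)
  fix c assume c: "c \<in> B"
  show "closedin (K c) (bd c)" "t1_space (K c)" using bd_closed T1 BC[OF c] by auto
  show "continuous_map (subtopology (K c) (bd c)) (tp (cbelow B R c)) (att c)"
    using att_cont[OF BC[OF c]] cbelow_initial[OF B c] by simp
  show "att c t \<in> pts (cbelow B R c)" if "t \<in> bd c" for t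
    using att_in[OF BC[OF c] that] cbelow_initial[OF B c] by simp
qed

lemma bd_sub: "c \<in> C \<Longrightarrow> bd c \<subseteq> topspace (K c)"
  using bd_closed closedin_subset by blast

lemma \<Phi>_in: "c \<in> C \<Longrightarrow> t \<in> topspace (K c) \<Longrightarrow> \<Phi> c t \<in> pts C"
  using att_in[of c t] by (auto simp: cmap_def cpts_def cbelow_def)

lemma topspace_ctop [simp]: "topspace (tp C) = pts C"
proof
  show "topspace (tp C) \<subseteq> pts C" using openin_ctop openin_topspace by blast
  have "openin (tp C) (pts C)"
    unfolding openin_ctop using \<Phi>_in by (auto simp: Collect_conj_eq Int_absorb2 subset_iff intro: back_subst[of "openin (K _)", OF openin_topspace])
  then show "pts C \<subseteq> topspace (tp C)" by (rule openin_subset)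
qed

lemma closedin_ctop:
  "closedin (tp C) V \<longleftrightarrow> V \<subseteq> pts C \<and> (\<forall>c\<in>C. closedin (K c) {t \<in> topspace (K c). \<Phi> c t \<in> V})"
proof -
  have "{t \<in> topspace (K c). \<Phi> c t \<in> pts C - V} = topspace (K c) - {t \<in> topspace (K c). \<Phi> c t \<in> V}" if "c \<in> C" for c
    using \<Phi>_in[OF that] by auto
  then show ?thesis
    by (auto simp: closedin_def openin_ctop Diff_subset)
qed

lemma \<Phi>_cont: "c \<in> C \<Longrightarrow> continuous_map (K c) (tp C) (\<Phi> c)"
  by (auto simp: continuous_map_def \<Phi>_in openin_ctop)

lemma pts_\<Phi>: "x \<in> pts C \<Longrightarrow> fst x \<in> C \<and> snd x \<in> topspace (K (fst x)) \<and> \<Phi> (fst x) (snd x) = x"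
  by (auto simp: cpts_def cmap_def)

lemma continuous_from:
  assumes "\<And>c. c \<in> C \<Longrightarrow> continuous_map (K c) Y (\<lambda>t. f (\<Phi> c t))"
  shows "continuous_map (tp C) Y f"
  unfolding continuous_map_def
proof (intro conjI allI impI funcsetI)
  fix x assume "x \<in> topspace (tp C)"
  then have "fst x \<in> C \<and> snd x \<in> topspace (K (fst x)) \<and> \<Phi> (fst x) (snd x) = x" using pts_\<Phi> by simp
  then show "f x \<in> topspace Y" using assms[of "fst x"] unfolding continuous_map_def by force
next
  fix U assume U: "openin Y U"
  show "openin (tp C) {x \<in> topspace (tp C). f x \<in> U}"
    unfolding openin_ctop
  proof (intro conjI ballI)
    fix c assume c: "c \<in> C"
    have "{t \<in> topspace (K c). \<Phi> c t \<in> {x \<in> topspace (tp C). f x \<in> U}} = {t \<in> topspace (K c). f (\<Phi> c t) \<in> U}"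
      using \<Phi>_in[OF c] by auto
    then show "openin (K c) {t \<in> topspace (K c). \<Phi> c t \<in> {x \<in> topspace (tp C). f x \<in> U}}"
      using openin_continuous_map_preimage[OF assms[OF c] U] by simp
  qed auto
qed

end

abbreviation unit_iv :: "real topology" where "unit_iv \<equiv> top_of_set {0..1}"

lemma openin_tube:
  assumes W: "openin (prod_topology X Y) W" and J: "compactin Y J"
  shows "openin X {x \<in> topspace X. {x} \<times> J \<subseteq> W}"
proof (subst openin_subopen, intro ballI)
  fix x assume "x \<in> {x \<in> topspace X. {x} \<times> J \<subseteq> W}"
  then obtain U V where "openin X U" "openin Y V" "x \<in> U" "J \<subseteq> V" "U \<times> V \<subseteq> W"
    using tube_lemma_right[OF W J, of x] by auto
  then show "\<exists>T. openin X T \<and> x \<in> T \<and> T \<subseteq> {x \<in> topspace X. {x} \<times> J \<subseteq> W}"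
    using openin_subset by (intro exI[of _ U]) blast
qed

context cellspace begin

text \<open>This uses that the unit interval is locally compact.\<close>
lemma continuous_from_prod:
  assumes "\<And>c. c \<in> C \<Longrightarrow> continuous_map (prod_topology (K c) unit_iv) Y (\<lambda>(t, s). D (\<Phi> c t, s))"
  shows "continuous_map (prod_topology (tp C) unit_iv) Y D"
  unfolding continuous_map_def
proof (intro conjI allI impI funcsetI)
  fix z assume z: "z \<in> topspace (prod_topology (tp C) unit_iv)"
  obtain x s where xs: "z = (x, s)" "x \<in> pts C" "s \<in> {0..1}" using z by auto
  have p: "fst x \<in> C" "snd x \<in> topspace (K (fst x))" "\<Phi> (fst x) (snd x) = x" using pts_\<Phi>[OF xs(2)] by auto
  have "(\<lambda>(t, s). D (\<Phi> (fst x) t, s)) (snd x, s) \<in> topspace Y"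
    using continuous_map_image_subset_topspace[OF assms[OF p(1)]] p(2) xs(3) by (auto simp: image_subset_iff)
  then show "D z \<in> topspace Y" using p xs by simp
next
  fix U assume U: "openin Y U"
  show "openin (prod_topology (tp C) unit_iv) {z \<in> topspace (prod_topology (tp C) unit_iv). D z \<in> U}"
  proof (subst openin_subopen, intro ballI)
    fix z assume z: "z \<in> {z \<in> topspace (prod_topology (tp C) unit_iv). D z \<in> U}"
    obtain x s where xs: "z = (x, s)" "x \<in> pts C" "s \<in> {0..1}" "D (x, s) \<in> U" using z by auto
    define W where "W c = {p \<in> topspace (prod_topology (K c) unit_iv). (\<lambda>(t, s). D (\<Phi> c t, s)) p \<in> U}" for c
    have W: "openin (prod_topology (K c) unit_iv) (W c)" if "c \<in> C" for c
      unfolding W_def by (rule openin_continuous_map_preimage[OF assms[OF that] U])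
    define c where "c = fst x"
    define t where "t = snd x"
    have ct: "c \<in> C" "t \<in> topspace (K c)" "\<Phi> c t = x" using pts_\<Phi>[OF xs(2)] by (auto simp: c_def t_def)
    have "(t, s) \<in> W c" using ct xs by (auto simp: W_def)
    moreover have "\<forall>x y. (x, y) \<in> W c \<longrightarrow> (\<exists>A B. openin (K c) A \<and> openin unit_iv B \<and> x \<in> A \<and> y \<in> B \<and> A \<times> B \<subseteq> W c)"
      using W[OF ct(1)] by (simp only: openin_prod_topology_alt)
    ultimately obtain A B where AB: "openin (K c) A" "openin unit_iv B" "t \<in> A" "s \<in> B" "A \<times> B \<subseteq> W c"
      by meson
    then obtain e where e: "e > 0" "ball s e \<inter> {0..1} \<subseteq> B"
      unfolding openin_contains_ball by blast
    \<comment> \<open>A compact interval inside \<open>B\<close> around \<open>s\<close> and its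
      open core \<open>J'\<close>: the tube lemma needs the former, the product neighbourhood the
      latter.\<close>
    define J where "J = {0..1} \<inter> {s - e/2..s + e/2}"
    define J' where "J' = {0..1} \<inter> {s - e/2<..<s + e/2}"
    have JB: "J \<subseteq> B" using e by (auto simp: J_def dist_real_def subset_iff)
    have J: "compactin unit_iv J"
      unfolding compactin_subtopology J_def by (auto simp: compact_Int)
    have J': "openin unit_iv J'" unfolding J'_def by (intro openin_open_Int) auto
    \<comment> \<open>Asking that the whole slice over one fixed \<open>J\<close> lands in
      \<open>U\<close> turns the preimage of \<open>V\<close> in every cell into a set of the tube
      lemma, so the same interval serves all cells at once.\<close>
    define V where "V = {y \<in> pts C. \<forall>r\<in>J. D (y, r) \<in> U}"
    have "openin (tp C) V"
      unfolding openin_ctop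
    proof (intro conjI ballI)
      fix d assume d: "d \<in> C"
      have "{t \<in> topspace (K d). \<Phi> d t \<in> V} = {t \<in> topspace (K d). {t} \<times> J \<subseteq> W d}"
        using \<Phi>_in[OF d] by (auto simp: V_def W_def J_def)
      then show "openin (K d) {t \<in> topspace (K d). \<Phi> d t \<in> V}"
        using openin_tube[OF W[OF d] J] by simp
    qed (auto simp: V_def)
    moreover have "x \<in> V"
    proof -
      have "D (x, r) \<in> U" if "r \<in> J" for r
      proof -
        have "(t, r) \<in> W c" using AB JB that by blast
        then show ?thesis by (simp add: W_def ct)
      qed
      then show ?thesis using xs by (simp add: V_def)
    qed
    moreover have "s \<in> J'" using xs e by (auto simp: J'_def)
    moreover have "V \<times> J' \<subseteq> {z \<in> topspace (prod_topology (tp C) unit_iv). D z \<in> U}"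
      by (auto simp: V_def J_def J'_def)
    ultimately show "\<exists>T. openin (prod_topology (tp C) unit_iv) T \<and> z \<in> T \<and> T \<subseteq> {z \<in> topspace (prod_topology (tp C) unit_iv). D z \<in> U}"
      using J' xs(1) by (intro exI[of _ "V \<times> J'"]) (auto simp: openin_prod_Times_iff)
  qed
qed

section \<open>Stages as closed subspaces, and compact subsets of a complex\<close>

lemma initial_below [simp]: "initial C R (cbelow C R c)"
  using transR by (rule initial_cbelow)

lemma topspace_stage [simp]: "initial C R B \<Longrightarrow> topspace (tp B) = pts B"
  using cellspace.topspace_ctop[OF cellspace_initial] .

lemma att_preimage:
  assumes c: "c \<in> C" and V: "closedin (tp (cbelow C R c)) (V \<inter> pts (cbelow C R c))"
  shows "closedin (K c) {t \<in> bd c. att c t \<in> V}"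
proof -
  have "closedin (subtopology (K c) (bd c)) {t \<in> topspace (subtopology (K c) (bd c)). att c t \<in> V \<inter> pts (cbelow C R c)}"
    by (rule closedin_continuous_map_preimage[OF att_cont[OF c] V])
  moreover have "{t \<in> topspace (subtopology (K c) (bd c)). att c t \<in> V \<inter> pts (cbelow C R c)} = {t \<in> bd c. att c t \<in> V}"
    using att_in[OF c] bd_sub[OF c] by auto
  ultimately show ?thesis using bd_closed[OF c] closedin_closed_subtopology by metis
qed

text \<open>Well-founded induction over the cells: when \<open>c\<close> is reached, the trace of
  \<open>V\<close> on the stage below is known to be closed, which settles the boundary part of the
  preimage in \<open>c\<close>. In applications only the interior of \<open>c\<close> remains to be
  inspected.\<close>

lemma closedin_cellwise:
  assumes V: "V \<subseteq> pts C"
    and step: "\<And>c. c \<in> C \<Longrightarrow> closedin (tp (cbelow C R c)) (V \<inter> pts (cbelow C R c)) \<Longrightarrow>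
      closedin (K c) {t \<in> topspace (K c). \<Phi> c t \<in> V}"
  shows "closedin (tp C) V"
proof -
  have "c \<in> C \<longrightarrow> closedin (K c) {t \<in> topspace (K c). \<Phi> c t \<in> V}" for c
    using wfR
  proof (induction c rule: wf_induct_rule)
    case (less c)
    show ?case
    proof (intro impI step)
      assume c: "c \<in> C"
      interpret B: cellspace "cbelow C R c" R K bd att by (rule cellspace_initial) simp
      show "closedin (tp (cbelow C R c)) (V \<inter> pts (cbelow C R c))"
        unfolding B.closedin_ctop
      proof (intro conjI ballI)
        fix d assume d: "d \<in> cbelow C R c"
        have "{t \<in> topspace (K d). \<Phi> d t \<in> V \<inter> pts (cbelow C R c)} = {t \<in> topspace (K d). \<Phi> d t \<in> V}"
          using B.\<Phi>_in[OF d] by auto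
        then show "closedin (K d) {t \<in> topspace (K d). \<Phi> d t \<in> V \<inter> pts (cbelow C R c)}"
          using less[of d] d by (auto simp: cbelow_def)
      qed auto
    qed
  qed
  then show ?thesis using V by (simp add: closedin_ctop)
qed

text \<open>A cell outside \<open>B\<close> has its interior disjoint from the points over
  \<open>B\<close>, so it meets \<open>V\<close> only through its attaching map.\<close>

lemma closedin_stage:
  assumes B: "initial C R B" and V: "closedin (tp B) V"
  shows "closedin (tp C) V"
proof (rule closedin_cellwise)
  interpret B: cellspace B R K bd att by (rule cellspace_initial[OF B])
  show VC: "V \<subseteq> pts C" using V cpts_mono[of B C] B by (auto simp: B.closedin_ctop initial_def)
  fix c assume c: "c \<in> C" and IH: "closedin (tp (cbelow C R c)) (V \<inter> pts (cbelow C R c))"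
  show "closedin (K c) {t \<in> topspace (K c). \<Phi> c t \<in> V}"
  proof (cases "c \<in> B")
    case True then show ?thesis using V by (simp add: B.closedin_ctop)
  next
    case False
    have "V \<subseteq> pts B" using V by (simp add: B.closedin_ctop)
    then have "{t \<in> topspace (K c). \<Phi> c t \<in> V} = {t \<in> bd c. att c t \<in> V}"
      using False bd_sub[OF c] by (auto simp: cmap_def cpts_def)
    then show ?thesis using att_preimage[OF c IH] by simp
  qed
qed

lemma closedin_pts_stage: "initial C R B \<Longrightarrow> closedin (tp C) (pts B)"
  using closedin_stage topspace_stage closedin_topspace by metis

lemma stage_closedin_Int:
  assumes B: "initial C R B" and V: "closedin (tp C) V"
  shows "closedin (tp B) (V \<inter> pts B)"
proof -
  interpret B: cellspace B R K bd att by (rule cellspace_initial[OF B])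
  have "{t \<in> topspace (K c). \<Phi> c t \<in> V \<inter> pts B} = {t \<in> topspace (K c). \<Phi> c t \<in> V}" if "c \<in> B" for c
    using B.\<Phi>_in[OF that] by auto
  then show ?thesis using V B unfolding B.closedin_ctop closedin_ctop by (auto simp: initial_def)
qed

lemma stage_subtopology:
  assumes B: "initial C R B"
  shows "tp B = subtopology (tp C) (pts B)"
proof -
  interpret B: cellspace B R K bd att by (rule cellspace_initial[OF B])
  have "closedin (tp B) V \<longleftrightarrow> closedin (subtopology (tp C) (pts B)) V" for V
    using closedin_stage[OF B, of V] stage_closedin_Int[OF B] closedin_subset[of "tp B" V]
    by (auto simp: closedin_subtopology)
  then show ?thesis unfolding topology_eq openin_closedin_eq
    using closedin_topspace closedin_subset by (metis subset_antisym)
qed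

text \<open>Pick one point of \<open>S\<close> in the interior of each cell that \<open>S\<close>
  meets. Every subset of this selection is closed, since each cell contributes at most one interior
  point; so the selection is compact and discrete, hence finite.\<close>

lemma finite_cells_compact:
  assumes S: "compactin (tp C) S"
  shows "finite (fst ` S)"
proof -
  have SC: "S \<subseteq> pts C" using compactin_subset_topspace[OF S] by simp
  have "\<forall>c\<in>fst ` S. \<exists>t. (c, t) \<in> S" by force
  from bchoice[OF this] obtain \<tau> where \<tau>: "\<And>c. c \<in> fst ` S \<Longrightarrow> (c, \<tau> c) \<in> S" by blast
  define T where "T = (\<lambda>c. (c, \<tau> c)) ` fst ` S"
  have TS: "T \<subseteq> S" using \<tau> by (auto simp: T_def)
  have clo: "closedin (tp C) T'" if T': "T' \<subseteq> T" for T'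
  proof (rule closedin_cellwise)
    show "T' \<subseteq> pts C" using T' TS SC by auto
    fix c assume c: "c \<in> C" and IH: "closedin (tp (cbelow C R c)) (T' \<inter> pts (cbelow C R c))"
    have "{t \<in> topspace (K c). \<Phi> c t \<in> T'} = {t \<in> bd c. att c t \<in> T'} \<union> {t \<in> topspace (K c) - bd c. (c, t) \<in> T'}"
      using bd_sub[OF c] by (auto simp: cmap_def)
    moreover have "closedin (K c) {t \<in> topspace (K c) - bd c. (c, t) \<in> T'}"
    proof -
      have "{t \<in> topspace (K c) - bd c. (c, t) \<in> T'} \<subseteq> {\<tau> c}" using T' by (auto simp: T_def)
      then have "finite {t \<in> topspace (K c) - bd c. (c, t) \<in> T'}" using finite_subset by blast
      then show ?thesis using T1[OF c] by (simp add: t1_space_closedin_finite)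
    qed
    ultimately show "closedin (K c) {t \<in> topspace (K c). \<Phi> c t \<in> T'}"
      using att_preimage[OF c IH] by (simp add: closedin_Un)
  qed
  have cT: "compactin (tp C) T" using closed_compactin[OF S TS] clo by simp
  \<comment> \<open>These open sets isolate the points of \<open>T\<close> from each other, so a
    finite subcover of \<open>T\<close> leaves only finitely many points.\<close>
  define U where "U x = pts C - (T - {x})" for x
  have "openin (tp C) (U x)" for x
    using openin_diff[OF openin_topspace clo[of "T - {x}"]] by (auto simp: U_def)
  moreover have "T \<subseteq> \<Union> (U ` T)" using TS SC by (auto simp: U_def)
  ultimately obtain F where F: "finite F" "F \<subseteq> U ` T" "T \<subseteq> \<Union>F"
    using cT unfolding compactin_def by (metis (no_types, lifting) imageE)
  then obtain T0 where T0: "finite T0" "T0 \<subseteq> T" "F = U ` T0" by (meson finite_subset_image)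
  have "T \<subseteq> T0" using F(3) unfolding T0(3) U_def by blast
  then have "finite T" using T0(1) finite_subset by blast
  moreover have "fst ` S = fst ` T" by (force simp: T_def image_iff)
  ultimately show ?thesis by simp
qed

end

lemma cbelow_subset: "cbelow C R c \<subseteq> C"
  by (auto simp: cbelow_def)

section \<open>Cylinders\<close>

lemma compact_cube: "compact (cube n)"
proof -
  have "cube n = Pi\<^sub>E UNIV (\<lambda>i. if i < n then {0..1} else {0})"
    by (auto simp: cube_def PiE_iff Ball_def split: if_splits)
  moreover have "compactin (product_topology (\<lambda>i::nat. euclidean::real topology) UNIV) (Pi\<^sub>E UNIV (\<lambda>i. if i < n then {0..1} else {0}))"
    by (simp add: compactin_PiE)
  ultimately show ?thesis by (simp add: euclidean_product_topology)
qed

lemma closed_cube: "closed (cube n)"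
  by (rule compact_imp_closed[OF compact_cube])

lemma bdry_subset: "bdry n \<subseteq> cube n"
  by (auto simp: bdry_def)

lemma cube_subset_euc: "cube n \<subseteq> euc n"
  by (auto simp: cube_def euc_def)

lemma closed_bdry: "closed (bdry n)"
proof -
  have "bdry n = cube n \<inter> (\<Union>i\<in>{..<n}. {x. x i = 0} \<union> {x. x i = 1})"
    by (auto simp: bdry_def)
  moreover have "closed (\<Union>i\<in>{..<n}. {x::nat\<Rightarrow>real. x i = 0} \<union> {x. x i = 1})"
    by (intro closed_UN ballI closed_Un closed_Collect_eq continuous_on_coord continuous_on_const) auto
  ultimately show ?thesis using closed_cube by auto
qed

lemma compact_bdry: "compact (bdry n)"
  using compact_Int_closed[OF compact_cube closed_bdry, of n n] bdry_subset by (simp add: Int_absorb1)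

text \<open>Twice the sup distance from the centre of the cube: on the cube it is at most 1, and it
  is 1 on the boundary. In dimension 0, where the boundary is empty, it is 0.\<close>

primrec cube_norm :: "nat \<Rightarrow> (nat \<Rightarrow> real) \<Rightarrow> real" where
  "cube_norm 0 t = 0"
| "cube_norm (Suc n) t = max (cube_norm n t) (2 * \<bar>t n - 1/2\<bar>)"

lemma cube_norm_ge: "j < n \<Longrightarrow> 2 * \<bar>t j - 1/2\<bar> \<le> cube_norm n t"
  by (induction n) (auto simp: less_Suc_eq)

lemma cube_norm_attained: "cube_norm n t > 0 \<Longrightarrow> \<exists>j<n. 2 * \<bar>t j - 1/2\<bar> = cube_norm n t"
proof (induction n)
  case (Suc n)
  show ?case
  proof (cases "cube_norm n t < 2 * \<bar>t n - 1/2\<bar>")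
    case True then show ?thesis by (intro exI[of _ n]) simp
  next
    case False
    then have eq: "cube_norm (Suc n) t = cube_norm n t" by simp
    then obtain j where "j < n" "2 * \<bar>t j - 1/2\<bar> = cube_norm n t" using Suc by auto
    then show ?thesis using eq by (intro exI[of _ j]) simp
  qed
qed simp

lemma continuous_on_cube_norm: "continuous_on S (cube_norm n)"
  by (induction n) (auto intro!: continuous_intros continuous_on_coord)

lemma cube_norm_cube_le: "t \<in> cube n \<Longrightarrow> cube_norm n t \<le> 1"
proof (rule ccontr)
  assume t: "t \<in> cube n" and "\<not> cube_norm n t \<le> 1"
  then obtain j where "j < n" "2 * \<bar>t j - 1/2\<bar> > 1" using cube_norm_attained[of n t] by auto
  moreover have "0 \<le> t j" "t j \<le> 1" using t \<open>j < n\<close> by (auto simp: cube_def)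
  ultimately show False by (simp add: abs_if split: if_splits)
qed

lemma cube_norm_bdry: "t \<in> bdry n \<Longrightarrow> cube_norm n t = 1"
  using cube_norm_ge[of _ n t] cube_norm_cube_le[of t n] by (fastforce simp: bdry_def)

abbreviation "cyl n \<equiv> cube n \<times> {0..1::real}"

text \<open>The ray from the point above the centre of the cube, at height 2 measured from the end s0,
  scaled so that it leaves the cylinder through its wall or through that end when \<open>\<nu> = ray_gauge\<close>.\<close>
definition ray_gauge :: "nat \<Rightarrow> real \<Rightarrow> (nat \<Rightarrow> real) \<times> real \<Rightarrow> real" where
  "ray_gauge n s0 k = max (cube_norm n (fst k)) ((2 - \<bar>snd k - s0\<bar>) / 2)"

definition ray :: "nat \<Rightarrow> real \<Rightarrow> real \<Rightarrow> (nat \<Rightarrow> real) \<times> real \<Rightarrow> (nat \<Rightarrow> real) \<times> real" where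
  "ray n s0 \<nu> k = (\<lambda>j. if j < n then 1/2 + (fst k j - 1/2) / \<nu> else 0,
     s0 + (1 - 2 * s0) * (2 + (\<bar>snd k - s0\<bar> - 2) / \<nu>))"

text \<open>The second term of the maximum is at least 1/2 because heights differ by at most 1; this
  keeps the divisor in \<open>ray\<close> away from 0.\<close>

lemma ray_gauge_range: "k \<in> cyl n \<Longrightarrow> s0 \<in> {0, 1} \<Longrightarrow> 1/2 \<le> ray_gauge n s0 k \<and> ray_gauge n s0 k \<le> 1"
  using cube_norm_cube_le[of "fst k" n] by (auto simp: ray_gauge_def le_max_iff_disj)

lemma ray_gauge_bdry: "k \<in> bdry n \<times> {0..1} \<Longrightarrow> s0 \<in> {0, 1} \<Longrightarrow> ray_gauge n s0 k = 1"
  using cube_norm_bdry[of "fst k" n] by (auto simp: ray_gauge_def)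

lemma ray_gauge_end: "k \<in> cyl n \<Longrightarrow> snd k = s0 \<Longrightarrow> s0 \<in> {0, 1} \<Longrightarrow> ray_gauge n s0 k = 1"
  using cube_norm_cube_le[of "fst k" n] by (auto simp: ray_gauge_def)

lemma ray_1: "k \<in> cyl n \<Longrightarrow> s0 \<in> {0, 1} \<Longrightarrow> ray n s0 1 k = k"
  by (auto simp: ray_def cube_def fun_eq_iff prod_eq_iff)

lemma ray_in:
  assumes "k \<in> cyl n" "s0 \<in> {0, 1}" "ray_gauge n s0 k \<le> \<nu>" "\<nu> \<le> 1"
  shows "ray n s0 \<nu> k \<in> cyl n"
proof -
  have nu: "\<nu> \<ge> 1/2" using ray_gauge_range assms by fastforce
  have ab: "\<bar>(fst k j - 1/2) / \<nu>\<bar> \<le> 1/2" if "j < n" for j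
    using cube_norm_ge[OF that, of "fst k"] assms(3) nu by (simp add: ray_gauge_def abs_divide divide_le_eq)
  then have 1: "0 \<le> 1/2 + (fst k j - 1/2) / \<nu> \<and> 1/2 + (fst k j - 1/2) / \<nu> \<le> 1" if "j < n" for j
    using ab[OF that] unfolding abs_le_iff by linarith
  define s' where "s' = \<bar>snd k - s0\<bar>"
  have s': "0 \<le> s'" "s' \<le> 1" using assms by (auto simp: s'_def)
  have "(2 - s') / \<nu> \<le> 2" using assms(3) nu by (simp add: ray_gauge_def s'_def divide_le_eq)
  moreover have "(2 - s') / \<nu> \<ge> 1"
    using assms(4) nu s' by (simp add: le_divide_eq)
  ultimately have "0 \<le> 2 + (s' - 2) / \<nu>" "2 + (s' - 2) / \<nu> \<le> 1"
    by (simp_all add: diff_divide_distrib)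
  then have "0 \<le> snd (ray n s0 \<nu> k)" "snd (ray n s0 \<nu> k) \<le> 1"
    using assms(2) by (auto simp: ray_def s'_def)
  moreover have "fst (ray n s0 \<nu> k) \<in> cube n" using 1 by (simp add: ray_def cube_def)
  ultimately show ?thesis by (metis atLeastAtMost_iff mem_Times_iff)
qed

text \<open>The term that realizes the maximum decides the exit: if it is \<open>cube_norm\<close>,
  some coordinate of the base reaches 0 or 1 and the ray leaves through the wall; otherwise the
  height becomes \<open>s0\<close>.\<close>

lemma ray_exit:
  assumes "k \<in> cyl n" "s0 \<in> {0, 1}"
  shows "ray n s0 (ray_gauge n s0 k) k \<in> bdry n \<times> {0..1} \<or> snd (ray n s0 (ray_gauge n s0 k) k) = s0"
proof -
  define \<mu> where "\<mu> = ray_gauge n s0 k"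
  have mu: "1/2 \<le> \<mu>" "\<mu> \<le> 1" using ray_gauge_range[OF assms] by (auto simp: \<mu>_def)
  have in_cyl: "ray n s0 \<mu> k \<in> cyl n" using ray_in[OF assms] mu by (simp add: \<mu>_def)
  consider "\<mu> = cube_norm n (fst k)" | "\<mu> = (2 - \<bar>snd k - s0\<bar>) / 2" unfolding \<mu>_def ray_gauge_def by linarith
  then show ?thesis
  proof cases
    case 1
    then obtain j where j: "j < n" "2 * \<bar>fst k j - 1/2\<bar> = \<mu>" using cube_norm_attained[of n "fst k"] mu by auto
    have "fst (ray n s0 \<mu> k) j = 0 \<or> fst (ray n s0 \<mu> k) j = 1"
    proof (cases "fst k j \<ge> 1/2")
      case True
      then have "fst k j - 1/2 = \<mu> / 2" using j by simp
      then have "(fst k j - 1/2) / \<mu> = 1/2" using mu by simp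
      then show ?thesis using j(1) by (simp only: ray_def fst_conv) simp
    next
      case False
      then have "fst k j - 1/2 = - \<mu> / 2" using j by simp
      then have "(fst k j - 1/2) / \<mu> = - 1/2" using mu by simp
      then show ?thesis using j(1) by (simp only: ray_def fst_conv) simp
    qed
    then have "fst (ray n s0 \<mu> k) \<in> bdry n" using in_cyl j(1) unfolding bdry_def by (auto simp: mem_Times_iff)
    then show ?thesis using in_cyl by (simp add: \<mu>_def mem_Times_iff)
  next
    case 2
    then have "\<bar>snd k - s0\<bar> - 2 = - 2 * \<mu>" by simp
    then have "(\<bar>snd k - s0\<bar> - 2) / \<mu> = - 2" using mu by simp
    then show ?thesis by (simp add: ray_def \<mu>_def)
  qed
qed

lemma continuous_on_ray_gauge: "continuous_on S f \<Longrightarrow> continuous_on S (\<lambda>x. ray_gauge n s0 (f x))"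
  unfolding ray_gauge_def
  by (intro continuous_intros continuous_on_compose2[OF continuous_on_cube_norm[of UNIV]]) auto

lemma continuous_on_ray:
  assumes "continuous_on S f" "continuous_on S g" "\<And>x. x \<in> S \<Longrightarrow> g x \<noteq> 0"
  shows "continuous_on S (\<lambda>x. ray n s0 (g x) (f x))"
proof -
  have "continuous_on S (\<lambda>x. fst (f x) j)" for j
    using continuous_on_compose2[OF continuous_on_coord[of UNIV j] continuous_on_fst[OF assms(1)]] by simp
  then have "continuous_on S (\<lambda>x. if j < n then 1/2 + (fst (f x) j - 1/2) / g x else 0)" for j
    using assms by (cases "j < n") (auto intro!: continuous_intros)
  then have "continuous_on S (\<lambda>x j. if j < n then 1/2 + (fst (f x) j - 1/2) / g x else 0)"
    by (rule continuous_on_coordinatewise_then_product)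
  moreover have "continuous_on S (\<lambda>x. s0 + (1 - 2 * s0) * (2 + (\<bar>snd (f x) - s0\<bar> - 2) / g x))"
    using assms by (auto intro!: continuous_intros)
  ultimately show ?thesis unfolding ray_def by (rule continuous_on_Pair)
qed

section \<open>Cubes and cylinders as models of cells; the ends of a cylinder complex\<close>

definition cubeK :: "('c \<Rightarrow> nat) \<Rightarrow> 'c \<Rightarrow> (nat \<Rightarrow> real) topology" where "cubeK n c = cube_top (n c)"
definition cubeB :: "('c \<Rightarrow> nat) \<Rightarrow> 'c \<Rightarrow> (nat \<Rightarrow> real) set" where "cubeB n c = bdry (n c)"
definition cylK :: "('c \<Rightarrow> nat) \<Rightarrow> 'c \<Rightarrow> ((nat \<Rightarrow> real) \<times> real) topology" where "cylK n c = top_of_set (cyl (n c))"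
definition cylB :: "('c \<Rightarrow> nat) \<Rightarrow> 'c \<Rightarrow> ((nat \<Rightarrow> real) \<times> real) set" where "cylB n c = bdry (n c) \<times> {0..1}"

definition emb :: "real \<Rightarrow> 'c \<times> (nat \<Rightarrow> real) \<Rightarrow> 'c \<times> ((nat \<Rightarrow> real) \<times> real)" where
  "emb s x = (fst x, snd x, s)"
definition unemb :: "'c \<times> ((nat \<Rightarrow> real) \<times> real) \<Rightarrow> 'c \<times> (nat \<Rightarrow> real)" where
  "unemb x = (fst x, fst (snd x))"

lemma unemb_emb [simp]: "unemb (emb s x) = x" by (simp add: emb_def unemb_def)

lemma topspace_cubeK [simp]: "topspace (cubeK n c) = cube (n c)" by (simp add: cubeK_def cube_top_def)
lemma topspace_cylK [simp]: "topspace (cylK n c) = cyl (n c)" by (simp add: cylK_def)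
lemma closedin_cubeK: "closedin (cubeK n c) (cubeB n c)"
  unfolding cubeK_def cube_top_def cubeB_def using closed_bdry bdry_subset by (simp add: closed_subset)

lemma closedin_cylK: "closedin (cylK n c) (cylB n c)"
  unfolding cylK_def cylB_def using bdry_subset by (intro closed_subset closed_Times closed_bdry) auto

lemma t1_cubeK: "t1_space (cubeK n c)" and t1_cylK: "t1_space (cylK n c)"
  by (simp_all add: cubeK_def cylK_def cube_top_def Hausdorff_imp_t1_space Hausdorff_space_subtopology)

lemma paste_closed2:
  assumes "closedin X A" "closedin X B" "topspace X \<subseteq> A \<union> B"
    and "continuous_map (subtopology X A) Y h" "continuous_map (subtopology X B) Y h"
  shows "continuous_map X Y h"
  unfolding continuous_map_closedin
proof (intro conjI allI impI funcsetI)
  have AB: "topspace (subtopology X A) = A" "topspace (subtopology X B) = B"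
    using closedin_subset[OF assms(1)] closedin_subset[OF assms(2)] by auto
  fix x assume "x \<in> topspace X"
  then show "h x \<in> topspace Y"
    using assms(3) continuous_map_image_subset_topspace[OF assms(4)] continuous_map_image_subset_topspace[OF assms(5)] AB by blast
next
  fix V assume V: "closedin Y V"
  have "closedin X {x \<in> topspace (subtopology X A). h x \<in> V}"
    using closedin_trans_full[OF closedin_continuous_map_preimage[OF assms(4) V] assms(1)] .
  moreover have "closedin X {x \<in> topspace (subtopology X B). h x \<in> V}"
    using closedin_trans_full[OF closedin_continuous_map_preimage[OF assms(5) V] assms(2)] .
  moreover have "{x \<in> topspace X. h x \<in> V} = {x \<in> topspace (subtopology X A). h x \<in> V} \<union> {x \<in> topspace (subtopology X B). h x \<in> V}"
    using assms(3) by auto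
  ultimately show "closedin X {x \<in> topspace X. h x \<in> V}" by (simp add: closedin_Un)
qed

text \<open>The condition \<open>att_end\<close> says that walls are glued so that height
  \<open>s0\<close> goes to height \<open>s0\<close>. This is what makes the end at
  \<open>s0\<close> a complex of cubes in its own right. One cylinder complex will be used with both
  values of \<open>s0\<close>.\<close>

locale cylspace = cellspace C R "cylK n" "cylB n" attW for C :: "'c set" and R n attW +
  fixes s0 :: real
  assumes s0: "s0 \<in> {0, 1}"
    and att_end: "c \<in> C \<Longrightarrow> t \<in> bdry (n c) \<Longrightarrow> snd (snd (attW c (t, s0))) = s0"
begin

definition endatt :: "'c \<Rightarrow> (nat \<Rightarrow> real) \<Rightarrow> 'c \<times> (nat \<Rightarrow> real)" where
  "endatt c t = unemb (attW c (t, s0))"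

abbreviation "epts B \<equiv> cpts B (cubeK n) (cubeB n)"
abbreviation "etp B \<equiv> ctop B (cubeK n) (cubeB n) endatt"

lemma s0_iv [simp]: "s0 \<in> {0..1}" using s0 by auto

lemma emb_endatt: "c \<in> C \<Longrightarrow> t \<in> bdry (n c) \<Longrightarrow> emb s0 (endatt c t) = attW c (t, s0)"
  using att_end[of c t] by (simp add: endatt_def emb_def unemb_def prod_eq_iff)

lemma emb_cmap: "c \<in> C \<Longrightarrow> t \<in> cube (n c) \<Longrightarrow> emb s0 (cmap (cubeB n) endatt c t) = \<Phi> c (t, s0)"
  using emb_endatt[of c t] s0_iv by (auto simp: cmap_def cubeB_def cylB_def emb_def)

lemma emb_pts_iff: "emb s0 x \<in> cpts B (cylK n) (cylB n) \<longleftrightarrow> x \<in> epts B"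
  using s0_iv by (cases x) (auto simp: emb_def cpts_def cylB_def cubeB_def)

lemma cylspace_initial:
  assumes "initial C R B" shows "cylspace B R n attW s0"
proof -
  interpret B: cellspace B R "cylK n" "cylB n" attW by (rule cellspace_initial[OF assms])
  show ?thesis
    by unfold_locales (use s0 att_end assms in \<open>auto simp: initial_def\<close>)
qed

text \<open>This makes \<open>emb s0\<close> a closed map. In each cylinder the preimage of the
  image splits into a wall part, closed by the cellwise induction, and a slice at height
  \<open>s0\<close>.\<close>

lemma closedin_emb:
  assumes V: "V \<subseteq> epts C" "\<And>c. c \<in> C \<Longrightarrow> closedin (cubeK n c) {t \<in> cube (n c). cmap (cubeB n) endatt c t \<in> V}"
  shows "closedin (tp C) (emb s0 ` V)"
proof (rule closedin_cellwise)
  show "emb s0 ` V \<subseteq> pts C" using V(1) emb_pts_iff by auto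
  fix c assume c: "c \<in> C" and IH: "closedin (tp (cbelow C R c)) (emb s0 ` V \<inter> pts (cbelow C R c))"
  have "{t \<in> cyl (n c). \<Phi> c t \<in> emb s0 ` V} = {t \<in> cylB n c. attW c t \<in> emb s0 ` V} \<union> {t \<in> cube (n c). cmap (cubeB n) endatt c t \<in> V} \<times> {s0}"
  proof (intro set_eqI iffI)
    fix k assume k: "k \<in> {t \<in> cyl (n c). \<Phi> c t \<in> emb s0 ` V}"
    show "k \<in> {t \<in> cylB n c. attW c t \<in> emb s0 ` V} \<union> {t \<in> cube (n c). cmap (cubeB n) endatt c t \<in> V} \<times> {s0}"
    proof (cases "k \<in> cylB n c")
      case True then show ?thesis using k by (simp add: cmap_def)
    next
      case False
      obtain t s where ts: "k = (t, s)" by force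
      then have "(c, t, s) \<in> emb s0 ` V" using k False by (simp add: cmap_def)
      then have "s = s0" "(c, t) \<in> V" by (auto simp: emb_def)
      moreover have "t \<in> cube (n c)" "t \<notin> bdry (n c)" using k False ts by (auto simp: cylB_def)
      ultimately show ?thesis by (simp add: ts cmap_def cubeB_def)
    qed
  next
    fix k assume k: "k \<in> {t \<in> cylB n c. attW c t \<in> emb s0 ` V} \<union> {t \<in> cube (n c). cmap (cubeB n) endatt c t \<in> V} \<times> {s0}"
    then show "k \<in> {t \<in> cyl (n c). \<Phi> c t \<in> emb s0 ` V}"
    proof
      assume "k \<in> {t \<in> cylB n c. attW c t \<in> emb s0 ` V}"
      then show ?thesis using bd_sub[OF c] by (auto simp: cmap_def)
    next
      assume "k \<in> {t \<in> cube (n c). cmap (cubeB n) endatt c t \<in> V} \<times> {s0}"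
      then obtain t where "k = (t, s0)" "t \<in> cube (n c)" "cmap (cubeB n) endatt c t \<in> V" by auto
      moreover from this have "\<Phi> c (t, s0) \<in> emb s0 ` V" using emb_cmap[OF c, of t] by (metis imageI)
      ultimately show ?thesis using s0_iv by simp
    qed
  qed
  moreover have "closedin (cylK n c) {t \<in> cylB n c. attW c t \<in> emb s0 ` V}" by (rule att_preimage[OF c IH])
  moreover have "closedin (cylK n c) ({t \<in> cube (n c). cmap (cubeB n) endatt c t \<in> V} \<times> {s0})"
  proof -
    have "closedin (prod_topology (cubeK n c) unit_iv) ({t \<in> cube (n c). cmap (cubeB n) endatt c t \<in> V} \<times> {s0})"
      using V(2)[OF c] s0_iv by (simp add: closedin_prod_Times_iff closed_subset)
    then show ?thesis by (simp add: cylK_def cubeK_def cube_top_def)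
  qed
  ultimately show "closedin (cylK n c) {t \<in> topspace (cylK n c). \<Phi> c t \<in> emb s0 ` V}" by (simp add: closedin_Un)
qed

lemma endatt_in: "c \<in> C \<Longrightarrow> t \<in> bdry (n c) \<Longrightarrow> endatt c t \<in> epts (cbelow C R c)"
  using att_in[of c "(t, s0)"] emb_endatt[of c t] s0_iv emb_pts_iff[of "endatt c t" "cbelow C R c"] by (simp add: cylB_def)

lemma continuous_at_end: "continuous_map (top_of_set S) (top_of_set (S \<times> {0..1})) (\<lambda>t. (t, s0))"
  using s0_iv by (auto intro!: continuous_intros)

lemma cellspace_end: "cellspace C R (cubeK n) (cubeB n) endatt"
proof unfold_locales
  fix c assume c: "c \<in> C"
  show "endatt c t \<in> epts (cbelow C R c)" if "t \<in> cubeB n c" for t using endatt_in[OF c] that by (simp add: cubeB_def)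
  interpret B: cylspace "cbelow C R c" R n attW s0 by (rule cylspace_initial) simp
  have bt: "subtopology (cubeK n c) (cubeB n c) = top_of_set (bdry (n c))" "subtopology (cylK n c) (cylB n c) = top_of_set (bdry (n c) \<times> {0..1})"
    using bdry_subset[of "n c"] by (auto simp: cubeK_def cubeB_def cylK_def cylB_def cube_top_def subtopology_subtopology Int_absorb1 Times_Int_Times)
  have cont: "continuous_map (top_of_set (bdry (n c))) (tp (cbelow C R c)) (\<lambda>t. attW c (t, s0))"
    using continuous_map_compose[OF continuous_at_end[of "bdry (n c)"] att_cont[OF c, unfolded bt]] by (simp add: o_def)
  show "continuous_map (subtopology (cubeK n c) (cubeB n c)) (etp (cbelow C R c)) (endatt c)"
  proof -
    \<comment> \<open>The end is not known to be a cell complex at this point, so that its cell maps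
      stay inside the stage has to be shown directly.\<close>
    have pin: "cmap (cubeB n) endatt d t \<in> epts (cbelow C R c)" if "d \<in> cbelow C R c" "t \<in> cube (n d)" for d t
    proof (cases "t \<in> bdry (n d)")
      case True
      have "endatt d t \<in> epts (cbelow C R c)"
        using B.endatt_in[OF that(1) True] cpts_mono[OF cbelow_subset, of "cbelow C R c" R d "cubeK n" "cubeB n"] by (rule rev_subsetD)
      with True show ?thesis by (simp add: cmap_def cubeB_def)
    next
      case False then show ?thesis using that by (simp add: cmap_def cpts_def cubeB_def)
    qed
    show ?thesis unfolding continuous_map_def bt
  proof (intro conjI allI impI funcsetI)
    have op: "openin (etp (cbelow C R c)) (epts (cbelow C R c))"
      unfolding openin_ctop
    proof (intro conjI ballI)
      fix d assume "d \<in> cbelow C R c"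
      then have "{t \<in> topspace (cubeK n d). cmap (cubeB n) endatt d t \<in> epts (cbelow C R c)} = topspace (cubeK n d)"
        using pin by auto
      then show "openin (cubeK n d) {t \<in> topspace (cubeK n d). cmap (cubeB n) endatt d t \<in> epts (cbelow C R c)}"
        by (simp only: openin_topspace)
    qed simp
    fix t assume "t \<in> topspace (top_of_set (bdry (n c)))"
    then show "endatt c t \<in> topspace (etp (cbelow C R c))" using endatt_in[OF c, of t] openin_subset[OF op] by auto
  next
    fix U assume U: "openin (etp (cbelow C R c)) U"
    \<comment> \<open>Openness is tested on complements, since \<open>emb s0\<close> is known to be
      closed.\<close>
    let ?V = "epts (cbelow C R c) - U"
    have "closedin (tp (cbelow C R c)) (emb s0 ` ?V)"
    proof (rule B.closedin_emb)
      fix d assume d: "d \<in> cbelow C R c"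
      have "{t \<in> cube (n d). cmap (cubeB n) B.endatt d t \<in> ?V} = topspace (cubeK n d) - {t \<in> cube (n d). cmap (cubeB n) endatt d t \<in> U}"
        using pin[OF d] by auto
      moreover have "openin (cubeK n d) {t \<in> cube (n d). cmap (cubeB n) endatt d t \<in> U}"
        using U d unfolding openin_ctop by simp
      ultimately show "closedin (cubeK n d) {t \<in> cube (n d). cmap (cubeB n) B.endatt d t \<in> ?V}"
        by (simp only: closedin_diff closedin_topspace)
    qed auto
    from closedin_continuous_map_preimage[OF cont this]
    have "closedin (top_of_set (bdry (n c))) {t \<in> bdry (n c). attW c (t, s0) \<in> emb s0 ` ?V}" by simp
    moreover have "{t \<in> bdry (n c). attW c (t, s0) \<in> emb s0 ` ?V} = bdry (n c) - {t \<in> bdry (n c). endatt c t \<in> U}"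
    proof -
      have "attW c (t, s0) \<in> emb s0 ` ?V \<longleftrightarrow> endatt c t \<notin> U" if "t \<in> bdry (n c)" for t
      proof -
        have "attW c (t, s0) \<in> emb s0 ` ?V \<longleftrightarrow> endatt c t \<in> ?V"
          unfolding emb_endatt[OF c that, symmetric] by (auto dest: arg_cong[of _ _ unemb])
        then show ?thesis using endatt_in[OF c that] by simp
      qed
      then show ?thesis by auto
    qed
    ultimately show "openin (top_of_set (bdry (n c))) {x \<in> topspace (top_of_set (bdry (n c))). endatt c x \<in> U}"
      by (simp add: openin_closedin_eq)
  qed
  qed
qed (use wfR transR totR closedin_cubeK t1_cubeK in auto)

sublocale E: cellspace C R "cubeK n" "cubeB n" endatt by (rule cellspace_end)

lemma emb_continuous: "continuous_map (etp C) (tp C) (emb s0)"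
proof (rule E.continuous_from)
  fix c assume c: "c \<in> C"
  have "continuous_map (cubeK n c) (tp C) (\<lambda>t. \<Phi> c (t, s0))"
    using continuous_map_compose[OF continuous_at_end[of "cube (n c)"] \<Phi>_cont[OF c, unfolded cylK_def[of n c]]] by (simp add: o_def cubeK_def cube_top_def)
  then show "continuous_map (cubeK n c) (tp C) (\<lambda>t. emb s0 (E.\<Phi> c t))"
    by (rule continuous_map_eq) (use emb_cmap[OF c] in auto)
qed

text \<open>\<open>emb s0\<close> is a closed injection, so a closed set of the end can be pulled
  back along \<open>f\<close> through its image.\<close>

lemma unemb_continuous:
  assumes f: "continuous_map X (tp C) f" and im: "\<And>x. x \<in> topspace X \<Longrightarrow> f x \<in> emb s0 ` epts C"
  shows "continuous_map X (etp C) (\<lambda>x. unemb (f x))"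
  unfolding continuous_map_closedin
proof (intro conjI allI impI funcsetI)
  fix x assume "x \<in> topspace X" then show "unemb (f x) \<in> topspace (etp C)" using im[of x] by auto
next
  fix V assume V: "closedin (etp C) V"
  have "closedin (tp C) (emb s0 ` V)" using V by (intro closedin_emb) (auto simp: E.closedin_ctop)
  from closedin_continuous_map_preimage[OF f this]
  have "closedin X {x \<in> topspace X. f x \<in> emb s0 ` V}" .
  moreover have "f x \<in> emb s0 ` V \<longleftrightarrow> unemb (f x) \<in> V" if x: "x \<in> topspace X" for x
    using im[OF x] by (auto simp: image_iff) (metis unemb_emb)
  ultimately show "closedin X {x \<in> topspace X. unemb (f x) \<in> V}" by (simp cong: conj_cong)
qed

end

section \<open>Deformation of a cylinder complex onto its ends\<close>

lemma continuous_map_top_of_setI: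
  "continuous_on S f \<Longrightarrow> f ` S \<subseteq> T \<Longrightarrow> continuous_map (top_of_set S) (top_of_set T) f"
  by (auto simp: image_subset_iff)

context cylspace begin

abbreviation "exit_scale c k \<equiv> ray_gauge (n c) s0 k"
abbreviation "exit_ray c \<nu> k \<equiv> ray (n c) s0 \<nu> k"

text \<open>One step of the recursion for the flow. During the time \<open>1 - m\<close> the point
  follows its ray, the scale falling from 1 to the gauge \<open>m\<close>. If it arrives on the
  wall, it continues with the flow of the attached point, run over the remaining time
  \<open>m\<close> rescaled to length 1; if it arrives on the end, it rests.\<close>

definition flow_step :: "('c \<Rightarrow> (nat \<Rightarrow> real) \<times> real \<Rightarrow> real \<Rightarrow> 'c \<times> (nat \<Rightarrow> real) \<times> real) \<Rightarrow> 'c \<Rightarrow> (nat \<Rightarrow> real) \<times> real \<Rightarrow> real \<Rightarrow> 'c \<times> (nat \<Rightarrow> real) \<times> real" where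
  "flow_step D c k \<tau> = (let m = exit_scale c k; j = exit_ray c m k in
     if \<tau> \<le> 1 - m then \<Phi> c (exit_ray c (1 - \<tau>) k)
     else if j \<in> cylB n c then D (fst (attW c j)) (snd (attW c j)) ((\<tau> - 1 + m) / m)
     else \<Phi> c j)"

text \<open>The point to which a wall point is attached lies in an earlier cell, so a flow step in
  \<open>c\<close> consults only earlier values and well-founded choice applies.\<close>

lemma flow_exists: "\<exists>D. \<forall>c. c \<in> C \<longrightarrow> (\<forall>k\<in>cyl (n c). \<forall>\<tau>. D c k \<tau> = flow_step D c k \<tau>)"
proof (rule dependent_wf_choice[OF wfR])
  fix f g :: "'c \<Rightarrow> (nat \<Rightarrow> real) \<times> real \<Rightarrow> real \<Rightarrow> 'c \<times> (nat \<Rightarrow> real) \<times> real" and c r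
  assume fg: "\<And>z. (z, c) \<in> R \<Longrightarrow> f z = g z"
  have "flow_step f c k \<tau> = flow_step g c k \<tau>" if c: "c \<in> C" for k \<tau>
  proof (cases "exit_ray c (exit_scale c k) k \<in> cylB n c")
    case True
    then have "fst (attW c (exit_ray c (exit_scale c k) k)) \<in> cbelow C R c"
      using att_in[OF c True] by (auto simp: cpts_def)
    then have "f (fst (attW c (exit_ray c (exit_scale c k) k))) = g (fst (attW c (exit_ray c (exit_scale c k) k)))"
      by (intro fg) (simp add: cbelow_def)
    then show ?thesis by (simp add: flow_step_def Let_def)
  qed (simp add: flow_step_def Let_def)
  then show "(c \<in> C \<longrightarrow> (\<forall>k\<in>cyl (n c). \<forall>\<tau>. r k \<tau> = flow_step f c k \<tau>)) = (c \<in> C \<longrightarrow> (\<forall>k\<in>cyl (n c). \<forall>\<tau>. r k \<tau> = flow_step g c k \<tau>))"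
    by simp
next
  fix c :: 'c and f :: "'c \<Rightarrow> (nat \<Rightarrow> real) \<times> real \<Rightarrow> real \<Rightarrow> 'c \<times> (nat \<Rightarrow> real) \<times> real"
  show "\<exists>r. c \<in> C \<longrightarrow> (\<forall>k\<in>cyl (n c). \<forall>\<tau>. r k \<tau> = flow_step f c k \<tau>)"
    by (rule exI[of _ "flow_step f c"]) simp
qed

text \<open>A strong deformation retraction onto the end. Continuity is proved by induction over the
  cells, by pasting the phase before the exit from a cell with the phase after it.\<close>

theorem deformation:
  obtains D where "continuous_map (prod_topology (tp C) unit_iv) (tp C) D"
    "\<And>x. x \<in> pts C \<Longrightarrow> D (x, 0) = x"
    "\<And>x. x \<in> pts C \<Longrightarrow> D (x, 1) \<in> emb s0 ` epts C"
    "\<And>x \<tau>. x \<in> epts C \<Longrightarrow> \<tau> \<in> {0..1} \<Longrightarrow> D (emb s0 x, \<tau>) = emb s0 x"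
proof -
  obtain D where D: "\<And>c k \<tau>. c \<in> C \<Longrightarrow> k \<in> cyl (n c) \<Longrightarrow> D c k \<tau> = flow_step D c k \<tau>"
    using flow_exists by blast
  define F where "F = (\<lambda>(x, \<tau>). D (fst x) (snd x) \<tau>)"
  \<comment> \<open>The flow after the exit, as a function of the exit point, which is on the wall
    or on the end.\<close>
  define FJ where "FJ c = (\<lambda>(j, \<tau>). if j \<in> cylB n c then F (attW c j, \<tau>) else \<Phi> c j)" for c
  have range: "1/2 \<le> exit_scale c k" "exit_scale c k \<le> 1" if "k \<in> cyl (n c)" for c k
    using ray_gauge_range[OF that s0] by auto
  have F0: "F (x, 0) = x" if x: "x \<in> pts C" for x
  proof -
    have p: "fst x \<in> C" "snd x \<in> cyl (n (fst x))" "\<Phi> (fst x) (snd x) = x" using pts_\<Phi>[OF x] by auto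
    have "F (x, 0) = flow_step D (fst x) (snd x) 0" using D[OF p(1,2)] by (simp add: F_def)
    then show ?thesis using range[OF p(2)] ray_1[OF p(2) s0] p(3) by (simp add: flow_step_def Let_def)
  qed
  have bd1: "exit_scale c k = 1" if "k \<in> cylB n c" for c k using ray_gauge_bdry[OF _ s0] that by (simp add: cylB_def)
  have wB_cyl: "k \<in> cyl (n c)" if "k \<in> cylB n c" for c k using that bdry_subset by (auto simp: cylB_def)
  have att_pts: "attW c k \<in> pts C" if "c \<in> C" "k \<in> cylB n c" for c k
    using subsetD[OF cpts_mono[OF cbelow_subset] att_in[OF that]] .
  \<comment> \<open>One formula for all points of the closed cylinder, including wall points, whose
    gauge is 1 and whose first phase has length 0. The two maxima do not change the values in their
    branches; they keep the expressions in range on the closed pieces used for pasting.\<close>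
  have F_form: "F (\<Phi> c k, \<tau>) = (if \<tau> \<le> 1 - exit_scale c k then \<Phi> c (exit_ray c (max (exit_scale c k) (1 - \<tau>)) k)
     else FJ c (exit_ray c (exit_scale c k) k, max 0 ((\<tau> - 1 + exit_scale c k) / exit_scale c k)))"
    if c: "c \<in> C" and k: "k \<in> cyl (n c)" and \<tau>: "\<tau> \<in> {0..1}" for c k \<tau>
  proof (cases "k \<in> cylB n c")
    case True
    have r: "exit_ray c 1 k = k" by (rule ray_1[OF k s0])
    show ?thesis
    proof (cases "\<tau> = 0")
      case True
      then show ?thesis using F0[OF att_pts[OF c \<open>k \<in> cylB n c\<close>]] bd1[OF \<open>k \<in> cylB n c\<close>] r \<open>k \<in> cylB n c\<close> by (simp add: cmap_def)
    next
      case False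
      then show ?thesis using \<tau> bd1[OF \<open>k \<in> cylB n c\<close>] r \<open>k \<in> cylB n c\<close> by (simp add: FJ_def cmap_def)
    qed
  next
    case False
    then have "F (\<Phi> c k, \<tau>) = flow_step D c k \<tau>" using D[OF c k] by (simp add: F_def cmap_def)
    then show ?thesis using range[OF k] by (auto simp: flow_step_def Let_def FJ_def F_def max_def not_le)
  qed
  \<comment> \<open>A point of the end has gauge 1 and is its own exit point, so it never
    moves.\<close>
  have fixed: "F (emb s0 x, \<tau>) = emb s0 x" if x: "x \<in> epts C" and \<tau>: "\<tau> \<in> {0..1}" for x \<tau>
  proof -
    have p: "emb s0 x \<in> pts C" using x emb_pts_iff by blast
    note q = pts_\<Phi>[OF p]
    have cx: "fst x \<in> C" "(snd x, s0) \<in> cyl (n (fst x))" "\<Phi> (fst x) (snd x, s0) = emb s0 x"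
      using q by (auto simp: emb_def)
    have nb: "(snd x, s0) \<notin> cylB n (fst x)" using p by (auto simp: emb_def cpts_def)
    have g1: "exit_scale (fst x) (snd x, s0) = 1" by (rule ray_gauge_end[OF cx(2) _ s0]) simp
    show ?thesis
    proof (cases "\<tau> = 0")
      case True then show ?thesis using F0[OF p] by simp
    next
      case False
      then show ?thesis using F_form[OF cx(1,2) \<tau>] g1 ray_1[OF cx(2) s0] nb cx(3) \<tau>
        by (simp add: FJ_def)
    qed
  qed
  have exit: "exit_ray c (exit_scale c k) k \<in> cylB n c \<or> snd (exit_ray c (exit_scale c k) k) = s0" if "k \<in> cyl (n c)" for c k
    using ray_exit[OF that s0] by (simp add: cylB_def)
  \<comment> \<open>At time 1 the rescaled time is again 1, so a point that leaves through the wall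
    is carried to the end by the flow of an earlier cell.\<close>
  have end1: "F (x, 1) \<in> emb s0 ` epts C" if x: "x \<in> pts C" for x
  proof -
    have "\<forall>x\<in>pts C. fst x = c \<longrightarrow> F (x, 1) \<in> emb s0 ` epts C" for c
      using wfR
    proof (induction c rule: wf_induct_rule)
      case (less c)
      show ?case
      proof (intro ballI impI)
        fix x assume x: "x \<in> pts C" "fst x = c"
        have p: "c \<in> C" "snd x \<in> cyl (n c)" "\<Phi> c (snd x) = x" using pts_\<Phi>[OF x(1)] x(2) by auto
        let ?j = "exit_ray c (exit_scale c (snd x)) (snd x)"
        have g: "1/2 \<le> exit_scale c (snd x)" "exit_scale c (snd x) \<le> 1" using range[OF p(2)] by auto
        have eq: "F (x, 1) = FJ c (?j, 1)" using F_form[OF p(1,2), of 1] p(3) g by auto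
        have jc: "?j \<in> cyl (n c)" using ray_in[OF p(2) s0] g by simp
        show "F (x, 1) \<in> emb s0 ` epts C"
        proof (cases "?j \<in> cylB n c")
          case True
          have "fst (attW c ?j) \<in> cbelow C R c" using att_in[OF p(1) True] by (auto simp: cpts_def)
          then have "(fst (attW c ?j), c) \<in> R" by (simp add: cbelow_def)
          then show ?thesis using less[of "fst (attW c ?j)"] att_pts[OF p(1) True] eq True by (simp add: FJ_def)
        next
          case False
          then have s: "snd ?j = s0" using exit[OF p(2)] by blast
          have "fst ?j \<in> cube (n c)" using jc by (simp add: mem_Times_iff)
          moreover have "fst ?j \<notin> bdry (n c)" using False s s0_iv by (auto simp: cylB_def mem_Times_iff)
          ultimately have "(c, fst ?j) \<in> epts C" using p(1) by (simp add: cpts_def cubeB_def)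
          moreover have "FJ c (?j, 1) = emb s0 (c, fst ?j)" using False s
            by (simp add: FJ_def cmap_def emb_def prod_eq_iff)
          ultimately show ?thesis using eq by simp
        qed
      qed
    qed
    then show ?thesis using x by blast
  qed
  have cont: "c \<in> C \<longrightarrow> continuous_map (prod_topology (cylK n c) unit_iv) (tp C) (\<lambda>(k, \<tau>). F (\<Phi> c k, \<tau>))" for c
    using wfR
  proof (induction c rule: wf_induct_rule)
    case (less c)
    show ?case
    proof
      assume c: "c \<in> C"
      let ?Z = "cyl (n c) \<times> {0..1::real}"
      have Z: "prod_topology (cylK n c) unit_iv = top_of_set ?Z" by (simp add: cylK_def)
      interpret B: cellspace "cbelow C R c" R "cylK n" "cylB n" attW by (rule cellspace_initial) simp
      \<comment> \<open>The cellwise statements for the earlier cells combine to continuity of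
        \<open>F\<close> on the whole stage below \<open>c\<close>, which is where the wall is
        attached.\<close>
      have FB: "continuous_map (prod_topology (tp (cbelow C R c)) unit_iv) (tp C) F"
      proof (rule B.continuous_from_prod)
        fix d assume "d \<in> cbelow C R c"
        then show "continuous_map (prod_topology (cylK n d) unit_iv) (tp C) (\<lambda>(t, s). F (\<Phi> d t, s))"
          using less[of d] by (simp add: cbelow_def)
      qed
      let ?J = "{j \<in> cyl (n c). j \<in> cylB n c \<or> snd j = s0}"
      have FJ: "continuous_map (top_of_set (?J \<times> {0..1})) (tp C) (FJ c)"
      proof (rule paste_closed2)
        let ?A = "cylB n c \<times> {0..1::real}" and ?B = "(cyl (n c) \<inter> {j. snd j = s0}) \<times> {0..1::real}"
        have cl: "closed (cylB n c)" "closed (cyl (n c) \<inter> {j. snd j = s0})"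
          unfolding cylB_def by (intro closed_Times closed_bdry closed_cube closed_Int closed_Collect_eq continuous_intros closed_atLeastAtMost)+
        have sub: "?A \<subseteq> ?J \<times> {0..1}" "?B \<subseteq> ?J \<times> {0..1}" using wB_cyl by auto
        show "closedin (top_of_set (?J \<times> {0..1})) ?A" "closedin (top_of_set (?J \<times> {0..1})) ?B"
          by (intro closed_subset sub closed_Times cl closed_atLeastAtMost)+
        show "topspace (top_of_set (?J \<times> {0..1})) \<subseteq> ?A \<union> ?B" by auto
        have "continuous_map (prod_topology (top_of_set (cylB n c)) unit_iv) (prod_topology (tp (cbelow C R c)) unit_iv) (\<lambda>(j, \<tau>). (attW c j, \<tau>))"
        proof -
          have "subtopology (cylK n c) (cylB n c) = top_of_set (cylB n c)"
            using wB_cyl[of _ c] by (simp add: cylK_def[of n c] subtopology_subtopology Int_absorb1 subset_iff)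
          then have "continuous_map (top_of_set (cylB n c)) (tp (cbelow C R c)) (attW c)" using att_cont[OF c] by simp
          then show ?thesis by (intro continuous_map_prod_top[THEN iffD2]) auto
        qed
        from continuous_map_compose[OF this FB]
        have "continuous_map (top_of_set ?A) (tp C) (\<lambda>z. F (attW c (fst z), snd z))"
          by (simp add: o_def case_prod_beta)
        then have "continuous_map (top_of_set ?A) (tp C) (FJ c)"
          by (rule continuous_map_eq) (auto simp: FJ_def)
        then show "continuous_map (subtopology (top_of_set (?J \<times> {0..1})) ?A) (tp C) (FJ c)"
          using sub(1) by (simp add: subtopology_subtopology Int_absorb1)
        have "continuous_map (top_of_set ?B) (tp C) (\<lambda>z. \<Phi> c (fst z))"
        proof -
          have "continuous_map (top_of_set ?B) (cylK n c) fst"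
            unfolding cylK_def by (rule continuous_map_top_of_setI) (auto intro: continuous_intros)
          from continuous_map_compose[OF this \<Phi>_cont[OF c]] show ?thesis by (simp add: o_def)
        qed
        then have "continuous_map (top_of_set ?B) (tp C) (FJ c)"
        proof (rule continuous_map_eq)
          fix z assume z: "z \<in> topspace (top_of_set ?B)"
          obtain t \<tau> where tz: "z = ((t, s0), \<tau>)" "t \<in> cube (n c)" "\<tau> \<in> {0..1}" using z by (cases z) auto
          show "\<Phi> c (fst z) = FJ c z"
          proof (cases "t \<in> bdry (n c)")
            case True
            \<comment> \<open>On the rim, where wall and end meet, the two descriptions of
              \<open>FJ\<close> agree because the flow fixes the end of the lower stage.\<close>
            then have w: "(t, s0) \<in> cylB n c" by (simp add: cylB_def s0_iv[simplified])
            have "attW c (t, s0) = emb s0 (endatt c t)" "endatt c t \<in> epts C"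
              using emb_endatt[OF c True] endatt_in[OF c True] cpts_mono[OF cbelow_subset] by force+
            then show ?thesis using fixed[of "endatt c t" \<tau>] tz w by (simp add: FJ_def cmap_def)
          next
            case False then show ?thesis using tz by (simp add: FJ_def cylB_def)
          qed
        qed
        then show "continuous_map (subtopology (top_of_set (?J \<times> {0..1})) ?B) (tp C) (FJ c)"
          using sub(2) by (simp add: subtopology_subtopology Int_absorb1)
      qed
      have cg: "continuous_on S (\<lambda>z. exit_scale c (fst z))" for S :: "(((nat \<Rightarrow> real) \<times> real) \<times> real) set"
        by (intro continuous_on_ray_gauge continuous_intros)
      \<comment> \<open>The closed sets of times before and after the exit.\<close>
      let ?T1 = "?Z \<inter> {z. snd z \<le> 1 - exit_scale c (fst z)}" and ?T2 = "?Z \<inter> {z. 1 - exit_scale c (fst z) \<le> snd z}"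
      show "continuous_map (prod_topology (cylK n c) unit_iv) (tp C) (\<lambda>(k, \<tau>). F (\<Phi> c k, \<tau>))"
        unfolding Z
      proof (rule paste_closed2)
        have cZ: "closed ?Z" by (intro closed_Times closed_cube closed_atLeastAtMost)
        have "closed ?T1" "closed ?T2"
          by (intro closed_Int cZ closed_Collect_le continuous_intros cg)+
        then show "closedin (top_of_set ?Z) ?T1" "closedin (top_of_set ?Z) ?T2" by (auto intro: closed_subset)
        show "topspace (top_of_set ?Z) \<subseteq> ?T1 \<union> ?T2" by auto
        have st: "subtopology (top_of_set ?Z) ?T1 = top_of_set ?T1" "subtopology (top_of_set ?Z) ?T2 = top_of_set ?T2"
          by (simp_all add: subtopology_subtopology Int_absorb1)
        have "continuous_map (top_of_set ?T1) (cylK n c) (\<lambda>z. exit_ray c (max (exit_scale c (fst z)) (1 - snd z)) (fst z))"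
          unfolding cylK_def
        proof (rule continuous_map_top_of_setI)
          show "continuous_on ?T1 (\<lambda>z. exit_ray c (max (exit_scale c (fst z)) (1 - snd z)) (fst z))"
            by (intro continuous_on_ray continuous_intros cg) (use range in fastforce)
          show "(\<lambda>z. exit_ray c (max (exit_scale c (fst z)) (1 - snd z)) (fst z)) ` ?T1 \<subseteq> cyl (n c)"
          proof (intro image_subsetI ray_in[OF _ s0])
            fix z assume "z \<in> ?T1"
            then show "fst z \<in> cyl (n c)" "exit_scale c (fst z) \<le> max (exit_scale c (fst z)) (1 - snd z)" "max (exit_scale c (fst z)) (1 - snd z) \<le> 1"
              using range(2)[of "fst z" c] by (auto simp: mem_Times_iff)
          qed
        qed
        from continuous_map_compose[OF this \<Phi>_cont[OF c]]
        have "continuous_map (top_of_set ?T1) (tp C) (\<lambda>z. \<Phi> c (exit_ray c (max (exit_scale c (fst z)) (1 - snd z)) (fst z)))"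
          by (simp add: o_def)
        then show "continuous_map (subtopology (top_of_set ?Z) ?T1) (tp C) (\<lambda>(k, \<tau>). F (\<Phi> c k, \<tau>))"
          unfolding st
        proof (rule continuous_map_eq)
          fix z assume "z \<in> topspace (top_of_set ?T1)"
          then show "\<Phi> c (exit_ray c (max (exit_scale c (fst z)) (1 - snd z)) (fst z)) = (\<lambda>(k, \<tau>). F (\<Phi> c k, \<tau>)) z"
            using F_form[OF c, of "fst z" "snd z"] by (simp add: case_prod_beta mem_Times_iff)
        qed
        have "continuous_map (top_of_set ?T2) (top_of_set (?J \<times> {0..1}))
          (\<lambda>z. (exit_ray c (exit_scale c (fst z)) (fst z), max 0 ((snd z - 1 + exit_scale c (fst z)) / exit_scale c (fst z))))"
        proof (rule continuous_map_top_of_setI)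
          have nz: "exit_scale c (fst z) \<noteq> 0" if "z \<in> ?T2" for z using range(1)[of "fst z" c] that by auto
          show "continuous_on ?T2 (\<lambda>z. (exit_ray c (exit_scale c (fst z)) (fst z), max 0 ((snd z - 1 + exit_scale c (fst z)) / exit_scale c (fst z))))"
            by (intro continuous_on_Pair continuous_on_ray continuous_intros cg) (use nz in auto)
          show "(\<lambda>z. (exit_ray c (exit_scale c (fst z)) (fst z), max 0 ((snd z - 1 + exit_scale c (fst z)) / exit_scale c (fst z)))) ` ?T2 \<subseteq> ?J \<times> {0..1}"
          proof (intro image_subsetI)
            fix z assume z: "z \<in> ?T2"
            then have k: "fst z \<in> cyl (n c)" "snd z \<le> 1" by (auto simp: mem_Times_iff)
            have "(snd z - 1 + exit_scale c (fst z)) / exit_scale c (fst z) \<le> 1" using range[OF k(1)] k(2) by (simp add: divide_le_eq)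
            moreover have "exit_ray c (exit_scale c (fst z)) (fst z) \<in> cyl (n c)" using ray_in[OF k(1) s0] range[OF k(1)] by simp
            ultimately show "(exit_ray c (exit_scale c (fst z)) (fst z), max 0 ((snd z - 1 + exit_scale c (fst z)) / exit_scale c (fst z))) \<in> ?J \<times> {0..1}"
              using exit[OF k(1)] by (simp add: mem_Times_iff)
          qed
        qed
        from continuous_map_compose[OF this FJ]
        have "continuous_map (top_of_set ?T2) (tp C) (\<lambda>z. FJ c (exit_ray c (exit_scale c (fst z)) (fst z), max 0 ((snd z - 1 + exit_scale c (fst z)) / exit_scale c (fst z))))"
          by (simp add: o_def)
        then show "continuous_map (subtopology (top_of_set ?Z) ?T2) (tp C) (\<lambda>(k, \<tau>). F (\<Phi> c k, \<tau>))"
          unfolding st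
        proof (rule continuous_map_eq)
          fix z assume z: "z \<in> topspace (top_of_set ?T2)"
          then have k: "fst z \<in> cyl (n c)" "snd z \<in> {0..1}" and ge: "1 - exit_scale c (fst z) \<le> snd z" by (auto simp: mem_Times_iff)
          let ?j = "exit_ray c (exit_scale c (fst z)) (fst z)"
          \<comment> \<open>At the exit time both pieces apply; they agree because the flow starts
            as the identity.\<close>
          have "FJ c (?j, 0) = \<Phi> c ?j"
            using F0[OF att_pts[OF c, of ?j]] by (simp add: FJ_def cmap_def)
          then show "FJ c (?j, max 0 ((snd z - 1 + exit_scale c (fst z)) / exit_scale c (fst z))) = (\<lambda>(k, \<tau>). F (\<Phi> c k, \<tau>)) z"
            using F_form[OF c k] ge by (cases "snd z = 1 - exit_scale c (fst z)") (simp_all add: case_prod_beta)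
        qed
      qed
    qed
  qed
  have "continuous_map (prod_topology (tp C) unit_iv) (tp C) F"
    by (rule continuous_from_prod) (use cont in blast)
  then show ?thesis using that F0 end1 fixed by blast
qed

end

section \<open>The diffeology of a cell complex\<close>

text \<open>All stages are described at once by local lifts to a single closed cell, instead of by
  iterated pushouts; that this gives the pushouts and colimits is proved afterwards. Constant plots
  need no separate clause, every point being interior to some cell.\<close>

definition cell_diff :: "('c \<Rightarrow> nat) \<Rightarrow> ('c \<Rightarrow> (nat \<Rightarrow> real) \<Rightarrow> 'c \<times> (nat \<Rightarrow> real)) \<Rightarrow> 'c set \<Rightarrow> ('c \<times> (nat \<Rightarrow> real)) diffeology" where
  "cell_diff n att B = \<lparr>dcarrier = cpts B (cubeK n) (cubeB n),
     dplots = {(k, U, p). openin (euclid k) U \<and> p ` U \<subseteq> cpts B (cubeK n) (cubeB n) \<and>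
       (\<forall>u\<in>U. \<exists>V. openin (euclid k) V \<and> u \<in> V \<and> V \<subseteq> U \<and>
          (\<exists>c\<in>B. lifts_through V k p (cube_diff (n c)) (cmap (cubeB n) att c)))}\<rparr>"

lemma dcarrier_cell_diff [simp]: "dcarrier (cell_diff n att B) = cpts B (cubeK n) (cubeB n)"
  by (simp add: cell_diff_def)

lemma lifts_through_cube:
  "lifts_through V k p (cube_diff m) h \<longleftrightarrow>
     (\<exists>q. openin (euclid k) V \<and> q ` V \<subseteq> cube m \<and> smooth_map_eu k V m q \<and> (\<forall>v\<in>V. p v = h (q v)))"
  by (auto simp: lifts_through_def cube_diff_def std_sub_def)

lemma dplots_cell_diff:
  "(k, U, p) \<in> dplots (cell_diff n att B) \<longleftrightarrow> openin (euclid k) U \<and> p ` U \<subseteq> cpts B (cubeK n) (cubeB n) \<and>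
     (\<forall>u\<in>U. \<exists>V c q. openin (euclid k) V \<and> u \<in> V \<and> V \<subseteq> U \<and> c \<in> B \<and> q ` V \<subseteq> cube (n c) \<and>
        smooth_map_eu k V (n c) q \<and> (\<forall>v\<in>V. p v = cmap (cubeB n) att c (q v)))"
  unfolding cell_diff_def by (simp add: lifts_through_cube) meson

lemma openin_euclid_preimage:
  assumes V: "openin (euclid k) V" and F: "continuous_on V F" "F ` V \<subseteq> euc n" and U: "openin (euclid n) U"
  shows "openin (euclid k) {v \<in> V. F v \<in> U}"
proof -
  obtain T where T: "open T" "U = euc n \<inter> T" using U openin_euclid_iff by blast
  have "openin (top_of_set V) (V \<inter> F -` T)" using continuous_openin_preimage_gen[OF F(1) T(1)] .
  then have "openin (euclid k) (V \<inter> F -` T)"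
    using openin_trans V unfolding euclid_def by blast
  moreover have "{v \<in> V. F v \<in> U} = V \<inter> F -` T" using F(2) T(2) by auto
  ultimately show ?thesis by simp
qed

lemma openin_euclid_Int: "openin (euclid k) U \<Longrightarrow> open T \<Longrightarrow> openin (euclid k) (U \<inter> T)"
  unfolding openin_euclid_iff by (metis inf_assoc open_Int)

lemma diffeological_cell_diff:
  assumes cm: "\<And>c t. c \<in> B \<Longrightarrow> t \<in> cube (n c) \<Longrightarrow> cmap (cubeB n) att c t \<in> cpts B (cubeK n) (cubeB n)"
  shows "diffeological (cell_diff n att B)"
  unfolding diffeological_def
proof (intro conjI allI impI)
  fix k U p q assume "(k, U, p) \<in> dplots (cell_diff n att B) \<and> (\<forall>u\<in>U. p u = q u)"
  then have *: "(k, U, p) \<in> dplots (cell_diff n att B)" "\<And>u. u \<in> U \<Longrightarrow> p u = q u" by auto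
  show "(k, U, q) \<in> dplots (cell_diff n att B)"
    unfolding dplots_cell_diff
  proof (intro conjI ballI)
    show "openin (euclid k) U" "q ` U \<subseteq> cpts B (cubeK n) (cubeB n)" using * unfolding dplots_cell_diff by force+
    fix u assume "u \<in> U"
    then obtain V c r where "openin (euclid k) V" "u \<in> V" "V \<subseteq> U" "c \<in> B" "r ` V \<subseteq> cube (n c)"
      "smooth_map_eu k V (n c) r" "\<forall>v\<in>V. p v = cmap (cubeB n) att c (r v)" using *(1) unfolding dplots_cell_diff by meson
    then show "\<exists>V c r. openin (euclid k) V \<and> u \<in> V \<and> V \<subseteq> U \<and> c \<in> B \<and> r ` V \<subseteq> cube (n c) \<and>
        smooth_map_eu k V (n c) r \<and> (\<forall>v\<in>V. q v = cmap (cubeB n) att c (r v))"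
      using *(2) by (intro exI[of _ V] exI[of _ c] exI[of _ r]) (auto simp: subset_iff)
  qed
next
  fix k U x assume *: "openin (euclid k) U \<and> x \<in> dcarrier (cell_diff n att B)"
  then obtain c t where ct: "x = (c, t)" "c \<in> B" "t \<in> cube (n c)" "t \<notin> cubeB n c" by (auto simp: cpts_def)
  show "(k, U, \<lambda>_. x) \<in> dplots (cell_diff n att B)"
    unfolding dplots_cell_diff
  proof (intro conjI ballI)
    fix u assume "u \<in> U"
    then show "\<exists>V c q. openin (euclid k) V \<and> u \<in> V \<and> V \<subseteq> U \<and> c \<in> B \<and> q ` V \<subseteq> cube (n c) \<and>
        smooth_map_eu k V (n c) q \<and> (\<forall>v\<in>V. x = cmap (cubeB n) att c (q v))"
      using * ct cube_subset_euc[of "n c"]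
      by (intro exI[of _ U] exI[of _ c] exI[of _ "\<lambda>_. t"]) (auto simp: smooth_map_eu_def cmap_def)
  qed (use * in auto)
next
  fix k U p assume *: "openin (euclid k) U \<and> p ` U \<subseteq> dcarrier (cell_diff n att B) \<and>
    (\<forall>u\<in>U. \<exists>V. openin (euclid k) V \<and> u \<in> V \<and> V \<subseteq> U \<and> (k, V, p) \<in> dplots (cell_diff n att B))"
  show "(k, U, p) \<in> dplots (cell_diff n att B)"
    unfolding dplots_cell_diff
  proof (intro conjI ballI)
    fix u assume "u \<in> U"
    then obtain V where V: "u \<in> V" "V \<subseteq> U" "(k, V, p) \<in> dplots (cell_diff n att B)" using * by meson
    then obtain V' c q where "openin (euclid k) V'" "u \<in> V'" "V' \<subseteq> V" "c \<in> B" "q ` V' \<subseteq> cube (n c)"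
      "smooth_map_eu k V' (n c) q" "\<forall>v\<in>V'. p v = cmap (cubeB n) att c (q v)" unfolding dplots_cell_diff by meson
    then show "\<exists>V c q. openin (euclid k) V \<and> u \<in> V \<and> V \<subseteq> U \<and> c \<in> B \<and> q ` V \<subseteq> cube (n c) \<and>
        smooth_map_eu k V (n c) q \<and> (\<forall>v\<in>V. p v = cmap (cubeB n) att c (q v))"
      using V(2) by (meson subset_trans)
  qed (use * in auto)
next
  fix m U p k V F assume *: "(m, U, p) \<in> dplots (cell_diff n att B) \<and> openin (euclid k) V \<and> F ` V \<subseteq> U \<and> smooth_map_eu k V m F"
  show "(k, V, p \<circ> F) \<in> dplots (cell_diff n att B)"
    unfolding dplots_cell_diff
  proof (intro conjI ballI)
    show "openin (euclid k) V" using * by simp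
    have "p ` U \<subseteq> cpts B (cubeK n) (cubeB n)" "F ` V \<subseteq> U" using * unfolding dplots_cell_diff by auto
    then show "(p \<circ> F) ` V \<subseteq> cpts B (cubeK n) (cubeB n)" by (auto simp: image_subset_iff)
    fix v assume v: "v \<in> V"
    then have "F v \<in> U" using * by auto
    then obtain W c q where W: "openin (euclid m) W" "F v \<in> W" "W \<subseteq> U" "c \<in> B" "q ` W \<subseteq> cube (n c)"
      "smooth_map_eu m W (n c) q" "\<forall>v\<in>W. p v = cmap (cubeB n) att c (q v)" using * unfolding dplots_cell_diff by meson
    define V' where "V' = {v \<in> V. F v \<in> W}"
    have oV: "openin (euclid k) V'" unfolding V'_def
      by (rule openin_euclid_preimage[OF _ smooth_map_eu_continuous _ W(1)]) (use * in \<open>auto simp: smooth_map_eu_def\<close>)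
    have F': "smooth_map_eu k V' m F" "F ` V' \<subseteq> W" using * smooth_map_eu_subset[of k V m F V'] by (auto simp: V'_def)
    show "\<exists>V'' c q. openin (euclid k) V'' \<and> v \<in> V'' \<and> V'' \<subseteq> V \<and> c \<in> B \<and> q ` V'' \<subseteq> cube (n c) \<and>
        smooth_map_eu k V'' (n c) q \<and> (\<forall>v\<in>V''. (p \<circ> F) v = cmap (cubeB n) att c (q v))"
      using oV W v smooth_map_eu_compose[OF oV W(1) F' W(6)] F'(2)
      by (intro exI[of _ V'] exI[of _ c] exI[of _ "\<lambda>x. q (F x)"]) (auto simp: V'_def)
  qed
qed (auto simp: dplots_cell_diff)

lemma openin_dtop:
  "openin (dtop X) A \<longleftrightarrow> A \<subseteq> dcarrier X \<and>
     (\<forall>n U p. (n, U, p) \<in> dplots X \<longrightarrow> openin (euclid n) {u \<in> U. p u \<in> A})"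
proof -
  have "istopology (\<lambda>A. A \<subseteq> dcarrier X \<and> (\<forall>n U p. (n, U, p) \<in> dplots X \<longrightarrow> openin (euclid n) {u \<in> U. p u \<in> A}))"
    unfolding istopology_def
  proof (intro conjI allI impI)
    fix S T n U p
    assume "S \<subseteq> dcarrier X \<and> (\<forall>n U p. (n, U, p) \<in> dplots X \<longrightarrow> openin (euclid n) {u \<in> U. p u \<in> S})"
      "T \<subseteq> dcarrier X \<and> (\<forall>n U p. (n, U, p) \<in> dplots X \<longrightarrow> openin (euclid n) {u \<in> U. p u \<in> T})" "(n, U, p) \<in> dplots X"
    then have "openin (euclid n) ({u \<in> U. p u \<in> S} \<inter> {u \<in> U. p u \<in> T})" by (intro openin_Int) auto
    then show "openin (euclid n) {u \<in> U. p u \<in> S \<inter> T}" by (rule back_subst[of "openin (euclid n)"]) auto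
  next
    fix \<U> n U p
    assume "\<forall>A\<in>\<U>. A \<subseteq> dcarrier X \<and> (\<forall>n U p. (n, U, p) \<in> dplots X \<longrightarrow> openin (euclid n) {u \<in> U. p u \<in> A})" "(n, U, p) \<in> dplots X"
    then have "openin (euclid n) (\<Union>A\<in>\<U>. {u \<in> U. p u \<in> A})" by (intro openin_Union) auto
    then show "openin (euclid n) {u \<in> U. p u \<in> \<Union>\<U>}" by (rule back_subst[of "openin (euclid n)"]) auto
  qed auto
  then show ?thesis unfolding dtop_def by simp
qed

text \<open>A smooth map of all of R^m onto the m-cube that preserves each face and is constant
  across a collar of it. It supplies a plot that covers a closed cell, and precomposition with it
  makes maps on the boundary tame.\<close>

definition sstepv :: "nat \<Rightarrow> (nat \<Rightarrow> real) \<Rightarrow> nat \<Rightarrow> real" where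
  "sstepv m x = (\<lambda>j. if j < m then sstep (x j) else 0)"

lemma sstepv_cube: "sstepv m x \<in> cube m"
  by (simp add: sstepv_def cube_def sstep_range)

lemma sstepv_smooth: "openin (euclid k) V \<Longrightarrow> smooth_map_eu k V m (sstepv m)"
  unfolding smooth_map_eu_def using sstepv_cube cube_subset_euc
  by (auto simp: sstepv_def intro!: smooth_fun_sstep)

lemma continuous_on_sstepv: "continuous_on S (sstepv m)"
proof (rule continuous_on_coordinatewise_then_product)
  fix j show "continuous_on S (\<lambda>x. sstepv m x j)"
    by (cases "j < m") (auto simp: sstepv_def intro!: continuous_on_sstep continuous_on_coord)
qed

lemma sstepv_surj: "y \<in> cube m \<Longrightarrow> \<exists>x\<in>cube m. sstepv m x = y"
proof -
  assume y: "y \<in> cube m"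
  have "\<exists>x\<ge>0. x \<le> 1 \<and> sstep x = y j" if "j < m" for j
  proof (rule IVT')
    show "continuous_on {0..1} sstep" using smooth_real_continuous[OF smooth_sstep] continuous_on_subset by blast
  qed (use y that in \<open>auto simp: sstep_0 sstep_1 cube_def\<close>)
  then obtain x where "\<And>j. j < m \<Longrightarrow> 0 \<le> x j \<and> x j \<le> 1 \<and> sstep (x j) = y j" by metis
  then show ?thesis using y
    by (intro bexI[of _ "\<lambda>j. if j < m then x j else 0"]) (auto simp: sstepv_def cube_def fun_eq_iff)
qed

locale cubecell = cellspace C R "cubeK n" "cubeB n" att for C :: "'c set" and R n att
begin

lemma diffeological_cell_diff_initial:
  assumes "initial C R B" shows "diffeological (cell_diff n att B)"
proof -
  interpret B: cellspace B R "cubeK n" "cubeB n" att by (rule cellspace_initial[OF assms])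
  show ?thesis by (rule diffeological_cell_diff) (use B.\<Phi>_in in auto)
qed

text \<open>Plots factor locally through closed cells, so cellwise open sets are open for the
  D-topology. Conversely, the plot obtained by composing the cell map with \<open>sstepv\<close>
  tests a whole closed cell: \<open>sstepv\<close> maps the compact cube onto itself, hence is a
  closed map there, and openness descends along it.\<close>

lemma dtop_cell_diff: "dtop (cell_diff n att C) = tp C"
  unfolding topology_eq
proof (intro allI iffI)
  fix A assume A: "openin (tp C) A"
  show "openin (dtop (cell_diff n att C)) A"
    unfolding openin_dtop
  proof (intro conjI allI impI)
    show "A \<subseteq> dcarrier (cell_diff n att C)" using A by (simp add: openin_ctop)
    fix k U p assume p: "(k, U, p) \<in> dplots (cell_diff n att C)"
    show "openin (euclid k) {u \<in> U. p u \<in> A}"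
    proof (subst openin_subopen, intro ballI)
      fix u assume u: "u \<in> {u \<in> U. p u \<in> A}"
      then obtain V c q where V: "openin (euclid k) V" "u \<in> V" "V \<subseteq> U" "c \<in> C" "q ` V \<subseteq> cube (n c)"
        "smooth_map_eu k V (n c) q" "\<forall>v\<in>V. p v = \<Phi> c (q v)" using p unfolding dplots_cell_diff by blast
      have "openin (cubeK n c) {t \<in> cube (n c). \<Phi> c t \<in> A}" using A V(4) by (simp add: openin_ctop)
      then obtain T where T: "open T" "{t \<in> cube (n c). \<Phi> c t \<in> A} = cube (n c) \<inter> T"
        by (auto simp: cubeK_def cube_top_def openin_open)
      have "openin (euclid k) {v \<in> V. q v \<in> euc (n c) \<inter> T}"
        by (rule openin_euclid_preimage[OF V(1) smooth_map_eu_continuous[OF V(6)]])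
          (use V(5) cube_subset_euc T(1) openin_euclid_iff in auto)
      moreover have qT: "p v \<in> A \<longleftrightarrow> q v \<in> T" "q v \<in> euc (n c)" if v: "v \<in> V" for v
      proof -
        have "q v \<in> cube (n c)" "p v = \<Phi> c (q v)" using V(5,7) v by auto
        moreover have "q v \<in> {t \<in> cube (n c). \<Phi> c t \<in> A} \<longleftrightarrow> q v \<in> cube (n c) \<inter> T" using T(2) by simp
        ultimately show "p v \<in> A \<longleftrightarrow> q v \<in> T" "q v \<in> euc (n c)" using cube_subset_euc by auto
      qed
      moreover have "u \<in> {v \<in> V. q v \<in> euc (n c) \<inter> T}" "{v \<in> V. q v \<in> euc (n c) \<inter> T} \<subseteq> {u \<in> U. p u \<in> A}"
        using u V(2,3) qT by auto
      ultimately show "\<exists>T. openin (euclid k) T \<and> u \<in> T \<and> T \<subseteq> {u \<in> U. p u \<in> A}" by blast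
    qed
  qed
next
  fix A assume A: "openin (dtop (cell_diff n att C)) A"
  show "openin (tp C) A"
    unfolding openin_ctop
  proof (intro conjI ballI)
    show "A \<subseteq> pts C" using A by (simp add: openin_dtop)
    fix c assume c: "c \<in> C"
    let ?m = "n c"
    have "(?m, euc ?m, \<lambda>x. \<Phi> c (sstepv ?m x)) \<in> dplots (cell_diff n att C)"
      unfolding dplots_cell_diff
    proof (intro conjI ballI)
      show "(\<lambda>x. \<Phi> c (sstepv ?m x)) ` euc ?m \<subseteq> pts C" using \<Phi>_in[OF c] sstepv_cube by auto
      fix u assume "u \<in> euc ?m"
      then show "\<exists>V d q. openin (euclid ?m) V \<and> u \<in> V \<and> V \<subseteq> euc ?m \<and> d \<in> C \<and> q ` V \<subseteq> cube (n d) \<and>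
         smooth_map_eu ?m V (n d) q \<and> (\<forall>v\<in>V. \<Phi> c (sstepv ?m v) = \<Phi> d (q v))"
        using c sstepv_cube sstepv_smooth[of ?m "euc ?m" ?m]
        by (intro exI[of _ "euc ?m"] exI[of _ c] exI[of _ "sstepv ?m"]) auto
    qed simp
    then have "openin (euclid ?m) {x \<in> euc ?m. \<Phi> c (sstepv ?m x) \<in> A}" using A by (simp add: openin_dtop)
    then obtain T where T: "open T" "{x \<in> euc ?m. \<Phi> c (sstepv ?m x) \<in> A} = euc ?m \<inter> T"
      using openin_euclid_iff by auto
    have "compact (sstepv ?m ` (cube ?m - T))"
      by (intro compact_continuous_image continuous_on_sstepv compact_diff compact_cube T)
    moreover have "sstepv ?m ` (cube ?m - T) = cube ?m - {t \<in> cube ?m. \<Phi> c t \<in> A}"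
    proof (intro set_eqI iffI)
      fix y assume "y \<in> sstepv ?m ` (cube ?m - T)"
      then show "y \<in> cube ?m - {t \<in> cube ?m. \<Phi> c t \<in> A}" using T(2) sstepv_cube cube_subset_euc by blast
    next
      fix y assume y: "y \<in> cube ?m - {t \<in> cube ?m. \<Phi> c t \<in> A}"
      then obtain x where x: "x \<in> cube ?m" "sstepv ?m x = y" using sstepv_surj by blast
      then have "x \<notin> T" using y T(2) cube_subset_euc by blast
      then show "y \<in> sstepv ?m ` (cube ?m - T)" using x by blast
    qed
    ultimately have "closed (cube ?m - {t \<in> cube ?m. \<Phi> c t \<in> A})" by (metis compact_imp_closed)
    then have "closedin (top_of_set (cube ?m)) (cube ?m - {t \<in> cube ?m. \<Phi> c t \<in> A})" by (simp add: closed_subset)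
    then show "openin (cubeK n c) {t \<in> topspace (cubeK n c). \<Phi> c t \<in> A}"
      by (simp add: openin_closedin_eq cubeK_def cube_top_def)
  qed
qed

text \<open>Smoothness of a map on a subset P of Euclidean space at a point: the map extends to a
  neighbourhood of the point and lifts there to a single closed cell.\<close>
definition smooth_at :: "nat \<Rightarrow> (nat \<Rightarrow> real) set \<Rightarrow> ((nat \<Rightarrow> real) \<Rightarrow> 'c \<times> (nat \<Rightarrow> real)) \<Rightarrow> (nat \<Rightarrow> real) \<Rightarrow> bool" where
  "smooth_at k P u x \<longleftrightarrow> (\<exists>V c q. openin (euclid k) V \<and> x \<in> V \<and> c \<in> C \<and> q ` V \<subseteq> cube (n c) \<and> smooth_map_eu k V (n c) q \<and>
     (\<forall>y\<in>V \<inter> P. u y = \<Phi> c (q y)))"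

lemma smooth_at_local:
  assumes "smooth_at k P u x" "open T" "x \<in> T" "\<And>y. y \<in> T \<Longrightarrow> y \<in> P' \<Longrightarrow> y \<in> P \<and> u' y = u y"
  shows "smooth_at k P' u' x"
proof -
  obtain V c q where V: "openin (euclid k) V" "x \<in> V" "c \<in> C" "q ` V \<subseteq> cube (n c)" "smooth_map_eu k V (n c) q"
     "\<forall>y\<in>V \<inter> P. u y = \<Phi> c (q y)" using assms(1) unfolding smooth_at_def by blast
  show ?thesis unfolding smooth_at_def
    by (intro exI[of _ "V \<inter> T"] exI[of _ c] exI[of _ q] conjI)
      (use V assms openin_euclid_Int smooth_map_eu_subset[OF V(5)] in auto)
qed

lemma open_smooth_at_set:
  assumes P: "P \<subseteq> euc k"
  shows "\<exists>T. open T \<and> {x \<in> P. smooth_at k P u x} = P \<inter> T"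
proof -
  have "openin (top_of_set P) {x \<in> P. smooth_at k P u x}"
  proof (subst openin_subopen, intro ballI)
    fix x assume x: "x \<in> {x \<in> P. smooth_at k P u x}"
    then obtain V c q where V: "openin (euclid k) V" "x \<in> V" "c \<in> C" "q ` V \<subseteq> cube (n c)" "smooth_map_eu k V (n c) q"
     "\<forall>y\<in>V \<inter> P. u y = \<Phi> c (q y)" unfolding smooth_at_def by blast
    obtain T where T: "open T" "V = euc k \<inter> T" using V(1) openin_euclid_iff by blast
    show "\<exists>T. openin (top_of_set P) T \<and> x \<in> T \<and> T \<subseteq> {x \<in> P. smooth_at k P u x}"
      using T x V P by (intro exI[of _ "P \<inter> T"]) (auto simp: smooth_at_def openin_open)
  qed
  then show ?thesis by (simp add: openin_open)
qed

end

section \<open>Smooth approximation\<close>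

text \<open>The first summand flattens the identity to 0 near 0, the second adds the missing
  \<open>1 - x\<close> near 1. For \<epsilon> at most 1/2 the two corrections do not
  overlap.\<close>

definition collar_fun :: "real \<Rightarrow> real \<Rightarrow> real" where
  "collar_fun \<epsilon> x = x * sstep (x / \<epsilon>) + (1 - sstep ((1 - x) / \<epsilon>)) * (1 - x)"

lemma collar_fun_0: "0 < \<epsilon> \<Longrightarrow> \<epsilon> \<le> 1/2 \<Longrightarrow> x \<le> \<epsilon> / 3 \<Longrightarrow> collar_fun \<epsilon> x = 0"
  by (simp add: collar_fun_def sstep_0 sstep_1 field_simps)

lemma collar_fun_1: "0 < \<epsilon> \<Longrightarrow> \<epsilon> \<le> 1/2 \<Longrightarrow> x \<ge> 1 - \<epsilon> / 3 \<Longrightarrow> collar_fun \<epsilon> x = 1"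
  by (simp add: collar_fun_def sstep_0 sstep_1 field_simps)

lemma collar_fun_le: "0 < \<epsilon> \<Longrightarrow> \<epsilon> \<le> 1/2 \<Longrightarrow> 0 \<le> x \<Longrightarrow> x \<le> 1/2 \<Longrightarrow> 0 \<le> collar_fun \<epsilon> x \<and> collar_fun \<epsilon> x \<le> x"
  using sstep_range[of "x / \<epsilon>"] by (simp add: collar_fun_def sstep_1 field_simps mult_left_le)

lemma collar_fun_ge: "0 < \<epsilon> \<Longrightarrow> \<epsilon> \<le> 1/2 \<Longrightarrow> x \<le> 1 \<Longrightarrow> 1/2 \<le> x \<Longrightarrow> x \<le> collar_fun \<epsilon> x \<and> collar_fun \<epsilon> x \<le> 1"
proof -
  assume a: "0 < \<epsilon>" "\<epsilon> \<le> 1/2" "x \<le> 1" "1/2 \<le> x"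
  have "collar_fun \<epsilon> x = x + (1 - sstep ((1 - x) / \<epsilon>)) * (1 - x)"
    using a by (simp add: collar_fun_def sstep_1 field_simps)
  moreover have "0 \<le> (1 - sstep ((1 - x) / \<epsilon>)) * (1 - x)" "(1 - sstep ((1 - x) / \<epsilon>)) * (1 - x) \<le> 1 * (1 - x)"
    using a sstep_range[of "(1 - x) / \<epsilon>"] by (simp, intro mult_right_mono) auto
  ultimately show ?thesis by simp
qed

lemma collar_fun_id: "0 < \<epsilon> \<Longrightarrow> \<epsilon> \<le> x \<Longrightarrow> x \<le> 1 - \<epsilon> \<Longrightarrow> collar_fun \<epsilon> x = x"
  by (simp add: collar_fun_def sstep_1 field_simps)

lemma smooth_fun_collar_fun:
  assumes V: "openin (euclid k) V" and f: "smooth_fun k V f"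
  shows "smooth_fun k V (\<lambda>x. collar_fun \<epsilon> (f x))"
proof -
  have 1: "smooth_fun k V (\<lambda>x. sstep (f x / \<epsilon>))"
    using smooth_fun_sstep[OF V smooth_fun_mult[OF V f smooth_fun_const[of k V "1 / \<epsilon>"]]] by simp
  have f1: "smooth_fun k V (\<lambda>x. 1 - f x)" by (rule smooth_fun_diff[OF V smooth_fun_const f])
  have 2: "smooth_fun k V (\<lambda>x. sstep ((1 - f x) / \<epsilon>))"
    using smooth_fun_sstep[OF V smooth_fun_mult[OF V f1 smooth_fun_const[of k V "1 / \<epsilon>"]]] by simp
  show ?thesis unfolding collar_fun_def
    by (rule smooth_fun_add(1)[OF V smooth_fun_mult[OF V f 1] smooth_fun_mult[OF V smooth_fun_diff[OF V smooth_fun_const 2] f1]])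
qed

lemma continuous_on_collar_fun: "continuous_on S f \<Longrightarrow> continuous_on S (\<lambda>x. collar_fun \<epsilon> (f x))"
  unfolding collar_fun_def divide_inverse by (intro continuous_intros continuous_on_sstep)

text \<open>Pushes the collar of width \<open>\<epsilon>/3\<close> of the cube onto its boundary while moving coordinates only within
  \<open>\<epsilon>\<close> of 0 or 1, so that \<open>\<epsilon>\<close>-tame maps on the boundary are invariant under it.\<close>
definition collar_push :: "nat \<Rightarrow> real \<Rightarrow> real \<Rightarrow> (nat \<Rightarrow> real) \<Rightarrow> nat \<Rightarrow> real" where
  "collar_push m \<epsilon> b t = (\<lambda>j. if j < m then (1 - b) * t j + b * collar_fun \<epsilon> (t j) else 0)"

lemma smooth_map_collar_push:
  assumes V: "openin (euclid k) V" and b: "smooth_fun k V b" and q: "\<And>j. j < m \<Longrightarrow> smooth_fun k V (\<lambda>y. q y j)"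
  shows "smooth_map_eu k V m (\<lambda>y. collar_push m \<epsilon> (b y) (q y))"
  unfolding smooth_map_eu_def
proof (intro conjI allI impI)
  fix j assume j: "j < m"
  have "smooth_fun k V (\<lambda>y. (1 - b y) * q y j + b y * collar_fun \<epsilon> (q y j))"
    by (rule smooth_fun_add(1)[OF V smooth_fun_mult[OF V smooth_fun_diff[OF V smooth_fun_const b] q[OF j]] smooth_fun_mult[OF V b smooth_fun_collar_fun[OF V q[OF j]]]])
  then show "smooth_fun k V (\<lambda>y. collar_push m \<epsilon> (b y) (q y) j)" using j by (simp add: collar_push_def)
qed (auto simp: collar_push_def euc_def)

lemma continuous_on_collar_push:
  assumes "continuous_on S b" "continuous_on S q"
  shows "continuous_on S (\<lambda>y. collar_push m \<epsilon> (b y) (q y))"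
proof (rule continuous_on_coordinatewise_then_product)
  fix j
  have "continuous_on S (\<lambda>y. q y j)" by (rule continuous_on_product_then_coordinatewise[OF assms(2)])
  then show "continuous_on S (\<lambda>y. collar_push m \<epsilon> (b y) (q y) j)"
    by (cases "j < m") (auto simp: collar_push_def intro!: continuous_intros continuous_on_collar_fun assms)
qed

text \<open>Written as \<open>x\<close> plus \<open>b\<close> times a displacement, a coordinate
  only moves towards its nearer face and never beyond it.\<close>

lemma collar_push_coord:
  assumes "0 < \<epsilon>" "\<epsilon> \<le> 1/2" "0 \<le> b" "b \<le> 1" "0 \<le> x" "x \<le> (1::real)"
  defines "v \<equiv> (1 - b) * x + b * collar_fun \<epsilon> x"
  shows "x \<le> 1/2 \<Longrightarrow> 0 \<le> v \<and> v \<le> x" "1/2 \<le> x \<Longrightarrow> x \<le> v \<and> v \<le> 1"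
    "\<epsilon> \<le> x \<Longrightarrow> x \<le> 1 - \<epsilon> \<Longrightarrow> v = x"
proof -
  have eq: "v = x + b * (collar_fun \<epsilon> x - x)" unfolding v_def by (simp add: algebra_simps)
  { assume "x \<le> 1/2"
    then have s: "0 \<le> collar_fun \<epsilon> x" "collar_fun \<epsilon> x \<le> x" using collar_fun_le assms by auto
    have "b * (x - collar_fun \<epsilon> x) \<le> 1 * (x - collar_fun \<epsilon> x)" using s assms by (intro mult_right_mono) auto
    moreover have "0 \<le> b * (x - collar_fun \<epsilon> x)" using s assms by simp
    ultimately show "0 \<le> v \<and> v \<le> x" using s eq by (simp add: algebra_simps) }
  { assume "1/2 \<le> x"
    then have s: "x \<le> collar_fun \<epsilon> x" "collar_fun \<epsilon> x \<le> 1" using collar_fun_ge assms by auto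
    have "b * (collar_fun \<epsilon> x - x) \<le> 1 * (collar_fun \<epsilon> x - x)" using s assms by (intro mult_right_mono) auto
    moreover have "0 \<le> b * (collar_fun \<epsilon> x - x)" using s assms by simp
    ultimately show "x \<le> v \<and> v \<le> 1" using s eq by (simp add: algebra_simps) }
  show "\<epsilon> \<le> x \<Longrightarrow> x \<le> 1 - \<epsilon> \<Longrightarrow> v = x" using collar_fun_id[of \<epsilon> x] assms(1) eq by simp
qed

lemma collar_push_cube: "0 < \<epsilon> \<Longrightarrow> \<epsilon> \<le> 1/2 \<Longrightarrow> 0 \<le> b \<Longrightarrow> b \<le> 1 \<Longrightarrow> t \<in> cube m \<Longrightarrow> collar_push m \<epsilon> b t \<in> cube m"
proof -
  assume a: "0 < \<epsilon>" "\<epsilon> \<le> 1/2" "0 \<le> b" "b \<le> 1" "t \<in> cube m"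
  have "0 \<le> (1 - b) * t j + b * collar_fun \<epsilon> (t j) \<and> (1 - b) * t j + b * collar_fun \<epsilon> (t j) \<le> 1" if "j < m" for j
  proof -
    have t: "0 \<le> t j" "t j \<le> 1" using a(5) that by (auto simp: cube_def)
    show ?thesis using collar_push_coord(1,2)[OF a(1-4) t] t by linarith
  qed
  then show ?thesis by (simp add: cube_def collar_push_def)
qed

lemma collar_push_bdry_coord: "0 < \<epsilon> \<Longrightarrow> \<epsilon> \<le> 1/2 \<Longrightarrow> j < m \<Longrightarrow> t j = \<alpha> \<Longrightarrow> \<alpha> \<in> {0, 1} \<Longrightarrow> collar_push m \<epsilon> b t j = \<alpha>"
  using collar_fun_0[of \<epsilon> 0] collar_fun_1[of \<epsilon> 1] by (auto simp: collar_push_def)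

lemma collar_push_bdry:
  assumes "0 < \<epsilon>" "\<epsilon> \<le> 1/2" "0 \<le> b" "b \<le> 1" "t \<in> bdry m" shows "collar_push m \<epsilon> b t \<in> bdry m"
proof -
  obtain j where j: "j < m" "t j \<in> {0, 1}" using assms(5) by (auto simp: bdry_def)
  then have "collar_push m \<epsilon> b t j \<in> {0, 1}" using collar_push_bdry_coord[of \<epsilon> j m t "t j" b] assms(1,2) by simp
  then show ?thesis using collar_push_cube[OF assms(1-4), of t m] assms(5) j by (auto simp: bdry_def)
qed

lemma collar_push_0: "t \<in> cube m \<Longrightarrow> collar_push m \<epsilon> 0 t = t"
  by (auto simp: collar_push_def cube_def fun_eq_iff)

text \<open>The coordinates are pushed one after the other through boundary points
  \<open>z i\<close>. Each step either leaves the coordinate alone or moves it within \<epsilon> of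
  one face \<alpha>; then both values of \<phi> equal the value with this coordinate replaced by
  \<alpha>.\<close>

lemma tame_collar_push:
  assumes tame: "\<And>t j \<alpha>. t \<in> bdry m \<Longrightarrow> j < m \<Longrightarrow> \<alpha> \<in> {0, 1} \<Longrightarrow> \<bar>t j - \<alpha>\<bar> \<le> \<epsilon> \<Longrightarrow> \<phi> t = \<phi> (t(j := \<alpha>))"
    and e: "0 < \<epsilon>" "\<epsilon> \<le> 1/2" and b: "0 \<le> b" "b \<le> 1" and t: "t \<in> bdry m"
  shows "\<phi> (collar_push m \<epsilon> b t) = \<phi> t"
proof -
  define z where "z i = (\<lambda>j. if j < i then collar_push m \<epsilon> b t j else t j)" for i
  have t': "t \<in> cube m" using t bdry_subset by auto
  have zb: "z i \<in> bdry m" for i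
  proof -
    obtain j where j: "j < m" "t j \<in> {0, 1}" using t by (auto simp: bdry_def)
    have "z i j \<in> {0, 1}" using collar_push_bdry_coord[of \<epsilon> j m t "t j" b] e j by (simp add: z_def)
    moreover have "z i \<in> cube m" using collar_push_cube[OF e b t'] t' by (auto simp: cube_def z_def)
    ultimately show ?thesis using j(1) by (auto simp: bdry_def)
  qed
  have "\<phi> (z i) = \<phi> t" if "i \<le> m" for i
    using that
  proof (induction i)
    case (Suc i)
    have im: "i < m" using Suc by simp
    have zi: "z i i = t i" "z (Suc i) i = collar_push m \<epsilon> b t i" by (simp_all add: z_def)
    have upd: "(z i)(i := \<alpha>) = (z (Suc i))(i := \<alpha>)" for \<alpha> by (auto simp: z_def fun_eq_iff)
    have ti: "0 \<le> t i" "t i \<le> 1" using t' im by (auto simp: cube_def)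
    have v: "collar_push m \<epsilon> b t i = (1 - b) * t i + b * collar_fun \<epsilon> (t i)" using im by (simp add: collar_push_def)
    note kc = collar_push_coord[OF e b ti, folded v]
    consider "t i < \<epsilon>" | "1 - \<epsilon> < t i" | "\<epsilon> \<le> t i" "t i \<le> 1 - \<epsilon>" by linarith
    then have "\<phi> (z (Suc i)) = \<phi> (z i)"
    proof cases
      case 1
      then have "\<bar>z i i - 0\<bar> \<le> \<epsilon>" "\<bar>z (Suc i) i - 0\<bar> \<le> \<epsilon>" using kc(1) e ti by (auto simp: zi)
      then show ?thesis using tame[OF zb im, of 0 i] tame[OF zb im, of 0 "Suc i"] upd[of 0] by simp
    next
      case 2
      then have "\<bar>z i i - 1\<bar> \<le> \<epsilon>" "\<bar>z (Suc i) i - 1\<bar> \<le> \<epsilon>" using kc(2) e ti by (auto simp: zi)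
      then show ?thesis using tame[OF zb im, of 1 i] tame[OF zb im, of 1 "Suc i"] upd[of 1] by simp
    next
      case 3
      then have "z (Suc i) = z i" using kc(3) zi upd[of "t i"] by (auto simp: z_def fun_eq_iff less_Suc_eq)
      then show ?thesis by simp
    qed
    then show ?case using Suc by simp
  qed (simp add: z_def)
  moreover have "z m = collar_push m \<epsilon> b t" using t' by (auto simp: z_def collar_push_def cube_def fun_eq_iff)
  ultimately show ?thesis by (metis order_refl)
qed

text \<open>The factor 2/(3\<delta>) carries the distances \<delta>/2 and \<delta> from a face to
  the thresholds 1/3 and 2/3 of \<open>sstep\<close>, so this cutoff is 0 near the boundary and 1 at
  depth \<delta>.\<close>

definition deepness :: "nat \<Rightarrow> real \<Rightarrow> (nat \<Rightarrow> real) \<Rightarrow> real" where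
  "deepness m \<delta> t = (\<Prod>j<m. sstep (t j * (2 / (3 * \<delta>))) * sstep ((1 - t j) * (2 / (3 * \<delta>))))"

lemma deepness_range: "0 \<le> deepness m \<delta> t \<and> deepness m \<delta> t \<le> 1"
  unfolding deepness_def by (auto intro!: prod_nonneg prod_le_1 mult_nonneg_nonneg mult_le_one simp: sstep_range)

lemma deepness_1: "\<delta> > 0 \<Longrightarrow> (\<And>j. j < m \<Longrightarrow> \<delta> \<le> t j \<and> t j \<le> 1 - \<delta>) \<Longrightarrow> deepness m \<delta> t = 1"
proof -
  assume d: "\<delta> > 0" "\<And>j. j < m \<Longrightarrow> \<delta> \<le> t j \<and> t j \<le> 1 - \<delta>"
  have "sstep (t j * (2 / (3 * \<delta>))) = 1" "sstep ((1 - t j) * (2 / (3 * \<delta>))) = 1" if "j < m" for j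
    by (rule sstep_1; use d(1) d(2)[OF that] in \<open>simp add: field_simps\<close>)+
  then show ?thesis unfolding deepness_def by (intro prod.neutral ballI) simp
qed

lemma deepness_0: "\<delta> > 0 \<Longrightarrow> j < m \<Longrightarrow> t j \<le> \<delta> / 2 \<or> 1 - \<delta> / 2 \<le> t j \<Longrightarrow> deepness m \<delta> t = 0"
  unfolding deepness_def by (rule prod_zero) (auto intro!: bexI[of _ j] simp: sstep_0 field_simps)

lemma smooth_fun_deepness:
  assumes V: "openin (euclid k) V" and q: "\<And>j. j < m \<Longrightarrow> smooth_fun k V (\<lambda>y. q y j)"
  shows "smooth_fun k V (\<lambda>y. deepness m \<delta> (q y))"
  unfolding deepness_def
  by (rule smooth_fun_prod[OF V], rule smooth_fun_mult[OF V smooth_fun_sstep[OF V smooth_fun_mult[OF V _ smooth_fun_const]]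
        smooth_fun_sstep[OF V smooth_fun_mult[OF V smooth_fun_diff[OF V smooth_fun_const] smooth_fun_const]]]) (use q in auto)

lemma continuous_on_deepness:
  assumes "continuous_on S q" shows "continuous_on S (\<lambda>y. deepness m \<delta> (q y))"
  unfolding deepness_def
  by (intro continuous_on_prod continuous_on_mult continuous_on_sstep continuous_intros continuous_on_product_then_coordinatewise[OF assms])

lemma paste_open2:
  assumes "openin X A" "openin X B" "topspace X \<subseteq> A \<union> B"
    and "continuous_map (subtopology X A) Y h" "continuous_map (subtopology X B) Y h"
  shows "continuous_map X Y h"
  unfolding continuous_map_def
proof (intro conjI allI impI funcsetI)
  have AB: "topspace (subtopology X A) = A" "topspace (subtopology X B) = B"
    using openin_subset[OF assms(1)] openin_subset[OF assms(2)] by auto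
  fix x assume "x \<in> topspace X"
  then show "h x \<in> topspace Y"
    using assms(3) continuous_map_image_subset_topspace[OF assms(4)] continuous_map_image_subset_topspace[OF assms(5)] AB by blast
next
  fix V assume V: "openin Y V"
  have "openin X {x \<in> topspace (subtopology X A). h x \<in> V}"
    using openin_trans_full[OF openin_continuous_map_preimage[OF assms(4) V] assms(1)] .
  moreover have "openin X {x \<in> topspace (subtopology X B). h x \<in> V}"
    using openin_trans_full[OF openin_continuous_map_preimage[OF assms(5) V] assms(2)] .
  moreover have "{x \<in> topspace X. h x \<in> V} = {x \<in> topspace (subtopology X A). h x \<in> V} \<union> {x \<in> topspace (subtopology X B). h x \<in> V}"
    using assms(3) by auto
  ultimately show "openin X {x \<in> topspace X. h x \<in> V}" by (simp add: openin_Un)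
qed

lemma finite_total_max:
  assumes "finite S" "S \<noteq> {}" "total_on C R" "trans R" "S \<subseteq> C"
  shows "\<exists>m\<in>S. \<forall>s\<in>S. s = m \<or> (s, m) \<in> R"
  using assms(1,2,5)
proof (induction rule: finite_ne_induct)
  case (insert x F)
  then obtain m where m: "m \<in> F" "\<forall>s\<in>F. s = m \<or> (s, m) \<in> R" by auto
  consider "x = m" | "(x, m) \<in> R" | "(m, x) \<in> R" using assms(3) insert m(1) unfolding total_on_def by blast
  then show ?case
  proof cases
    case 3
    then have "\<forall>s\<in>insert x F. s = x \<or> (s, x) \<in> R" using m(2) assms(4) by (auto dest: transD)
    then show ?thesis by blast
  qed (use m in auto)
qed auto

locale smoothcell = cubecell C R n att for C :: "'c set" and R n att +
  assumes att_smooth: "c \<in> C \<Longrightarrow> smooth_map (bdry_diff (n c)) (cell_diff n att (cbelow C R c)) (att c)"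
    and att_tame: "c \<in> C \<Longrightarrow> tame (n c) (att c)"
begin

text \<open>By tameness, \<open>att d\<close> agrees near a boundary point with its composite with the projection onto a face,
  which is smooth on a neighbourhood; so a lift along the boundary of a cell may be replaced by a lift to a lower cell.\<close>
lemma lower_lift:
  assumes u: "u ` P \<subseteq> pts B" and B: "B \<subseteq> C" and x: "x \<in> P" and smooth_at: "smooth_at k P u x"
  shows "\<exists>V c q. openin (euclid k) V \<and> x \<in> V \<and> c \<in> B \<and> q ` V \<subseteq> cube (n c) \<and> smooth_map_eu k V (n c) q \<and>
     (\<forall>y\<in>V \<inter> P. u y = \<Phi> c (q y))" (is ?goal)
proof -
  have "\<forall>V q. openin (euclid k) V \<and> x \<in> V \<and> d \<in> C \<and> q ` V \<subseteq> cube (n d) \<and> smooth_map_eu k V (n d) q \<and>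
     (\<forall>y\<in>V \<inter> P. u y = \<Phi> d (q y)) \<longrightarrow> ?goal" for d
    using wfR
  proof (induction d rule: wf_induct_rule)
    case (less d)
    show ?case
    proof (intro allI impI)
      fix V q assume A: "openin (euclid k) V \<and> x \<in> V \<and> d \<in> C \<and> q ` V \<subseteq> cube (n d) \<and> smooth_map_eu k V (n d) q \<and>
        (\<forall>y\<in>V \<inter> P. u y = \<Phi> d (q y))"
      show ?goal
      proof (cases "d \<in> B")
        case True then show ?thesis using A by blast
      next
        case False
        \<comment> \<open>Values of \<open>u\<close> avoid the interior of \<open>d\<close>, so on
          \<open>P\<close> the lift runs in the boundary of the cell.\<close>
        have qb: "q y \<in> bdry (n d)" if "y \<in> V \<inter> P" for y
        proof (rule ccontr)
          assume "q y \<notin> bdry (n d)"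
          then have "u y = (d, q y)" using A that by (simp add: cmap_def cubeB_def)
          then show False using False u that by (auto simp: cpts_def)
        qed
        have d: "d \<in> C" using A by simp
        obtain \<epsilon> where e: "0 < \<epsilon>" "\<And>t j \<alpha>. t \<in> bdry (n d) \<Longrightarrow> j < n d \<Longrightarrow> \<alpha> \<in> {0, 1} \<Longrightarrow> \<bar>t j - \<alpha>\<bar> \<le> \<epsilon> \<Longrightarrow> att d t = att d (t(j := \<alpha>))"
          using att_tame[OF d] unfolding tame_def by blast
        obtain j where j: "j < n d" "q x j \<in> {0, 1}" using qb[of x] A x by (auto simp: bdry_def)
        define \<alpha> where "\<alpha> = q x j"
        have cq: "continuous_on V q" using A smooth_map_eu_continuous by blast
        define V1 where "V1 = {y \<in> V. q y \<in> {t \<in> euc (n d). \<bar>t j - \<alpha>\<bar> < \<epsilon>}}"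
        have o: "openin (euclid (n d)) {t \<in> euc (n d). \<bar>t j - \<alpha>\<bar> < \<epsilon>}"
          unfolding openin_euclid_iff
          by (intro exI[of _ "{t. \<bar>t j - \<alpha>\<bar> < \<epsilon>}"] conjI open_Collect_less continuous_intros continuous_on_coord) auto
        have V1: "openin (euclid k) V1" unfolding V1_def
          by (rule openin_euclid_preimage[OF _ cq _ o]) (use A in \<open>auto simp: smooth_map_eu_def\<close>)
        \<comment> \<open>Off \<open>P\<close> the lift \<open>q\<close> may leave the boundary.
          Setting the coordinate \<open>j\<close> to \<alpha> forces it onto a face on the whole
          neighbourhood, and tameness shows that this does not alter \<open>u\<close> on
          \<open>P\<close>.\<close>
        define q1 where "q1 y = (q y)(j := \<alpha>)" for y
        have q1b: "q1 ` V1 \<subseteq> bdry (n d)"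
        proof (intro image_subsetI)
          fix y assume "y \<in> V1"
          then have "q y \<in> cube (n d)" using A by (auto simp: V1_def)
          moreover have "\<alpha> \<in> {0, 1}" using j by (simp add: \<alpha>_def)
          ultimately show "q1 y \<in> bdry (n d)" using j(1) by (auto simp: q1_def bdry_def cube_def)
        qed
        have sq: "smooth_map_eu k V1 (n d) q" using A smooth_map_eu_subset[of k V "n d" q V1] by (auto simp: V1_def)
        have sq1: "smooth_map_eu k V1 (n d) q1"
          unfolding smooth_map_eu_def
        proof (intro conjI allI impI)
          show "q1 ` V1 \<subseteq> euc (n d)" using q1b bdry_subset cube_subset_euc by blast
          fix i assume "i < n d"
          then show "smooth_fun k V1 (\<lambda>x. q1 x i)" using sq by (cases "i = j") (auto simp: q1_def smooth_map_eu_def)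
        qed
        \<comment> \<open>Now \<open>q1\<close> is a plot of the boundary, so smoothness of
          \<open>att d\<close> provides a lift to a cell before \<open>d\<close>, and the induction
          continues from there.\<close>
        have "(k, V1, q1) \<in> dplots (bdry_diff (n d))"
          using V1 q1b sq1 by (auto simp: bdry_diff_def std_sub_def)
        then have "(k, V1, att d \<circ> q1) \<in> dplots (cell_diff n att (cbelow C R d))" using att_smooth[OF d] unfolding smooth_map_def by blast
        moreover have xV1: "x \<in> V1" using A e(1) cube_subset_euc[of "n d"] by (auto simp: V1_def \<alpha>_def image_subset_iff)
        ultimately obtain V2 c r where V2: "openin (euclid k) V2" "x \<in> V2" "V2 \<subseteq> V1" "c \<in> cbelow C R d" "r ` V2 \<subseteq> cube (n c)"
          "smooth_map_eu k V2 (n c) r" "\<forall>v\<in>V2. (att d \<circ> q1) v = \<Phi> c (r v)"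
          unfolding dplots_cell_diff by meson
        have "u y = \<Phi> c (r y)" if y: "y \<in> V2 \<inter> P" for y
        proof -
          have yV: "y \<in> V1" "y \<in> V \<inter> P" using y V2(3) by (auto simp: V1_def)
          have "u y = att d (q y)" using A yV qb[OF yV(2)] by (simp add: cmap_def cubeB_def)
          also have "\<dots> = att d (q1 y)" unfolding q1_def using e(2)[OF qb[OF yV(2)] j(1), of \<alpha>] j(2) yV(1)
            by (auto simp: V1_def \<alpha>_def)
          finally show ?thesis using V2(7) y by simp
        qed
        moreover have "(c, d) \<in> R" "c \<in> C" using V2(4) by (auto simp: cbelow_def)
        ultimately show ?goal using less[OF \<open>(c, d) \<in> R\<close>, rule_format, of V2 r] V2(1,2,5,6) by blast
      qed
    qed
  qed
  then show ?thesis using smooth_at unfolding smooth_at_def by blast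
qed

end

text \<open>Moves \<open>t\<close> towards \<open>w\<close> with weight \<open>b\<close> times the
  depth of \<open>t\<close>: the result is \<open>w\<close> itself deep inside when \<open>b\<close>
  is 1, and \<open>t\<close> near the boundary of the cube.\<close>

definition nudge :: "nat \<Rightarrow> real \<Rightarrow> real \<Rightarrow> (nat \<Rightarrow> real) \<Rightarrow> (nat \<Rightarrow> real) \<Rightarrow> nat \<Rightarrow> real" where
  "nudge m \<delta> b t w = (\<lambda>j. if j < m then t j + b * deepness m \<delta> t * (w j - t j) else 0)"

lemma nudge_flat: "t \<in> cube m \<Longrightarrow> b * deepness m \<delta> t = 0 \<Longrightarrow> nudge m \<delta> b t w = t"
  by (auto simp: nudge_def cube_def fun_eq_iff)

lemma continuous_on_nudge:
  assumes "continuous_on S b" "continuous_on S t" "continuous_on S w"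
  shows "continuous_on S (\<lambda>y. nudge m \<delta> (b y) (t y) (w y))"
proof (rule continuous_on_coordinatewise_then_product)
  fix j
  show "continuous_on S (\<lambda>y. nudge m \<delta> (b y) (t y) (w y) j)"
    using continuous_on_product_then_coordinatewise[OF assms(2), of j] continuous_on_product_then_coordinatewise[OF assms(3), of j]
    by (cases "j < m") (auto simp: nudge_def intro!: continuous_intros continuous_on_deepness assms)
qed

lemma smooth_map_nudge:
  assumes V: "openin (euclid k) V" and b: "smooth_fun k V b" and t: "\<And>j. j < m \<Longrightarrow> smooth_fun k V (\<lambda>y. t y j)"
    and w: "\<And>j. j < m \<Longrightarrow> smooth_fun k V (\<lambda>y. w y j)"
  shows "smooth_map_eu k V m (\<lambda>y. nudge m \<delta> (b y) (t y) (w y))"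
  unfolding smooth_map_eu_def
proof (intro conjI allI impI)
  fix j assume j: "j < m"
  have "smooth_fun k V (\<lambda>y. t y j + b y * deepness m \<delta> (t y) * (w y j - t y j))"
    by (rule smooth_fun_add(1)[OF V t[OF j] smooth_fun_mult[OF V smooth_fun_mult[OF V b smooth_fun_deepness[OF V t]] smooth_fun_diff[OF V w[OF j] t[OF j]]]])
  then show "smooth_fun k V (\<lambda>y. nudge m \<delta> (b y) (t y) (w y) j)" using j by (simp add: nudge_def)
qed (auto simp: nudge_def euc_def)

lemma openin_ocube: "openin (euclid m) (cube m - bdry m)"
proof -
  have eq: "cube m - bdry m = euc m \<inter> (\<Inter>j\<in>{..<m}. {x. 0 < x j} \<inter> {x. x j < 1})"
    by (auto simp: cube_def bdry_def euc_def less_le)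
  have "open (\<Inter>j\<in>{..<m}. {x::nat\<Rightarrow>real. 0 < x j} \<inter> {x. x j < 1})"
    by (intro open_INT ballI open_Int open_Collect_less continuous_on_coord continuous_on_const) auto
  then show ?thesis using eq openin_euclid_iff by blast
qed

lemma homotopic_rel_iff:
  assumes "N \<subseteq> topspace X"
  shows "homotopic_with (\<lambda>f. \<forall>x\<in>N. f x = u x) X Y p q \<longleftrightarrow>
    (\<exists>h. continuous_map (prod_topology unit_iv X) Y h \<and> (\<forall>x\<in>topspace X. h (0, x) = p x) \<and>
      (\<forall>x\<in>topspace X. h (1, x) = q x) \<and> (\<forall>t\<in>{0..1}. \<forall>x\<in>N. h (t, x) = u x))"
  by (rule homotopic_with) (metis assms subsetD)

section \<open>Relative smooth approximation, by induction over the top cell\<close>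

context smoothcell begin

abbreviation "upto_cell c \<equiv> insert c (cbelow C R c)"

lemma initial_upto: "c \<in> C \<Longrightarrow> initial C R (upto_cell c)"
  using transR by (auto simp: initial_def cbelow_def dest: transD)

lemma not_below_self: "c \<notin> cbelow C R c"
  using wfR by (simp add: cbelow_def)

lemma \<Phi>_below: "d \<in> cbelow C R c \<Longrightarrow> t \<in> cube (n d) \<Longrightarrow> \<Phi> d t \<in> pts (cbelow C R c)"
  using cellspace.\<Phi>_in[OF cellspace_initial[OF initial_below]] by simp

lemma att_below: "c \<in> C \<Longrightarrow> t \<in> bdry (n c) \<Longrightarrow> att c t \<in> pts (cbelow C R c)"
  using att_in[of c t] by (simp add: cubeB_def)

text \<open>Closed subsets of the cell \<open>c\<close> give closed sets of the complex after adding
  the lower stage, or without it when they miss the boundary. Later cells see these sets only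
  through their attaching maps. The lemma provides continuity of the cell coordinate and closedness
  of the deep region.\<close>

lemma closedin_top_cell:
  assumes c: "c \<in> C" and F: "closed F" "F \<subseteq> cube (n c)"
  shows "closedin (tp C) (pts (cbelow C R c) \<union> {c} \<times> (F - bdry (n c)))"
    and "F \<inter> bdry (n c) = {} \<Longrightarrow> closedin (tp C) ({c} \<times> F)"
proof -
  have sub: "{c} \<times> (F - bdry (n c)) \<subseteq> pts C" using c F by (auto simp: cpts_def cubeB_def)
  show "closedin (tp C) (pts (cbelow C R c) \<union> {c} \<times> (F - bdry (n c)))" (is "closedin _ ?V")
  proof (rule closedin_cellwise)
    show "?V \<subseteq> pts C" by (rule Un_least[OF cpts_mono[OF cbelow_subset] sub])
    fix d assume d: "d \<in> C" and IH: "closedin (tp (cbelow C R d)) (?V \<inter> pts (cbelow C R d))"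
    consider "d \<in> cbelow C R c" | "d = c" | "d \<notin> cbelow C R c" "d \<noteq> c" by blast
    then show "closedin (cubeK n d) {t \<in> topspace (cubeK n d). \<Phi> d t \<in> ?V}"
    proof cases
      case 1
      then have "{t \<in> topspace (cubeK n d). \<Phi> d t \<in> ?V} = topspace (cubeK n d)" using \<Phi>_below by auto
      then show ?thesis by (simp only: closedin_topspace)
    next
      case 2
      have "{t \<in> topspace (cubeK n d). \<Phi> d t \<in> ?V} = bdry (n c) \<union> F"
        using att_below[OF c] F(2) bdry_subset[of "n c"] not_below_self[of c] by (auto simp: 2 cmap_def cubeB_def cpts_def)
      then show ?thesis using F closed_bdry[of "n c"] bdry_subset[of "n c"] unfolding 2 cubeK_def cube_top_def
        by (simp add: closed_subset closed_Un)
    next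
      case 3
      then have "{t \<in> topspace (cubeK n d). \<Phi> d t \<in> ?V} = {t \<in> cubeB n d. att d t \<in> ?V}"
        using bd_sub[OF d] by (auto simp: cmap_def cpts_def)
      then show ?thesis using att_preimage[OF d IH] by simp
    qed
  qed
  show "closedin (tp C) ({c} \<times> F)" if F0: "F \<inter> bdry (n c) = {}"
  proof (rule closedin_cellwise)
    show "{c} \<times> F \<subseteq> pts C" using sub F0 by auto
    fix d assume d: "d \<in> C" and IH: "closedin (tp (cbelow C R d)) ({c} \<times> F \<inter> pts (cbelow C R d))"
    have "{t \<in> topspace (cubeK n d). \<Phi> d t \<in> {c} \<times> F} = {t \<in> cubeB n d. att d t \<in> {c} \<times> F} \<union> (if d = c then F else {})"
      using bd_sub[OF d] F F0 by (auto simp: cmap_def cubeB_def)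
    moreover have "closedin (cubeK n d) (if d = c then F else {})" using F by (auto simp: cubeK_def cube_top_def closed_subset)
    ultimately show "closedin (cubeK n d) {t \<in> topspace (cubeK n d). \<Phi> d t \<in> {c} \<times> F}"
      using att_preimage[OF d IH] by (simp only: closedin_Un)
  qed
qed

text \<open>The homotopy is stationary on a neighbourhood of \<open>Q\<close> and not just on
  \<open>Q\<close>: smoothness at a point depends on nearby values, so this is what allows modified
  and unmodified pieces to be glued.\<close>

definition approximable where
  "approximable k P Q u \<longleftrightarrow> (\<exists>N v. openin (top_of_set P) N \<and> Q \<subseteq> N \<and>
     homotopic_with (\<lambda>f. \<forall>x\<in>N. f x = u x) (top_of_set P) (tp C) u v \<and> (\<forall>x\<in>P. smooth_at k P v x))"

text \<open>All pairs \<open>P\<close>, \<open>Q\<close> are quantified together, because the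
  induction hypothesis will be applied to another compact set with another relative part.\<close>

definition approx_claim where
  "approx_claim k c \<longleftrightarrow> (\<forall>P Q u. compact P \<longrightarrow> P \<subseteq> euc k \<longrightarrow> closed Q \<longrightarrow> Q \<subseteq> P \<longrightarrow>
     continuous_map (top_of_set P) (tp C) u \<longrightarrow> u ` P \<subseteq> pts (upto_cell c) \<longrightarrow> (\<forall>x\<in>Q. smooth_at k P u x) \<longrightarrow> approximable k P Q u)"

text \<open>A compact image meets finitely many cells, and the largest of them bounds the
  image.\<close>

lemma approx_reduce:
  assumes claim: "\<And>d. d \<in> B \<Longrightarrow> approx_claim k d" and B: "B \<subseteq> C"
    and P: "compact P" "P \<subseteq> euc k" and Q: "closed Q" "Q \<subseteq> P"
    and u: "continuous_map (top_of_set P) (tp C) u" "u ` P \<subseteq> pts B" and smQ: "\<forall>x\<in>Q. smooth_at k P u x"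
  shows "approximable k P Q u"
proof (cases "P = {}")
  case True
  then show ?thesis using Q u(1) unfolding approximable_def
    by (intro exI[of _ "{}"] exI[of _ u]) (auto intro: homotopic_with_refl[THEN iffD2])
next
  case False
  have "compactin (tp C) (u ` P)"
    using image_compactin[OF _ u(1), of P] P(1) by (simp add: compactin_subtopology)
  then have fin: "finite (fst ` u ` P)" by (rule finite_cells_compact)
  have sub: "fst ` u ` P \<subseteq> B" using u(2) by (auto simp: cpts_def)
  obtain c where c: "c \<in> fst ` u ` P" "\<forall>s\<in>fst ` u ` P. s = c \<or> (s, c) \<in> R"
    using finite_total_max[OF fin _ totR transR] subset_trans[OF sub B] False by auto
  have "u ` P \<subseteq> pts (upto_cell c)"
  proof
    fix y assume y: "y \<in> u ` P"
    then have "fst y \<in> upto_cell c" using c(2) sub B by (auto simp: cbelow_def)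
    moreover have "y \<in> pts B" using u(2) y by auto
    ultimately show "y \<in> pts (upto_cell c)" by (cases y) (simp add: cpts_def)
  qed
  moreover have "approx_claim k c" using claim c(1) sub by blast
  ultimately show ?thesis using P Q u(1) smQ unfolding approx_claim_def by simp
qed

text \<open>On the deep part of the top cell, u is replaced by a polynomial approximation; what remains is pushed off
  the cell into the lower stage, where the induction hypothesis applies relative to the part that is already smooth.
  The cutoff \<open>\<beta>\<close> keeps both modifications away from Q.\<close>
lemma approx_step:
  assumes c: "c \<in> C" and IH: "\<And>d. d \<in> cbelow C R c \<Longrightarrow> approx_claim k d"
  shows "approx_claim k c"
  unfolding approx_claim_def
proof (intro allI impI)
  fix P Q u
  assume P: "compact P" "P \<subseteq> euc k" and Q: "closed Q" "Q \<subseteq> P"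
    and u: "continuous_map (top_of_set P) (tp C) u" "u ` P \<subseteq> pts (upto_cell c)" and smQ: "\<forall>x\<in>Q. smooth_at k P u x"
  define m where "m = n c"
  define A where "A = pts (cbelow C R c)"
  obtain \<epsilon> where e: "0 < \<epsilon>" "\<epsilon> \<le> 1/2" and tame: "\<And>t j \<alpha>. t \<in> bdry m \<Longrightarrow> j < m \<Longrightarrow> \<alpha> \<in> {0, 1} \<Longrightarrow> \<bar>t j - \<alpha>\<bar> \<le> \<epsilon> \<Longrightarrow> att c t = att c (t(j := \<alpha>))"
    using att_tame[OF c] unfolding tame_def m_def by blast
  have att_collar_push: "att c (collar_push m \<epsilon> b t) = att c t" if "0 \<le> b" "b \<le> 1" "t \<in> bdry m" for b t
    by (rule tame_collar_push[OF tame e that])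
  \<comment> \<open>The full push sends everything within \<epsilon>/3 of a face to the boundary,
    and 2\<delta> is below \<epsilon>/3. So a nudged point that is not pushed to the boundary lies
    in \<open>E (2 * \<delta>)\<close>; as nudges are smaller than \<delta>/4, the original point
    then lies where \<open>deepness\<close> is 1.\<close>
  define \<delta> where "\<delta> = \<epsilon> / 9"
  have d0: "0 < \<delta>" "\<delta> < 1/2" using e by (auto simp: \<delta>_def)
  \<comment> \<open>The coordinate in the top cell, meaningful on \<open>Oc\<close>, where
    \<open>u\<close> is interior to that cell.\<close>
  define ut where "ut x = snd (u x)" for x
  define Oc where "Oc = {x \<in> P. u x \<notin> A}"
  have cP: "closed P" using P(1) by (rule compact_imp_closed)
  have uO: "u x = (c, ut x)" "ut x \<in> cube m" "ut x \<notin> bdry m" if "x \<in> Oc" for x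
  proof -
    have "u x \<in> pts (upto_cell c)" "u x \<notin> A" using that u(2) by (auto simp: Oc_def)
    then show "u x = (c, ut x)" "ut x \<in> cube m" "ut x \<notin> bdry m"
      by (auto simp: A_def cpts_def ut_def m_def cubeB_def)
  qed
  have \<Phi>_int: "\<Phi> c t = (c, t)" if "t \<notin> bdry m" for t using that by (simp add: cmap_def cubeB_def m_def)
  have \<Phi>_bd: "\<Phi> c t = att c t" if "t \<in> bdry m" for t using that by (simp add: cmap_def cubeB_def m_def)
  have \<Phi>_bdA: "\<Phi> c t \<in> A" if "t \<in> bdry m" for t using that att_below[OF c] \<Phi>_bd by (simp add: A_def m_def)
  have notA: "(c, t) \<notin> A" for t using not_below_self by (auto simp: A_def cpts_def)
  have clP: "closed {x \<in> P. u x \<in> V}" if "closedin (tp C) V" for V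
    using closedin_continuous_map_preimage[OF u(1) that] cP by (simp add: closedin_closed_trans)
  have clA: "closedin (tp C) A" unfolding A_def by (rule closedin_pts_stage) simp
  have Oc_open: "open (- {x \<in> P. u x \<in> A})" "Oc = P \<inter> - {x \<in> P. u x \<in> A}"
    using clP[OF clA] by (auto simp: Oc_def)
  have cont_ut: "continuous_on Oc ut"
  proof -
    have "continuous_map (top_of_set Oc) (top_of_set (cube m)) ut"
      unfolding continuous_map_closedin
    proof (intro conjI allI impI funcsetI)
      fix x assume "x \<in> topspace (top_of_set Oc)" then show "ut x \<in> topspace (top_of_set (cube m))" using uO by simp
    next
      fix V assume "closedin (top_of_set (cube m)) V"
      then have V: "closed V" "V \<subseteq> cube m" using closed_cube closedin_closed_trans closedin_subset by fastforce+
      \<comment> \<open>The part of \<open>V\<close> interior to the cell need not be closed in the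
        complex; it becomes so after adding \<open>A\<close>, which \<open>Oc\<close>
        avoids.\<close>
      have "closed {x \<in> P. u x \<in> A \<union> {c} \<times> (V - bdry m)}"
        unfolding A_def m_def by (rule clP[OF closedin_top_cell(1)[OF c]]) (use V in \<open>auto simp: m_def\<close>)
      moreover have "{x \<in> topspace (top_of_set Oc). ut x \<in> V} = Oc \<inter> {x \<in> P. u x \<in> A \<union> {c} \<times> (V - bdry m)}"
      proof -
        have "ut x \<in> V \<longleftrightarrow> u x \<in> A \<union> {c} \<times> (V - bdry m)" if "x \<in> Oc" for x
          using uO[OF that] that by (simp add: Oc_def)
        then show ?thesis by (auto simp: Oc_def)
      qed
      ultimately show "closedin (top_of_set Oc) {x \<in> topspace (top_of_set Oc). ut x \<in> V}"
        by (simp only: closedin_closed_Int)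
    qed
    then show ?thesis by simp
  qed
  define S where "S = {x \<in> P. smooth_at k P u x}"
  obtain TS where TS: "open TS" "S = P \<inter> TS" using open_smooth_at_set[OF P(2)] unfolding S_def by blast
  have PS: "P - S = P - TS" using TS(2) by blast
  have QS: "Q \<subseteq> S" using smQ Q(2) by (auto simp: S_def)
  \<comment> \<open>Nothing will move near \<open>Q\<close>, where \<beta> is 0. The modification is
    complete near the points where \<open>u\<close> is not yet smooth, where \<beta> is 1. In
    between \<open>u\<close> is smooth already and has to be kept so.\<close>
  obtain \<beta> O0 O1 where beta: "\<And>k V. openin (euclid k) V \<Longrightarrow> smooth_fun k V \<beta>" "\<And>x. 0 \<le> \<beta> x \<and> \<beta> x \<le> 1"
    "continuous_on UNIV \<beta>" "open O0" "Q \<subseteq> O0" "\<And>x. x \<in> O0 \<Longrightarrow> \<beta> x = 0" "open O1" "P - S \<subseteq> O1" "\<And>x. x \<in> O1 \<Longrightarrow> \<beta> x = 1"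
  proof (rule smooth_cutoff[OF P(1) Q(1), of "P - S"])
    show "closed (P - S)" unfolding PS using cP TS(1) by (rule closed_Diff)
  qed (use Q QS in auto)
  define E where "E \<eta> = {t \<in> cube m. \<forall>j<m. \<eta> \<le> t j \<and> t j \<le> 1 - \<eta>}" for \<eta>
  have E_closed: "closed (E \<eta>)" for \<eta>
  proof -
    have "E \<eta> = cube m \<inter> (\<Inter>j\<in>{..<m}. {t. \<eta> \<le> t j} \<inter> {t. t j \<le> 1 - \<eta>})" by (auto simp: E_def)
    moreover have "closed (\<Inter>j\<in>{..<m}. {t::nat\<Rightarrow>real. \<eta> \<le> t j} \<inter> {t. t j \<le> 1 - \<eta>})"
      by (intro closed_INT ballI closed_Int closed_Collect_le continuous_on_coord continuous_on_const)
    ultimately show ?thesis using closed_cube by auto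
  qed
  have E_bd: "E \<eta> \<inter> bdry m = {}" if "\<eta> > 0" for \<eta>
    using that by (fastforce simp: E_def bdry_def)
  \<comment> \<open>A compact part of \<open>Oc\<close> containing all its points where
    \<open>deepness\<close> of the cell coordinate is nonzero; only there is an approximation
    required.\<close>
  define K0 where "K0 = {x \<in> P. u x \<in> {c} \<times> E (\<delta>/2)}"
  have K0_closed: "closed K0" unfolding K0_def
    by (rule clP[OF closedin_top_cell(2)[OF c E_closed]]) (use E_bd[of "\<delta>/2"] d0 in \<open>auto simp: E_def m_def\<close>)
  have K0_Oc: "K0 \<subseteq> Oc" using notA by (auto simp: K0_def Oc_def)
  have K0_compact: "compact K0"
    using K0_closed P(1) by (metis (no_types, lifting) K0_def closed_Int_compact inf.absorb1 mem_Collect_eq subsetI)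
  have K0_iff: "x \<in> K0 \<longleftrightarrow> ut x \<in> E (\<delta>/2)" if "x \<in> Oc" for x
    using uO(1)[OF that] that by (auto simp: K0_def Oc_def)
  have "\<exists>w. is_polynomial 0 w \<and> (\<forall>x\<in>K0. \<bar>ut x j - w x\<bar> < \<delta>/4)" for j
  proof -
    have "continuous_on K0 (\<lambda>x. ut x j)"
      by (rule continuous_on_product_then_coordinatewise[OF continuous_on_subset[OF cont_ut K0_Oc]])
    moreover have "0 < \<delta>/4" using d0 by simp
    ultimately obtain g where "is_polynomial 0 g" "\<And>x. x \<in> K0 \<Longrightarrow> \<bar>ut x j - g x\<bar> < \<delta>/4"
      using polynomial_approximation[OF K0_compact] by blast
    then show ?thesis by blast
  qed
  then obtain W where W: "\<And>j. is_polynomial 0 (W j)" "\<And>j x. x \<in> K0 \<Longrightarrow> \<bar>ut x j - W j x\<bar> < \<delta>/4" by metis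
  define w where "w x = (\<lambda>j. if j < m then W j x else 0)" for x
  have cont_w: "continuous_on Z w" for Z
  proof (rule continuous_on_coordinatewise_then_product)
    fix j show "continuous_on Z (\<lambda>x. w x j)"
      by (cases "j < m") (auto simp: w_def intro: is_polynomial_continuous[OF W(1)])
  qed
  have smooth_w: "smooth_fun k' V (\<lambda>x. w x j)" if "openin (euclid k') V" for k' V j
    by (cases "j < m") (auto simp: w_def intro: is_polynomial_smooth[OF W(1) that])
  have not_K0: "deepness m \<delta> (ut x) = 0" if x: "x \<in> Oc" "x \<notin> K0" for x
  proof -
    have "ut x \<notin> E (\<delta>/2)" using K0_iff x by blast
    then obtain j where "j < m" "\<not> (\<delta>/2 \<le> ut x j \<and> ut x j \<le> 1 - \<delta>/2)"
      using uO(2)[OF x(1)] unfolding E_def by blast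
    then show ?thesis by (intro deepness_0[OF d0(1)]) auto
  qed
  have nudge_near: "\<bar>nudge m \<delta> b (ut x) (w x) j - ut x j\<bar> < \<delta>/4" if x: "x \<in> Oc" and b: "0 \<le> b" "b \<le> 1" for x b j
  proof (cases "x \<in> K0 \<and> j < m")
    case True
    have "\<bar>b * deepness m \<delta> (ut x) * (w x j - ut x j)\<bar> \<le> 1 * \<bar>w x j - ut x j\<bar>"
      unfolding abs_mult[of "b * deepness m \<delta> (ut x)"]
      using b deepness_range[of m \<delta> "ut x"] by (intro mult_right_mono) (auto simp: abs_mult intro: mult_le_one)
    also have "\<dots> < \<delta>/4" using W(2)[of x j] True by (simp add: w_def abs_minus_commute)
    finally show ?thesis using True by (simp add: nudge_def)
  next
    case False
    show ?thesis
    proof (cases "j < m")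
      case True
      then have "deepness m \<delta> (ut x) = 0" using False not_K0[OF x] by simp
      then show ?thesis using d0 True by (simp add: nudge_def)
    next
      case j: False
      then have "ut x j = 0" using uO(2)[OF x] by (simp add: cube_def)
      then show ?thesis using d0 j by (simp add: nudge_def)
    qed
  qed
  \<comment> \<open>On \<open>K0\<close> coordinates keep distance \<delta>/2 from the faces and
    move by less than \<delta>/4; off \<open>K0\<close> they do not move.\<close>
  have nudge_int: "nudge m \<delta> b (ut x) (w x) \<in> cube m - bdry m" if x: "x \<in> Oc" and b: "0 \<le> b" "b \<le> 1" for x b
  proof (cases "x \<in> K0")
    case True
    then have E2: "ut x \<in> E (\<delta>/2)" using K0_iff x by simp
    have "0 < nudge m \<delta> b (ut x) (w x) j \<and> nudge m \<delta> b (ut x) (w x) j < 1" if "j < m" for j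
    proof -
      have "\<delta>/2 \<le> ut x j" "ut x j \<le> 1 - \<delta>/2" using E2 that by (auto simp: E_def)
      then show ?thesis using nudge_near[OF x b, of j] d0 by linarith
    qed
    then show ?thesis by (fastforce simp: cube_def bdry_def less_imp_le nudge_def[of m _ _ _ _] )
  next
    case False
    then show ?thesis using nudge_flat[OF uO(2)[OF x], of b \<delta> "w x"] not_K0[OF x] uO[OF x] by simp
  qed
  \<comment> \<open>Nudge and collar push run together with the parameter
    \<open>s * \<beta> x\<close>, which is 0 at time 0 and, near \<open>Q\<close>, at all
    times.\<close>
  define H where "H = (\<lambda>(s, x). if u x \<in> A then u x else \<Phi> c (collar_push m \<epsilon> (s * \<beta> x) (nudge m \<delta> (s * \<beta> x) (ut x) (w x))))"
  have sb: "0 \<le> s * \<beta> x \<and> s * \<beta> x \<le> 1" if "s \<in> {0..1}" for s x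
    using that beta(2)[of x] by (auto intro: mult_le_one)
  \<comment> \<open>The collar push as a map of the whole stage, consistent across the boundary
    because \<open>att c\<close> is invariant under it. It takes over where \<open>u\<close>
    approaches \<open>A\<close> and no cell coordinate is available.\<close>
  define rr where "rr = (\<lambda>(a, b). if a \<in> A then a else \<Phi> c (collar_push m \<epsilon> b (snd a)))"
  interpret B: cellspace "upto_cell c" R "cubeK n" "cubeB n" att by (rule cellspace_initial[OF initial_upto[OF c]])
  have rr_\<Phi>: "rr (\<Phi> c t, b) = \<Phi> c (collar_push m \<epsilon> b t)" if "t \<in> cube m" "0 \<le> b" "b \<le> 1" for t b
  proof (cases "t \<in> bdry m")
    case True
    then show ?thesis using \<Phi>_bdA[OF True] collar_push_bdry[OF e that(2,3) True] att_collar_push[OF that(2,3) True]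
      by (simp add: rr_def \<Phi>_bd)
  next
    case False then show ?thesis using notA by (simp add: rr_def \<Phi>_int)
  qed
  have rr_cont: "continuous_map (prod_topology (tp (upto_cell c)) unit_iv) (tp C) rr"
  proof (rule B.continuous_from_prod)
    fix d assume d: "d \<in> upto_cell c"
    then have dC: "d \<in> C" using c by (auto simp: cbelow_def)
    show "continuous_map (prod_topology (cubeK n d) unit_iv) (tp C) (\<lambda>(t, s). rr (\<Phi> d t, s))"
    proof (cases "d = c")
      case True
      have "continuous_map (top_of_set (cube m \<times> {0..1})) (top_of_set (cube m)) (\<lambda>z. collar_push m \<epsilon> (snd z) (fst z))"
        by (rule continuous_map_top_of_setI, intro continuous_on_collar_push continuous_intros) (use collar_push_cube[OF e] in auto)
      moreover have "continuous_map (top_of_set (cube m)) (tp C) (\<Phi> c)"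
        using \<Phi>_cont[OF c] by (simp add: cubeK_def cube_top_def m_def)
      ultimately have "continuous_map (top_of_set (cube m \<times> {0..1})) (tp C) (\<Phi> c \<circ> (\<lambda>z. collar_push m \<epsilon> (snd z) (fst z)))"
        by (rule continuous_map_compose)
      then have "continuous_map (top_of_set (cube m \<times> {0..1})) (tp C) (\<lambda>z. \<Phi> c (collar_push m \<epsilon> (snd z) (fst z)))"
        by (simp only: o_def)
      then have "continuous_map (top_of_set (cube m \<times> {0..1})) (tp C) (\<lambda>(t, s). rr (\<Phi> c t, s))"
        by (rule continuous_map_eq) (use rr_\<Phi> in auto)
      then show ?thesis by (simp add: True cubeK_def cube_top_def m_def)
    next
      case False
      then have "d \<in> cbelow C R c" using d by simp
      then have "\<Phi> d t \<in> A" if "t \<in> cube (n d)" for t using \<Phi>_below that by (simp add: A_def)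
      moreover have "continuous_map (prod_topology (cubeK n d) unit_iv) (tp C) (\<lambda>z. \<Phi> d (fst z))"
        using continuous_map_compose[OF continuous_map_fst \<Phi>_cont[OF dC]] by (simp add: o_def)
      ultimately show ?thesis by (elim continuous_map_eq) (auto simp: rr_def)
    qed
  qed
  have H_cont: "continuous_map (prod_topology unit_iv (top_of_set P)) (tp C) H"
  proof (rule paste_open2)
    \<comment> \<open>On \<open>?U1\<close> the cell coordinate is continuous; on \<open>?U2\<close>
      there is no nudge, so \<open>H\<close> is \<open>rr\<close> along \<open>u\<close>.\<close>
    let ?U1 = "{0..1::real} \<times> Oc" and ?U2 = "{0..1::real} \<times> (P - K0)"
    have opO: "openin (top_of_set P) Oc" "openin (top_of_set P) (P - K0)"
      using Oc_open K0_closed by (auto simp: openin_open intro: exI[of _ "- K0"])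
    show "openin (prod_topology unit_iv (top_of_set P)) ?U1" "openin (prod_topology unit_iv (top_of_set P)) ?U2"
      using opO by (simp_all only: openin_prod_Times_iff) auto
    show "topspace (prod_topology unit_iv (top_of_set P)) \<subseteq> ?U1 \<union> ?U2" using K0_Oc by auto
    have st: "subtopology (prod_topology unit_iv (top_of_set P)) ?U1 = top_of_set ?U1"
      "subtopology (prod_topology unit_iv (top_of_set P)) ?U2 = prod_topology unit_iv (top_of_set (P - K0))"
      by (auto simp: subtopology_subtopology Oc_def Times_Int_Times intro!: arg_cong[of _ _ top_of_set])
    have c1: "continuous_on ?U1 (\<lambda>z. fst z * \<beta> (snd z))"
      by (intro continuous_intros continuous_on_compose2[OF beta(3)]) auto
    have "continuous_map (top_of_set ?U1) (top_of_set (cube m)) (\<lambda>z. collar_push m \<epsilon> (fst z * \<beta> (snd z)) (nudge m \<delta> (fst z * \<beta> (snd z)) (ut (snd z)) (w (snd z))))"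
    proof (rule continuous_map_top_of_setI)
      show "continuous_on ?U1 (\<lambda>z. collar_push m \<epsilon> (fst z * \<beta> (snd z)) (nudge m \<delta> (fst z * \<beta> (snd z)) (ut (snd z)) (w (snd z))))"
        by (intro continuous_on_collar_push continuous_on_nudge c1 continuous_on_compose2[OF cont_ut] continuous_on_compose2[OF cont_w[of UNIV]] continuous_intros) auto
      show "(\<lambda>z. collar_push m \<epsilon> (fst z * \<beta> (snd z)) (nudge m \<delta> (fst z * \<beta> (snd z)) (ut (snd z)) (w (snd z)))) ` ?U1 \<subseteq> cube m"
        using sb nudge_int by (auto intro!: collar_push_cube[OF e])
    qed
    moreover have "continuous_map (top_of_set (cube m)) (tp C) (\<Phi> c)"
      using \<Phi>_cont[OF c] by (simp add: cubeK_def cube_top_def m_def)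
    ultimately have "continuous_map (top_of_set ?U1) (tp C) (\<Phi> c \<circ> (\<lambda>z. collar_push m \<epsilon> (fst z * \<beta> (snd z)) (nudge m \<delta> (fst z * \<beta> (snd z)) (ut (snd z)) (w (snd z)))))"
      by (rule continuous_map_compose)
    then have "continuous_map (top_of_set ?U1) (tp C) (\<lambda>z. \<Phi> c (collar_push m \<epsilon> (fst z * \<beta> (snd z)) (nudge m \<delta> (fst z * \<beta> (snd z)) (ut (snd z)) (w (snd z)))))"
      by (simp only: o_def)
    then show "continuous_map (subtopology (prod_topology unit_iv (top_of_set P)) ?U1) (tp C) H"
      unfolding st by (rule continuous_map_eq) (auto simp: H_def Oc_def)
    have uB: "continuous_map (top_of_set P) (tp (upto_cell c)) u"
      using u unfolding stage_subtopology[OF initial_upto[OF c]] by (auto simp: continuous_map_in_subtopology)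
    have "continuous_map (prod_topology unit_iv (top_of_set (P - K0))) (prod_topology (tp (upto_cell c)) unit_iv) (\<lambda>z. (u (snd z), fst z * \<beta> (snd z)))"
      unfolding continuous_map_pairwise o_def fst_conv snd_conv
    proof
      show "continuous_map (prod_topology unit_iv (top_of_set (P - K0))) (tp (upto_cell c)) (\<lambda>z. u (snd z))"
        by (rule continuous_map_compose[OF continuous_map_snd continuous_map_from_subtopology_mono[OF uB], unfolded o_def]) auto
      have "continuous_map (top_of_set ({0..1} \<times> (P - K0))) unit_iv (\<lambda>z. fst z * \<beta> (snd z))"
        by (rule continuous_map_top_of_setI, intro continuous_intros continuous_on_compose2[OF beta(3)]) (use sb in auto)
      then show "continuous_map (prod_topology unit_iv (top_of_set (P - K0))) unit_iv (\<lambda>z. fst z * \<beta> (snd z))" by simp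
    qed
    from continuous_map_compose[OF this rr_cont]
    have "continuous_map (prod_topology unit_iv (top_of_set (P - K0))) (tp C) (\<lambda>z. rr (u (snd z), fst z * \<beta> (snd z)))" by (simp only: o_def)
    then show "continuous_map (subtopology (prod_topology unit_iv (top_of_set P)) ?U2) (tp C) H"
      unfolding st
    proof (rule continuous_map_eq)
      fix z assume "z \<in> topspace (prod_topology unit_iv (top_of_set (P - K0)))"
      then obtain s x where z: "z = (s, x)" "s \<in> {0..1}" "x \<in> P" "x \<notin> K0" by (cases z) auto
      show "rr (u (snd z), fst z * \<beta> (snd z)) = H z"
      proof (cases "u x \<in> A")
        case False
        then have x: "x \<in> Oc" using z by (simp add: Oc_def)
        then have "nudge m \<delta> (s * \<beta> x) (ut x) (w x) = ut x" using nudge_flat[OF uO(2)[OF x]] not_K0[OF x z(4)] by simp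
        then show ?thesis using False z uO(1)[OF x] by (simp add: H_def rr_def)
      qed (simp add: H_def rr_def z)
    qed
  qed
  define u2 where "u2 x = H (1, x)" for x
  have H0: "H (0, x) = u x" if "x \<in> P" for x
  proof (cases "u x \<in> A")
    case False
    then have x: "x \<in> Oc" using that by (simp add: Oc_def)
    then show ?thesis using False nudge_flat[OF uO(2)[OF x]] collar_push_0[OF uO(2)[OF x]] uO[OF x] \<Phi>_int by (simp add: H_def)
  qed (simp add: H_def)
  have H_O0: "H (s, x) = u x" if "x \<in> P" "x \<in> O0" for s x
  proof -
    have "H (s, x) = H (0, x)" using beta(6)[OF that(2)] by (simp add: H_def)
    then show ?thesis using H0[OF that(1)] by simp
  qed
  have u2_cont: "continuous_map (top_of_set P) (tp C) u2"
    using continuous_map_compose[OF continuous_map_pairedI[OF continuous_map_const[THEN iffD2] continuous_map_id] H_cont, of 1]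
    by (simp add: u2_def[abs_def] o_def)
  have hom1: "homotopic_with (\<lambda>f. \<forall>x\<in>N. f x = u x) (top_of_set P) (tp C) u u2" if N: "N \<subseteq> P \<inter> O0" for N
  proof (subst homotopic_rel_iff)
    show "\<exists>h. continuous_map (prod_topology unit_iv (top_of_set P)) (tp C) h \<and> (\<forall>x\<in>topspace (top_of_set P). h (0, x) = u x) \<and>
      (\<forall>x\<in>topspace (top_of_set P). h (1, x) = u2 x) \<and> (\<forall>t\<in>{0..1}. \<forall>x\<in>N. h (t, x) = u x)"
    proof (intro exI[of _ H] conjI ballI)
      show "H (t, x) = u x" if "x \<in> N" for t x using N that by (intro H_O0) blast+
    qed (use H_cont H0 in \<open>simp_all add: u2_def\<close>)
  qed (use N in auto)
  have u2_Oc: "u2 x = \<Phi> c (collar_push m \<epsilon> (\<beta> x) (nudge m \<delta> (\<beta> x) (ut x) (w x)))" if "x \<in> Oc" for x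
    using that by (simp add: u2_def H_def Oc_def)
  have u2_A: "u2 x = u x" if "u x \<in> A" for x using that by (simp add: u2_def H_def)
  \<comment> \<open>A lift of \<open>u\<close> to a lower cell survives unchanged. A lift
    \<open>q\<close> to the top cell is also defined off \<open>P\<close>, so nudge and push can be
    applied to \<open>q\<close> in place of the coordinate of \<open>u\<close>.\<close>
  have clean_S: "smooth_at k P u2 x" if x: "x \<in> S" for x
  proof -
    have xP: "x \<in> P" "smooth_at k P u x" using x by (auto simp: S_def)
    have uC: "upto_cell c \<subseteq> C" using c cbelow_subset[of C R c] by blast
    obtain V d q where V: "openin (euclid k) V" "x \<in> V" "d \<in> upto_cell c" "q ` V \<subseteq> cube (n d)" "smooth_map_eu k V (n d) q"
      "\<forall>y\<in>V \<inter> P. u y = \<Phi> d (q y)"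
      using lower_lift[OF u(2) uC xP] by blast
    show ?thesis
    proof (cases "d = c")
      case False
      then have dA: "d \<in> cbelow C R c" using V(3) by simp
      have "u2 y = \<Phi> d (q y)" if "y \<in> V \<inter> P" for y
        using V(4,6) that \<Phi>_below[OF dA, of "q y"] u2_A[of y] by (auto simp: A_def)
      moreover have "d \<in> C" using V(3) uC by blast
      ultimately show ?thesis unfolding smooth_at_def using V(1,2,4,5)
        by (intro exI[of _ V] exI[of _ d] exI[of _ q]) simp
    next
      case True
      have q: "q ` V \<subseteq> cube m" "smooth_map_eu k V m q" "\<And>y. y \<in> V \<Longrightarrow> y \<in> P \<Longrightarrow> u y = \<Phi> c (q y)"
        using V(4-6) True by (auto simp: m_def)
      define z where "z y = nudge m \<delta> (\<beta> y) (q y) (w y)" for y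
      have deep_bd: "deepness m \<delta> t = 0" if "t \<in> bdry m" for t
      proof -
        obtain j where "j < m" "t j = 0 \<or> t j = 1" using \<open>t \<in> bdry m\<close> by (auto simp: bdry_def)
        then show ?thesis using d0 by (intro deepness_0[of \<delta> j]) auto
      qed
      have form: "u2 y = \<Phi> c (collar_push m \<epsilon> (\<beta> y) (z y))" if y: "y \<in> V" "y \<in> P" for y
      proof (cases "q y \<in> bdry m")
        case True
        have "u2 y = att c (q y)" using u2_A[of y] q(3)[OF y] \<Phi>_bdA[OF True] \<Phi>_bd[OF True] by simp
        moreover have "z y = q y" unfolding z_def using q(1) y by (intro nudge_flat) (auto simp: deep_bd[OF True])
        ultimately show ?thesis using beta(2)[of y] collar_push_bdry[OF e _ _ True, of "\<beta> y"] att_collar_push[OF _ _ True, of "\<beta> y"] \<Phi>_bd by simp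
      next
        case False
        then have "u y = (c, q y)" using q(3)[OF y] \<Phi>_int by simp
        then have "y \<in> Oc" "ut y = q y" using y notA by (auto simp: Oc_def ut_def)
        then show ?thesis using u2_Oc by (simp add: z_def)
      qed
      have smz: "smooth_map_eu k V m z" unfolding z_def
        by (rule smooth_map_nudge[OF V(1) beta(1)[OF V(1)] _ smooth_w[OF V(1)]]) (use q(2) in \<open>auto simp: smooth_map_eu_def\<close>)
      \<comment> \<open>Off \<open>P\<close> the polynomial \<open>w\<close> is not controlled, so
        the neighbourhood has to shrink: near a face \<open>deepness\<close> vanishes and
        \<open>z\<close> is \<open>q\<close>; at an interior point openness of the interior
        suffices.\<close>
      have "\<exists>V'. openin (euclid k) V' \<and> x \<in> V' \<and> V' \<subseteq> V \<and> z ` V' \<subseteq> cube m"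
      proof (cases "q x \<in> bdry m")
        case True
        then obtain j where j: "j < m" "q x j = 0 \<or> q x j = 1" by (auto simp: bdry_def)
        define \<alpha> where "\<alpha> = q x j"
        let ?V' = "{y \<in> V. q y \<in> {t \<in> euc m. \<bar>t j - \<alpha>\<bar> < \<delta>/2}}"
        have "openin (euclid m) {t \<in> euc m. \<bar>t j - \<alpha>\<bar> < \<delta>/2}"
          unfolding openin_euclid_iff
          by (intro exI[of _ "{t. \<bar>t j - \<alpha>\<bar> < \<delta>/2}"] conjI open_Collect_less continuous_intros continuous_on_coord) auto
        then have "openin (euclid k) ?V'"
          by (rule openin_euclid_preimage[OF V(1) smooth_map_eu_continuous[OF q(2)] q(2)[unfolded smooth_map_eu_def, THEN conjunct1]])
        moreover have "x \<in> ?V'" using V(2) q(1) d0 cube_subset_euc[of m] by (auto simp: \<alpha>_def)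
        moreover have "z ` ?V' \<subseteq> cube m"
        proof (intro image_subsetI)
          fix y assume y: "y \<in> ?V'"
          then have "\<bar>q y j - \<alpha>\<bar> < \<delta>/2" by simp
          then have "q y j \<le> \<delta>/2 \<or> 1 - \<delta>/2 \<le> q y j" using j(2) unfolding \<alpha>_def by linarith
          then have "deepness m \<delta> (q y) = 0" by (rule deepness_0[OF d0(1) j(1)])
          moreover have "q y \<in> cube m" using q(1) y by auto
          ultimately show "z y \<in> cube m" unfolding z_def by (simp add: nudge_flat)
        qed
        ultimately show ?thesis by (intro exI[of _ ?V']) auto
      next
        case False
        then have "u x = (c, q x)" using q(3) V(2) xP \<Phi>_int by simp
        then have "x \<in> Oc" "ut x = q x" using xP notA by (auto simp: Oc_def ut_def)
        then have "z x \<in> cube m - bdry m" using nudge_int[of x "\<beta> x"] beta(2)[of x] by (simp add: z_def)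
        moreover have "openin (euclid k) {y \<in> V. z y \<in> cube m - bdry m}"
          using openin_euclid_preimage[OF V(1) smooth_map_eu_continuous[OF smz] _ openin_ocube] smz by (auto simp: smooth_map_eu_def)
        ultimately show ?thesis using V(2) by (intro exI[of _ "{y \<in> V. z y \<in> cube m - bdry m}"]) auto
      qed
      then obtain V' where V': "openin (euclid k) V'" "x \<in> V'" "V' \<subseteq> V" "z ` V' \<subseteq> cube m" by blast
      have "smooth_map_eu k V' m (\<lambda>y. collar_push m \<epsilon> (\<beta> y) (z y))"
        by (rule smooth_map_collar_push[OF V'(1) beta(1)[OF V'(1)]])
          (use smooth_map_eu_subset[OF smz V'(3)] in \<open>auto simp: smooth_map_eu_def\<close>)
      moreover have "(\<lambda>y. collar_push m \<epsilon> (\<beta> y) (z y)) ` V' \<subseteq> cube m"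
        using V'(4) beta(2) by (auto intro!: collar_push_cube[OF e])
      ultimately show ?thesis unfolding smooth_at_def using V' form c
        by (intro exI[of _ V'] exI[of _ c] exI[of _ "\<lambda>y. collar_push m \<epsilon> (\<beta> y) (z y)"]) (auto simp: m_def)
    qed
  qed
  \<comment> \<open>Around such a point of \<open>P\<close>, both \<beta> and
    \<open>deepness\<close> are 1, so the nudged coordinate is the polynomial \<open>w\<close>,
    which extends off \<open>P\<close>.\<close>
  have clean_deep: "smooth_at k P u2 x" if x: "x \<in> Oc" "nudge m \<delta> (\<beta> x) (ut x) (w x) \<in> E (2 * \<delta>)" "x \<notin> S" for x
  proof -
    have xP: "x \<in> P" "x \<in> O1" using x beta(8) by (auto simp: Oc_def)
    define G where "G = (\<Inter>j\<in>{..<m}. {t::nat\<Rightarrow>real. \<delta> < t j} \<inter> {t. t j < 1 - \<delta>})"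
    have "open G" unfolding G_def
      by (intro open_INT ballI open_Int open_Collect_less continuous_on_coord continuous_on_const) auto
    then have "openin (top_of_set Oc) (Oc \<inter> ut -` G)" by (rule continuous_openin_preimage_gen[OF cont_ut])
    then obtain T' where T': "open T'" "Oc \<inter> ut -` G = Oc \<inter> T'" by (auto simp: openin_open)
    define Tn where "Tn = T' \<inter> (- {x \<in> P. u x \<in> A}) \<inter> O1"
    have Tn: "open Tn" unfolding Tn_def using T'(1) Oc_open(1) beta(7) by blast
    have "ut x \<in> G"
    proof -
      have "\<delta> < ut x j \<and> ut x j < 1 - \<delta>" if "j < m" for j
      proof -
        have "2 * \<delta> \<le> nudge m \<delta> (\<beta> x) (ut x) (w x) j" "nudge m \<delta> (\<beta> x) (ut x) (w x) j \<le> 1 - 2 * \<delta>"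
          using x(2) that by (auto simp: E_def)
        then show ?thesis using nudge_near[OF x(1), of "\<beta> x" j] beta(2)[of x] d0 by linarith
      qed
      then show ?thesis by (simp add: G_def)
    qed
    then have xTn: "x \<in> Tn" using T'(2) x(1) xP by (auto simp: Tn_def Oc_def)
    have mvw: "y \<in> Oc \<and> \<beta> y = 1 \<and> nudge m \<delta> (\<beta> y) (ut y) (w y) = w y" if y: "y \<in> Tn" "y \<in> P" for y
    proof -
      have yO: "y \<in> Oc" "\<beta> y = 1" using y beta(9) by (auto simp: Tn_def Oc_def)
      then have "ut y \<in> G" using T'(2) y by (auto simp: Tn_def)
      then have "deepness m \<delta> (ut y) = 1" by (intro deepness_1[OF d0(1)]) (auto simp: G_def less_imp_le)
      then show ?thesis using yO by (auto simp: nudge_def w_def fun_eq_iff)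
    qed
    let ?V = "{y \<in> euc k \<inter> Tn. w y \<in> cube m - bdry m}"
    have o1: "openin (euclid k) (euc k \<inter> Tn)" using Tn openin_euclid_iff by blast
    have wm: "smooth_map_eu k (euc k \<inter> Tn) m w" unfolding smooth_map_eu_def
      by (intro conjI allI impI smooth_w[OF o1]) (auto simp: w_def euc_def)
    have V: "openin (euclid k) ?V"
      using openin_euclid_preimage[OF o1 smooth_map_eu_continuous[OF wm] _ openin_ocube] wm by (auto simp: smooth_map_eu_def)
    have "nudge m \<delta> (\<beta> x) (ut x) (w x) = w x" using mvw[OF xTn xP(1)] by blast
    then have "w x \<in> cube m - bdry m" using nudge_int[OF x(1), of "\<beta> x"] beta(2)[of x] by (simp only:)
    then have xV: "x \<in> ?V" using xP P(2) xTn by auto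
    have "smooth_map_eu k ?V m (\<lambda>y. collar_push m \<epsilon> 1 (w y))"
      by (rule smooth_map_collar_push[OF V smooth_fun_const smooth_w[OF V]])
    moreover have "(\<lambda>y. collar_push m \<epsilon> 1 (w y)) ` ?V \<subseteq> cube m" by (auto intro!: collar_push_cube[OF e])
    moreover have "u2 y = \<Phi> c (collar_push m \<epsilon> 1 (w y))" if "y \<in> ?V \<inter> P" for y
    proof -
      have y: "y \<in> Oc" "\<beta> y = 1" "nudge m \<delta> (\<beta> y) (ut y) (w y) = w y" using mvw[of y] that by blast+
      show ?thesis unfolding u2_Oc[OF y(1)] y(3) by (simp only: y(2))
    qed
    ultimately show ?thesis unfolding smooth_at_def using V xV c
      by (intro exI[of _ ?V] exI[of _ c] exI[of _ "\<lambda>y. collar_push m \<epsilon> 1 (w y)"]) (auto simp: m_def)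
  qed
  \<comment> \<open>The part that has been carried into the lower stage and is left to the induction
    hypothesis.\<close>
  define T where "T = {x \<in> P. u2 x \<in> A}"
  have T_closed: "closed T" unfolding T_def
    using closedin_continuous_map_preimage[OF u2_cont clA] cP by (simp add: closedin_closed_trans)
  \<comment> \<open>Where \<open>u\<close> was not smooth, points of the closed set \<open>D\<close>
    are covered by \<open>clean_deep\<close>. Near any other such point of \<open>P\<close>
    everything has been pushed into \<open>A\<close>, so it is not in the closure of the complement
    of \<open>T\<close>.\<close>
  have fr: "smooth_at k P u2 x" if x: "x \<in> P" "x \<in> closure (P - T)" for x
  proof (cases "x \<in> S")
    case False
    then have xO1: "x \<in> O1" using x(1) beta(8) by auto
    define D where "D = K0 \<inter> (\<lambda>x. nudge m \<delta> (\<beta> x) (ut x) (w x)) -` E (2 * \<delta>)"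
    have "closed D" unfolding D_def
      by (rule continuous_closed_preimage[OF _ K0_closed E_closed])
        (intro continuous_on_nudge cont_w continuous_on_subset[OF cont_ut K0_Oc] continuous_on_subset[OF beta(3)], simp)
    show ?thesis
    proof (cases "x \<in> D")
      case True
      then show ?thesis using clean_deep[of x] False K0_Oc by (auto simp: D_def)
    next
      case xD: False
      have "open (O1 \<inter> - D)" using beta(7) \<open>closed D\<close> by auto
      then have "(O1 \<inter> - D) \<inter> (P - T) \<noteq> {}"
        using x(2) xO1 xD open_Int_closure_eq_empty[of "O1 \<inter> - D" "P - T"] by blast
      then obtain y where y: "y \<in> O1" "y \<notin> D" "y \<in> P" "y \<notin> T" by blast
      then have y2: "u2 y \<notin> A" by (simp add: T_def)
      then have yO: "y \<in> Oc" using u2_A[of y] y(3) by (auto simp: Oc_def)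
      have b1: "\<beta> y = 1" using beta(9)[OF y(1)] .
      let ?z = "nudge m \<delta> (\<beta> y) (ut y) (w y)"
      have zc: "?z \<in> cube m" using nudge_int[OF yO, of "\<beta> y"] b1 by simp
      have nE: "?z \<notin> E (2 * \<delta>)"
      proof
        assume z: "?z \<in> E (2 * \<delta>)"
        have "\<delta>/2 \<le> ut y j \<and> ut y j \<le> 1 - \<delta>/2" if "j < m" for j
        proof -
          have "2 * \<delta> \<le> ?z j" "?z j \<le> 1 - 2 * \<delta>" using z that by (auto simp: E_def)
          then show ?thesis using nudge_near[OF yO, of "\<beta> y" j] b1 d0 by linarith
        qed
        then have "y \<in> K0" using K0_iff[OF yO] uO(2)[OF yO] by (simp add: E_def)
        then show False using y(2) z by (simp add: D_def)
      qed
      then obtain j where j: "j < m" "?z j \<le> 2 * \<delta> \<or> 1 - 2 * \<delta> \<le> ?z j" using zc unfolding E_def by fastforce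
      have "2 * \<delta> \<le> \<epsilon> / 3" using e by (simp add: \<delta>_def)
      then have "?z j \<le> \<epsilon> / 3 \<or> 1 - \<epsilon> / 3 \<le> ?z j" using j(2) by linarith
      then have "collar_fun \<epsilon> (?z j) = 0 \<or> collar_fun \<epsilon> (?z j) = 1" using collar_fun_0[OF e] collar_fun_1[OF e] by blast
      then have "collar_push m \<epsilon> 1 ?z j = 0 \<or> collar_push m \<epsilon> 1 ?z j = 1" using j(1) by (simp add: collar_push_def)
      then have "collar_push m \<epsilon> 1 ?z \<in> bdry m" using collar_push_cube[OF e, of 1 ?z m] zc j(1) by (auto simp: bdry_def)
      then have "u2 y \<in> A" using u2_Oc[OF yO] b1 \<Phi>_bdA by simp
      then show ?thesis using y2 by simp
    qed
  qed (rule clean_S)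
  \<comment> \<open>The frontier of \<open>T\<close> in \<open>P\<close> is included so that the
    homotopy on \<open>T\<close> extends by the constant one on the rest; \<open>Q\<close> is
    included to keep the relative condition.\<close>
  define Q2 where "Q2 = T \<inter> (closure (P - T) \<union> Q)"
  have TP: "T \<subseteq> P" by (auto simp: T_def)
  have cT: "compact T" using compact_Int_closed[OF P(1) T_closed] TP by (simp add: Int_absorb1)
  have "approximable k T Q2 u2"
  proof (rule approx_reduce[of "cbelow C R c"])
    show "approx_claim k d" if "d \<in> cbelow C R c" for d using IH[OF that] .
    show "cbelow C R c \<subseteq> C" by (rule cbelow_subset)
    show "T \<subseteq> euc k" using TP P(2) by simp
    show "closed Q2" unfolding Q2_def using T_closed Q(1) by auto
    show "continuous_map (top_of_set T) (tp C) u2" by (rule continuous_map_from_subtopology_mono[OF u2_cont TP])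
    show "u2 ` T \<subseteq> pts (cbelow C R c)" by (auto simp: T_def A_def)
    show "\<forall>x\<in>Q2. smooth_at k T u2 x"
    proof
      fix x assume x: "x \<in> Q2"
      then have "smooth_at k P u2 x" using fr TP clean_S QS by (auto simp: Q2_def)
      then show "smooth_at k T u2 x" by (rule smooth_at_local[of _ _ _ _ UNIV]) (use TP in auto)
    qed
  qed (use cT in \<open>auto simp: Q2_def\<close>)
  then obtain N2 v2 where N2: "openin (top_of_set T) N2" "Q2 \<subseteq> N2"
    "homotopic_with (\<lambda>f. \<forall>x\<in>N2. f x = u2 x) (top_of_set T) (tp C) u2 v2" "\<forall>x\<in>T. smooth_at k T v2 x"
    unfolding approximable_def by blast
  obtain G where G: "open G" "N2 = T \<inter> G" using N2(1) by (auto simp: openin_open)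
  have "N2 \<subseteq> T" using G(2) by auto
  have "\<exists>h. continuous_map (prod_topology unit_iv (top_of_set T)) (tp C) h \<and> (\<forall>x\<in>topspace (top_of_set T). h (0, x) = u2 x) \<and>
      (\<forall>x\<in>topspace (top_of_set T). h (1, x) = v2 x) \<and> (\<forall>t\<in>{0..1}. \<forall>x\<in>N2. h (t, x) = u2 x)"
    using N2(3) by (subst (asm) homotopic_rel_iff) (use \<open>N2 \<subseteq> T\<close> in auto)
  then obtain h where h: "continuous_map (prod_topology unit_iv (top_of_set T)) (tp C) h" "\<And>x. x \<in> T \<Longrightarrow> h (0, x) = u2 x"
      "\<And>x. x \<in> T \<Longrightarrow> h (1, x) = v2 x" "\<And>t x. t \<in> {0..1} \<Longrightarrow> x \<in> N2 \<Longrightarrow> h (t, x) = u2 x" by auto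
  have cs: "P - T \<subseteq> closure (P - T)" by (rule closure_subset)
  define h' where "h' = (\<lambda>(s::real, x). if x \<in> T then h (s, x) else u2 x)"
  define v where "v x = h' (1, x)" for x
  have h'_cont: "continuous_map (prod_topology unit_iv (top_of_set P)) (tp C) h'"
  proof (rule paste_closed2)
    let ?A = "{0..1::real} \<times> T" and ?B = "{0..1::real} \<times> (P \<inter> closure (P - T))"
    have cl: "closedin (top_of_set P) T" "closedin (top_of_set P) (P \<inter> closure (P - T))"
      using T_closed TP by (auto intro: closed_subset closedin_closed_Int)
    show "closedin (prod_topology unit_iv (top_of_set P)) ?A" "closedin (prod_topology unit_iv (top_of_set P)) ?B"
      using cl by (simp_all only: closedin_prod_Times_iff) auto
    show "topspace (prod_topology unit_iv (top_of_set P)) \<subseteq> ?A \<union> ?B" using cs by auto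
    have st: "subtopology (prod_topology unit_iv (top_of_set P)) ?A = prod_topology unit_iv (top_of_set T)"
      "subtopology (prod_topology unit_iv (top_of_set P)) ?B = prod_topology unit_iv (top_of_set (P \<inter> closure (P - T)))"
      using TP by (auto simp: subtopology_subtopology Times_Int_Times Int_absorb1)
    show "continuous_map (subtopology (prod_topology unit_iv (top_of_set P)) ?A) (tp C) h'"
      unfolding st by (rule continuous_map_eq[OF h(1)]) (auto simp: h'_def)
    have "continuous_map (prod_topology unit_iv (top_of_set (P \<inter> closure (P - T)))) (tp C) (\<lambda>z. u2 (snd z))"
      by (rule continuous_map_compose[OF continuous_map_snd continuous_map_from_subtopology_mono[OF u2_cont], unfolded o_def]) auto
    then show "continuous_map (subtopology (prod_topology unit_iv (top_of_set P)) ?B) (tp C) h'"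
      unfolding st
    proof (rule continuous_map_eq)
      fix z assume "z \<in> topspace (prod_topology unit_iv (top_of_set (P \<inter> closure (P - T))))"
      then obtain s x where z: "z = (s, x)" "s \<in> {0..1}" "x \<in> closure (P - T)" by auto
      show "u2 (snd z) = h' z"
      proof (cases "x \<in> T")
        case True
        then have "x \<in> N2" using z(3) N2(2) by (auto simp: Q2_def)
        then show ?thesis using h(4)[OF z(2)] True by (simp add: z(1) h'_def)
      qed (simp add: z(1) h'_def)
    qed
  qed
  \<comment> \<open>Both homotopies are stationary here: the first because of \<open>O0\<close>, the
    second off \<open>T\<close> and on \<open>G\<close>.\<close>
  define N where "N = P \<inter> O0 \<inter> (- T \<union> G)"
  have N: "openin (top_of_set P) N"
    unfolding N_def openin_open using beta(4) T_closed G(1)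
    by (intro exI[of _ "O0 \<inter> (- T \<union> G)"]) (auto intro!: open_Int open_Un)
  have QN: "Q \<subseteq> N" using Q(2) beta(5) N2(2) G(2) by (auto simp: N_def Q2_def)
  have u2N: "u2 x = u x" if "x \<in> N" for x using H_O0[of x 1] that by (auto simp: N_def u2_def)
  have "homotopic_with (\<lambda>f. \<forall>x\<in>N. f x = u x) (top_of_set P) (tp C) u2 v"
  proof (subst homotopic_with)
    show "\<exists>h. continuous_map (prod_topology unit_iv (top_of_set P)) (tp C) h \<and> (\<forall>x\<in>topspace (top_of_set P). h (0, x) = u2 x) \<and>
      (\<forall>x\<in>topspace (top_of_set P). h (1, x) = v x) \<and> (\<forall>t\<in>{0..1}. \<forall>x\<in>N. h (t, x) = u x)"
    proof (intro exI[of _ h'] conjI ballI)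
      fix t :: real and x assume "t \<in> {0..1}" "x \<in> N"
      then show "h' (t, x) = u x" using h(4)[of t x] u2N[of x] G(2) by (auto simp: h'_def N_def)
    qed (use h'_cont h(2) in \<open>auto simp: h'_def v_def\<close>)
  next
    fix h k :: "(nat \<Rightarrow> real) \<Rightarrow> 'c \<times> (nat \<Rightarrow> real)"
    assume "\<And>x. x \<in> topspace (top_of_set P) \<Longrightarrow> h x = k x"
    then show "(\<forall>x\<in>N. h x = u x) = (\<forall>x\<in>N. k x = u x)" by (simp add: N_def)
  qed
  moreover have "homotopic_with (\<lambda>f. \<forall>x\<in>N. f x = u x) (top_of_set P) (tp C) u u2"
    by (rule hom1) (auto simp: N_def)
  ultimately have hom: "homotopic_with (\<lambda>f. \<forall>x\<in>N. f x = u x) (top_of_set P) (tp C) u v"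
    by (rule homotopic_with_trans[rotated])
  have v_T: "v x = v2 x" if "x \<in> T" for x using h(3)[OF that] that by (simp add: v_def h'_def)
  have v_nT: "v x = u2 x" if "x \<notin> T" for x using that by (simp add: v_def h'_def)
  have "smooth_at k P v x" if x: "x \<in> P" for x
  proof -
    \<comment> \<open>Off \<open>T\<close> and on its frontier \<open>v\<close> agrees locally with
      \<open>u2\<close>, smooth there by \<open>fr\<close>; in the relative interior of
      \<open>T\<close> it agrees with \<open>v2\<close>.\<close>
    consider "x \<notin> T" | "x \<in> T" "x \<notin> closure (P - T)" | "x \<in> T" "x \<in> closure (P - T)" by blast
    then show ?thesis
    proof cases
      case 1
      then have "x \<in> closure (P - T)" using x cs by blast
      from fr[OF x this] show ?thesis
        by (rule smooth_at_local[of _ _ _ _ "- T"]) (use 1 T_closed v_nT in auto)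
    next
      case 2
      have "smooth_at k T v2 x" using N2(4) 2 by blast
      then show ?thesis
      proof (rule smooth_at_local[of _ _ _ _ "- closure (P - T)"])
        fix y assume "y \<in> - closure (P - T)" "y \<in> P"
        then have "y \<in> T" using cs by blast
        then show "y \<in> T \<and> v y = v2 y" using v_T by simp
      qed (use 2 in auto)
    next
      case 3
      have "x \<in> G" using 3 N2(2) G(2) by (auto simp: Q2_def)
      from fr[OF x 3(2)] show ?thesis
      proof (rule smooth_at_local[of _ _ _ _ G])
        fix y assume y: "y \<in> G" "y \<in> P"
        show "y \<in> P \<and> v y = u2 y"
        proof (cases "y \<in> T")
          case True
          then show ?thesis using h(3)[OF True] h(4)[of 1 y] v_T[OF True] y G(2) by simp
        qed (use v_nT y in auto)
      qed (use G \<open>x \<in> G\<close> in auto)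
    qed
  qed
  then show "approximable k P Q u" unfolding approximable_def using N QN hom
    by (intro exI[of _ N] exI[of _ v] conjI ballI)
qed

theorem smooth_approximation:
  assumes "compact P" "P \<subseteq> euc k" "continuous_map (top_of_set P) (tp C) u"
  shows "\<exists>v. homotopic_with (\<lambda>_. True) (top_of_set P) (tp C) u v \<and> (\<forall>x\<in>P. smooth_at k P v x)"
proof -
  have "c \<in> C \<longrightarrow> approx_claim k c" for c
    using wfR
  proof (induction c rule: wf_induct_rule)
    case (less c)
    then show ?case using approx_step[of c k] by (auto simp: cbelow_def)
  qed
  then have "approximable k P {} u"
    using continuous_map_image_subset_topspace[OF assms(3)] by (intro approx_reduce[of C] assms) auto
  then obtain N v where v: "homotopic_with (\<lambda>f. \<forall>x\<in>N. f x = u x) (top_of_set P) (tp C) u v" "\<forall>x\<in>P. smooth_at k P v x"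
    unfolding approximable_def by blast
  have "homotopic_with (\<lambda>_. True) (top_of_set P) (tp C) u v" by (rule homotopic_with_mono[OF v(1)]) simp
  then show ?thesis using v(2) by blast
qed

end

section \<open>Replacing the attaching maps\<close>

lemma sstepv_bdry: "t \<in> bdry m \<Longrightarrow> sstepv m t \<in> bdry m"
proof -
  assume "t \<in> bdry m"
  then obtain i where i: "i < m" "t i = 0 \<or> t i = 1" by (auto simp: bdry_def)
  then have "sstepv m t i = 0 \<or> sstepv m t i = 1" by (auto simp: sstepv_def sstep_0 sstep_1)
  then show ?thesis using sstepv_cube[of m t] i(1) by (auto simp: bdry_def)
qed

text \<open>The straight-line homotopy keeps each coordinate that is 0 or 1, hence never leaves the
  boundary.\<close>

lemma homotopic_id_sstepv: "homotopic_with (\<lambda>_. True) (top_of_set (bdry m)) (top_of_set (bdry m)) (\<lambda>t. t) (sstepv m)"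
proof -
  define h where "h = (\<lambda>(s::real, t). \<lambda>j. (1 - s) * t j + s * sstepv m t j)"
  have "continuous_on ({0..1} \<times> bdry m) h"
  proof (rule continuous_on_coordinatewise_then_product)
    fix j
    have "continuous_on ({0..1::real} \<times> bdry m) (\<lambda>z. snd z j)" "continuous_on ({0..1::real} \<times> bdry m) (\<lambda>z. sstepv m (snd z) j)"
      by (intro continuous_on_product_then_coordinatewise[of _ snd] continuous_on_product_then_coordinatewise[of _ "\<lambda>z. sstepv m (snd z)"]
          continuous_on_compose2[OF continuous_on_sstepv[of UNIV]] continuous_intros; simp)+
    then show "continuous_on ({0..1} \<times> bdry m) (\<lambda>z. h z j)"
      unfolding h_def case_prod_beta by (intro continuous_intros)
  qed
  moreover have "h (s, t) \<in> bdry m" if s: "0 \<le> s" "s \<le> 1" and t: "t \<in> bdry m" for s t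
  proof -
    obtain i where i: "i < m" "t i = 0 \<or> t i = 1" using t by (auto simp: bdry_def)
    have t': "t \<in> cube m" using t bdry_subset by auto
    have "0 \<le> (1 - s) * t j + s * sstep (t j) \<and> (1 - s) * t j + s * sstep (t j) \<le> 1" if "j < m" for j
    proof -
      have tj: "0 \<le> t j" "t j \<le> 1" using t' that by (auto simp: cube_def)
      have "(1 - s) * t j + s * sstep (t j) \<le> (1 - s) * 1 + s * 1"
        using s tj sstep_range by (intro add_mono mult_left_mono) auto
      then show ?thesis using s tj sstep_range by simp
    qed
    then have "h (s, t) \<in> cube m" using t' by (auto simp: h_def cube_def sstepv_def)
    moreover have "h (s, t) i = 0 \<or> h (s, t) i = 1" using i by (auto simp: h_def sstepv_def sstep_0 sstep_1)
    ultimately show ?thesis using i(1) by (auto simp: bdry_def)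
  qed
  ultimately have "continuous_map (top_of_set ({0..1} \<times> bdry m)) (top_of_set (bdry m)) h"
    by (intro continuous_map_top_of_setI) auto
  then show ?thesis unfolding homotopic_with_def
    by (intro exI[of _ h]) (auto simp: h_def)
qed

context smoothcell begin

text \<open>A smooth approximation is made tame by precomposing it with \<open>sstepv\<close>, which
  is homotopic to the identity of the boundary. The constant 1/3 comes from the flat parts of
  \<open>sstep\<close>.\<close>

lemma tame_smooth_approximation:
  assumes u: "continuous_map (top_of_set (bdry m)) (tp C) u"
  shows "\<exists>\<phi>. homotopic_with (\<lambda>_. True) (top_of_set (bdry m)) (tp C) u \<phi> \<and>
    smooth_map (bdry_diff m) (cell_diff n att C) \<phi> \<and> tame m \<phi>"
proof -
  obtain v where v: "homotopic_with (\<lambda>_. True) (top_of_set (bdry m)) (tp C) u v" "\<forall>x\<in>bdry m. smooth_at m (bdry m) v x"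
    using smooth_approximation[OF compact_bdry _ u] bdry_subset cube_subset_euc by blast
  define \<phi> where "\<phi> t = v (sstepv m t)" for t
  have vc: "continuous_map (top_of_set (bdry m)) (tp C) v" using homotopic_with_imp_continuous_maps[OF v(1)] by simp
  have "homotopic_with (\<lambda>_. True) (top_of_set (bdry m)) (tp C) (v \<circ> (\<lambda>t. t)) (v \<circ> sstepv m)"
    by (rule homotopic_with_compose_continuous_map_left[OF homotopic_id_sstepv vc]) simp
  then have "homotopic_with (\<lambda>_. True) (top_of_set (bdry m)) (tp C) v \<phi>" by (simp add: o_def \<phi>_def[abs_def])
  then have hom: "homotopic_with (\<lambda>_. True) (top_of_set (bdry m)) (tp C) u \<phi>" using homotopic_with_trans[OF v(1)] by blast
  have "tame m \<phi>" unfolding tame_def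
  proof (intro exI[of _ "1/3"] conjI ballI allI impI)
    fix t :: "nat \<Rightarrow> real" and j and \<alpha> :: real assume a: "\<alpha> \<in> {0, 1}" "\<bar>t j - \<alpha>\<bar> \<le> 1/3"
    have "t j \<le> 1/3 \<and> \<alpha> = 0 \<or> 2/3 \<le> t j \<and> \<alpha> = 1" using a by (auto simp: abs_le_iff)
    then have "sstep (t j) = sstep \<alpha>" by (auto simp: sstep_0 sstep_1)
    then have "sstepv m t = sstepv m (t(j := \<alpha>))" by (auto simp: sstepv_def fun_eq_iff)
    then show "\<phi> t = \<phi> (t(j := \<alpha>))" by (simp add: \<phi>_def)
  qed auto
  moreover have "smooth_map (bdry_diff m) (cell_diff n att C) \<phi>"
    unfolding smooth_map_def
  proof (intro conjI allI impI)
    have vp: "v t \<in> pts C" if "t \<in> bdry m" for t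
      using continuous_map_image_subset_topspace[OF vc] that by auto
    show "\<phi> ` dcarrier (bdry_diff m) \<subseteq> dcarrier (cell_diff n att C)"
      using vp sstepv_bdry by (auto simp: bdry_diff_def std_sub_def \<phi>_def)
    fix k U p assume "(k, U, p) \<in> dplots (bdry_diff m)"
    then have p: "openin (euclid k) U" "p ` U \<subseteq> bdry m" "smooth_map_eu k U m p" by (auto simp: bdry_diff_def std_sub_def)
    show "(k, U, \<phi> \<circ> p) \<in> dplots (cell_diff n att C)"
      unfolding dplots_cell_diff
    proof (intro conjI ballI)
      show "(\<phi> \<circ> p) ` U \<subseteq> pts C"
      proof (intro image_subsetI)
        fix y assume "y \<in> U"
        then have "sstepv m (p y) \<in> bdry m" using p(2) sstepv_bdry by blast
        then show "(\<phi> \<circ> p) y \<in> pts C" using vp by (simp add: \<phi>_def)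
      qed
      fix x assume x: "x \<in> U"
      define \<tau> where "\<tau> y = sstepv m (p y)" for y
      have pe: "p ` U \<subseteq> euc m" using p(3) by (simp add: smooth_map_eu_def)
      have s\<tau>: "smooth_map_eu k U m \<tau>" unfolding \<tau>_def
        by (rule smooth_map_eu_compose[OF p(1) openin_euclid_euc p(3) pe sstepv_smooth[OF openin_euclid_euc]])
      have \<tau>b: "\<tau> y \<in> bdry m" if "y \<in> U" for y using sstepv_bdry p(2) that by (auto simp: \<tau>_def)
      obtain V c q where V: "openin (euclid m) V" "\<tau> x \<in> V" "c \<in> C" "q ` V \<subseteq> cube (n c)" "smooth_map_eu m V (n c) q"
        "\<forall>y\<in>V \<inter> bdry m. v y = \<Phi> c (q y)" using bspec[OF v(2) \<tau>b[OF x]] unfolding smooth_at_def by (elim exE conjE) (rule that)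
      define U' where "U' = {y \<in> U. \<tau> y \<in> V}"
      have U': "openin (euclid k) U'" unfolding U'_def
        by (rule openin_euclid_preimage[OF p(1) smooth_map_eu_continuous[OF s\<tau>] s\<tau>[unfolded smooth_map_eu_def, THEN conjunct1] V(1)])
      have "smooth_map_eu k U' (n c) (\<lambda>y. q (\<tau> y))"
        by (rule smooth_map_eu_compose[OF U' V(1) smooth_map_eu_subset[OF s\<tau>] _ V(5)]) (auto simp: U'_def)
      moreover have "(\<lambda>y. q (\<tau> y)) ` U' \<subseteq> cube (n c)"
        using V(4) unfolding U'_def image_subset_iff by simp
      moreover have "\<forall>y\<in>U'. (\<phi> \<circ> p) y = \<Phi> c (q (\<tau> y))"
      proof
        fix y assume "y \<in> U'"
        then have "\<tau> y \<in> V \<inter> bdry m" using \<tau>b by (simp add: U'_def)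
        then have "v (\<tau> y) = \<Phi> c (q (\<tau> y))" using V(6) by blast
        then show "(\<phi> \<circ> p) y = \<Phi> c (q (\<tau> y))" by (simp add: \<phi>_def \<tau>_def)
      qed
      moreover have "x \<in> U'" "U' \<subseteq> U" using x V(2) by (auto simp: U'_def)
      ultimately show "\<exists>V c q. openin (euclid k) V \<and> x \<in> V \<and> V \<subseteq> U \<and> c \<in> C \<and> q ` V \<subseteq> cube (n c) \<and>
          smooth_map_eu k V (n c) q \<and> (\<forall>y\<in>V. (\<phi> \<circ> p) y = \<Phi> c (q y))"
        using U' V(3) by (intro exI[of _ U'] exI[of _ c] exI[of _ "\<lambda>y. q (\<tau> y)"] conjI)
    qed (rule p(1))
  qed
  ultimately show ?thesis using hom by blast
qed

end

context cylspace begin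

lemma deformation_exists:
  "\<exists>D. continuous_map (prod_topology (tp C) unit_iv) (tp C) D \<and>
    (\<forall>x\<in>pts C. D (x, 0) = x) \<and> (\<forall>x\<in>pts C. D (x, 1) \<in> emb s0 ` epts C)"
proof (rule deformation)
  fix D assume "continuous_map (prod_topology (tp C) unit_iv) (tp C) D"
    "\<And>x. x \<in> pts C \<Longrightarrow> D (x, 0) = x" "\<And>x. x \<in> pts C \<Longrightarrow> D (x, 1) \<in> emb s0 ` epts C"
  then show ?thesis by (intro exI[of _ D] conjI ballI)
qed

text \<open>The deformation fixes the end, so flowing to time 1 and forgetting the height inverts
  \<open>emb s0\<close> up to homotopy.\<close>

lemma end_equivalent: "etp C homotopy_equivalent_space tp C"
proof -
  obtain D where D: "continuous_map (prod_topology (tp C) unit_iv) (tp C) D"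
    "\<And>x. x \<in> pts C \<Longrightarrow> D (x, 0) = x" "\<And>x. x \<in> pts C \<Longrightarrow> D (x, 1) \<in> emb s0 ` epts C"
    "\<And>x \<tau>. x \<in> epts C \<Longrightarrow> \<tau> \<in> {0..1} \<Longrightarrow> D (emb s0 x, \<tau>) = emb s0 x"
    using deformation by blast
  have D1: "continuous_map (tp C) (tp C) (\<lambda>x. D (x, 1))"
    using continuous_map_compose[OF continuous_map_pairedI[OF continuous_map_id continuous_map_const[THEN iffD2]] D(1), of 1]
    by (simp add: o_def)
  define g where "g x = unemb (D (x, 1))" for x
  have g: "continuous_map (tp C) (etp C) g"
    unfolding g_def by (rule unemb_continuous[OF D1]) (use D(3) in simp)
  have fg: "emb s0 (g x) = D (x, 1)" if "x \<in> pts C" for x using D(3)[OF that] by (auto simp: g_def)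
  have gf: "g (emb s0 x) = x" if "x \<in> epts C" for x using D(4)[OF that, of 1] by (simp add: g_def)
  have "homotopic_with (\<lambda>_. True) (etp C) (etp C) (g \<circ> emb s0) id"
    by (rule homotopic_with_equal) (use gf continuous_map_compose[OF emb_continuous g] in auto)
  moreover have "homotopic_with (\<lambda>_. True) (tp C) (tp C) id (emb s0 \<circ> g)"
  proof (subst homotopic_with)
    have "continuous_map (prod_topology unit_iv (tp C)) (tp C) (\<lambda>z. D (snd z, fst z))"
      using continuous_map_compose[OF continuous_map_pairedI[OF continuous_map_snd continuous_map_fst] D(1)] by (simp add: o_def)
    then show "\<exists>h. continuous_map (prod_topology unit_iv (tp C)) (tp C) h \<and> (\<forall>x\<in>topspace (tp C). h (0, x) = id x) \<and>
      (\<forall>x\<in>topspace (tp C). h (1, x) = (emb s0 \<circ> g) x) \<and> (\<forall>t\<in>{0..1}. True)"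
      using D(2) fg by (intro exI[of _ "\<lambda>z. D (snd z, fst z)"]) auto
  qed auto
  ultimately show ?thesis unfolding homotopy_equivalent_space_def
    using emb_continuous g homotopic_with_symD by blast
qed

end

section \<open>Recursive choice of the walls\<close>

lemma cell_diff_cong:
  assumes "\<And>c t. c \<in> B \<Longrightarrow> att c t = att' c t"
  shows "cell_diff n att B = cell_diff n att' B"
proof -
  have "cmap (cubeB n) att c = cmap (cubeB n) att' c" if "c \<in> B" for c using assms[OF that] by (simp add: cmap_def fun_eq_iff)
  then show ?thesis unfolding cell_diff_def by (simp cong: bex_cong)
qed

theorem smooth_replacement:
  assumes "cubecell C R n att0"
  obtains att where "smoothcell C R n att" "ctop C (cubeK n) (cubeB n) att0 homotopy_equivalent_space ctop C (cubeK n) (cubeB n) att"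
proof -
  interpret A: cubecell C R n att0 by fact
  \<comment> \<open>\<open>v\<close> is an admissible wall for the cell \<open>c\<close> over the
    walls \<open>f\<close> of the earlier cells: the given attaching map at height 0, a tame smooth
    one at height 1. It depends on \<open>f\<close> only below \<open>c\<close>, as the recursion
    requires.\<close>
  define good where "good f c v \<longleftrightarrow> (c \<in> C \<longrightarrow>
      continuous_map (top_of_set (bdry (n c) \<times> {0..1})) (ctop (cbelow C R c) (cylK n) (cylB n) f) v \<and>
      (\<forall>k\<in>cylB n c. v k \<in> cpts (cbelow C R c) (cylK n) (cylB n)) \<and>
      (\<forall>t\<in>bdry (n c). v (t, 0) = emb 0 (att0 c t)) \<and> (\<forall>t. snd (snd (v (t, 1))) = 1) \<and>
      smooth_map (bdry_diff (n c)) (cell_diff n (\<lambda>d t. unemb (f d (t, 1))) (cbelow C R c)) (\<lambda>t. unemb (v (t, 1))) \<and>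
      tame (n c) (\<lambda>t. unemb (v (t, 1))))"
    for f :: "'a \<Rightarrow> (nat \<Rightarrow> real) \<times> real \<Rightarrow> 'a \<times> (nat \<Rightarrow> real) \<times> real" and c v
  \<comment> \<open>Good walls over an initial set assemble to a cylinder complex with two ends, the
    upper one smooth. This is used below the current cell during the recursion and at the end for
    all of \<open>C\<close>.\<close>
  have cyl: "cylspace B R n f 0 \<and> cylspace B R n f 1 \<and> smoothcell B R n (\<lambda>d t. unemb (f d (t, 1)))"
    if B: "initial C R B" and g: "\<And>d. d \<in> B \<Longrightarrow> good f d (f d)" for f B
  proof -
    have BC: "d \<in> C" if "d \<in> B" for d using B that by (auto simp: initial_def)
    have W: "cellspace B R (cylK n) (cylB n) f"
    proof
      fix d assume d: "d \<in> B"
      have sub: "subtopology (cylK n d) (cylB n d) = top_of_set (bdry (n d) \<times> {0..1})"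
        using bdry_subset[of "n d"] by (auto simp: cylK_def cylB_def subtopology_subtopology Int_absorb1 Times_Int_Times)
      show "continuous_map (subtopology (cylK n d) (cylB n d)) (ctop (cbelow B R d) (cylK n) (cylB n) f) (f d)"
        using g[OF d] BC[OF d] unfolding good_def sub cbelow_initial[OF B d] by simp
      show "f d t \<in> cpts (cbelow B R d) (cylK n) (cylB n)" if "t \<in> cylB n d" for t
        using g[OF d] BC[OF d] that unfolding good_def cbelow_initial[OF B d] by simp
      show "closedin (cylK n d) (cylB n d)" "t1_space (cylK n d)" by (rule closedin_cylK t1_cylK)+
    next
      show "total_on B R" using A.totR BC by (simp add: total_on_def)
    qed (rule A.wfR A.transR)+
    have 0: "cylspace B R n f 0"
      by (intro cylspace.intro cylspace_axioms.intro W) (use g BC in \<open>auto simp: good_def emb_def\<close>)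
    have 1: "cylspace B R n f 1"
      by (intro cylspace.intro cylspace_axioms.intro W) (use g BC in \<open>auto simp: good_def\<close>)
    interpret W1: cylspace B R n f 1 by (rule 1)
    have eq: "W1.endatt = (\<lambda>d t. unemb (f d (t, 1)))" by (simp add: W1.endatt_def fun_eq_iff)
    have "smoothcell B R n W1.endatt"
    proof (intro smoothcell.intro smoothcell_axioms.intro cubecell.intro W1.cellspace_end)
      fix d assume d: "d \<in> B"
      show "smooth_map (bdry_diff (n d)) (cell_diff n W1.endatt (cbelow B R d)) (W1.endatt d)" "tame (n d) (W1.endatt d)"
        using g[OF d] BC[OF d] unfolding good_def eq cbelow_initial[OF B d] by simp_all
    qed
    then show ?thesis using 0 1 unfolding eq by simp
  qed
  have "\<exists>f. \<forall>c. good f c (f c)"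
  proof (rule dependent_wf_choice[OF A.wfR])
    fix f g :: "'a \<Rightarrow> (nat \<Rightarrow> real) \<times> real \<Rightarrow> 'a \<times> (nat \<Rightarrow> real) \<times> real" and c v
    assume fg: "\<And>z. (z, c) \<in> R \<Longrightarrow> f z = g z"
    have "ctop (cbelow C R c) (cylK n) (cylB n) f = ctop (cbelow C R c) (cylK n) (cylB n) g"
      by (rule ctop_cong) (simp add: cbelow_def fg)
    moreover have "cell_diff n (\<lambda>d t. unemb (f d (t, 1))) (cbelow C R c) = cell_diff n (\<lambda>d t. unemb (g d (t, 1))) (cbelow C R c)"
      by (rule cell_diff_cong) (simp add: cbelow_def fg)
    ultimately show "good f c v = good g c v" by (simp add: good_def)
  next
    fix c and f :: "'a \<Rightarrow> (nat \<Rightarrow> real) \<times> real \<Rightarrow> 'a \<times> (nat \<Rightarrow> real) \<times> real"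
    assume IH: "\<And>y. (y, c) \<in> R \<Longrightarrow> good f y (f y)"
    show "\<exists>v. good f c v"
    proof (cases "c \<in> C")
      case True
      let ?B = "cbelow C R c"
      let ?bd = "top_of_set (bdry (n c))"
      have Bi: "initial C R ?B" by simp
      have cy: "cylspace ?B R n f 0" "cylspace ?B R n f 1" "smoothcell ?B R n (\<lambda>d t. unemb (f d (t, 1)))"
        using cyl[OF Bi, of f] IH by (auto simp: cbelow_def)
      interpret W0: cylspace ?B R n f 0 by (rule cy(1))
      interpret W1: cylspace ?B R n f 1 by (rule cy(2))
      have e1: "W1.endatt = (\<lambda>d t. unemb (f d (t, 1)))" by (simp add: W1.endatt_def fun_eq_iff)
      interpret S: smoothcell ?B R n W1.endatt unfolding e1 by (rule cy(3))
      have "subtopology (cubeK n c) (cubeB n c) = ?bd"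
        using bdry_subset[of "n c"] by (auto simp: cubeK_def cubeB_def cube_top_def subtopology_subtopology Int_absorb1)
      then have a0: "continuous_map ?bd (A.tp ?B) (att0 c)" using A.att_cont[OF True] by simp
      \<comment> \<open>The bottom end is the given complex, as \<open>good\<close> prescribes the
        walls at height 0.\<close>
      have "A.tp ?B = W0.etp ?B"
      proof (rule ctop_cong)
        fix d t assume d: "d \<in> ?B" and t: "t \<in> cubeB n d"
        have "good f d (f d)" "d \<in> C" using IH d by (auto simp: cbelow_def)
        then have "f d (t, 0) = emb 0 (att0 d t)" using t by (simp add: good_def cubeB_def)
        then show "att0 d t = W0.endatt d t" by (simp add: W0.endatt_def)
      qed
      then have "continuous_map ?bd (W0.etp ?B) (att0 c)" using a0 by simp
      from continuous_map_compose[OF this W0.emb_continuous]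
      have u0: "continuous_map ?bd (W0.tp ?B) (\<lambda>t. emb 0 (att0 c t))" by (simp add: o_def)
      \<comment> \<open>The flow towards height 1 carries the given attaching map into the top end,
        the complex with smooth structure in which approximation is possible.\<close>
      obtain D where D: "continuous_map (prod_topology (W0.tp ?B) unit_iv) (W0.tp ?B) D"
        "\<And>x. x \<in> W0.pts ?B \<Longrightarrow> D (x, 0) = x" "\<And>x. x \<in> W0.pts ?B \<Longrightarrow> D (x, 1) \<in> emb 1 ` W1.epts ?B"
        using W1.deformation_exists by blast
      have hD: "homotopic_with (\<lambda>_. True) ?bd (W0.tp ?B) (\<lambda>t. emb 0 (att0 c t)) (\<lambda>t. D (emb 0 (att0 c t), 1))"
      proof (subst homotopic_with)
        have in_p: "emb 0 (att0 c t) \<in> W0.pts ?B" if "t \<in> bdry (n c)" for t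
          using continuous_map_image_subset_topspace[OF u0] that by auto
        have "continuous_map (prod_topology unit_iv ?bd) (prod_topology (W0.tp ?B) unit_iv) (\<lambda>z. (emb 0 (att0 c (snd z)), fst z))"
          by (intro continuous_map_pairedI continuous_map_fst continuous_map_compose[OF continuous_map_snd u0, unfolded o_def])
        from continuous_map_compose[OF this D(1)]
        have "continuous_map (prod_topology unit_iv ?bd) (W0.tp ?B) (\<lambda>z. D (emb 0 (att0 c (snd z)), fst z))" by (simp only: o_def)
        then show "\<exists>h. continuous_map (prod_topology unit_iv ?bd) (W0.tp ?B) h \<and> (\<forall>x\<in>topspace ?bd. h (0, x) = emb 0 (att0 c x)) \<and>
          (\<forall>x\<in>topspace ?bd. h (1, x) = D (emb 0 (att0 c x), 1)) \<and> (\<forall>t\<in>{0..1}. True)"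
          using D(2) in_p by (intro exI[of _ "\<lambda>z. D (emb 0 (att0 c (snd z)), fst z)"]) auto
      qed auto
      have u1: "continuous_map ?bd (W0.tp ?B) (\<lambda>t. D (emb 0 (att0 c t), 1))"
        using homotopic_with_imp_continuous_maps[OF hD] by simp
      have u1_im: "D (emb 0 (att0 c t), 1) \<in> emb 1 ` W1.epts ?B" if "t \<in> bdry (n c)" for t
        using continuous_map_image_subset_topspace[OF u0] that by (intro D(3)) auto
      have "continuous_map ?bd (W1.etp ?B) (\<lambda>t. unemb (D (emb 0 (att0 c t), 1)))"
        by (rule W1.unemb_continuous[OF u1]) (use u1_im in simp)
      from S.tame_smooth_approximation[OF this]
      obtain \<phi> where \<phi>: "homotopic_with (\<lambda>_. True) ?bd (W1.etp ?B) (\<lambda>t. unemb (D (emb 0 (att0 c t), 1))) \<phi>"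
        "smooth_map (bdry_diff (n c)) (cell_diff n W1.endatt ?B) \<phi>" "tame (n c) \<phi>" by blast
      have "homotopic_with (\<lambda>_. True) ?bd (W0.tp ?B) (emb 1 \<circ> (\<lambda>t. unemb (D (emb 0 (att0 c t), 1)))) (emb 1 \<circ> \<phi>)"
        by (rule homotopic_with_compose_continuous_map_left[OF \<phi>(1) W1.emb_continuous]) simp
      then have "homotopic_with (\<lambda>_. True) ?bd (W0.tp ?B) (\<lambda>t. D (emb 0 (att0 c t), 1)) (emb 1 \<circ> \<phi>)"
        by (rule homotopic_with_eq) (use u1_im in force)+
      \<comment> \<open>The concatenated homotopy is the new wall. Its end values are prescribed for
        all \<open>t\<close>, also off the boundary, so the map at height 1 is literally \<phi> and
        inherits smoothness and tameness.\<close>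
      from homotopic_with_trans[OF hD this]
      obtain h where h: "continuous_map (prod_topology unit_iv ?bd) (W0.tp ?B) h"
        "\<And>t. h (0, t) = emb 0 (att0 c t)" "\<And>t. h (1, t) = emb 1 (\<phi> t)"
        unfolding homotopic_with_def by auto
      define v where "v = (\<lambda>z. h (snd z, fst z))"
      have "continuous_map (prod_topology ?bd unit_iv) (prod_topology unit_iv ?bd) (\<lambda>z. (snd z, fst z))"
        by (intro continuous_map_pairedI continuous_map_fst continuous_map_snd)
      from continuous_map_compose[OF this h(1)]
      have vc: "continuous_map (top_of_set (bdry (n c) \<times> {0..1})) (W0.tp ?B) v" by (simp add: v_def o_def)
      have "good f c v"
        unfolding good_def
      proof (intro impI conjI ballI allI)
        fix k assume "k \<in> cylB n c"
        then show "v k \<in> W0.pts ?B" using continuous_map_image_subset_topspace[OF vc] by (auto simp: cylB_def image_subset_iff)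
      next
        have "(\<lambda>t. unemb (v (t, 1))) = \<phi>" by (simp add: v_def h(3))
        then show "smooth_map (bdry_diff (n c)) (cell_diff n (\<lambda>d t. unemb (f d (t, 1))) (cbelow C R c)) (\<lambda>t. unemb (v (t, 1)))"
          "tame (n c) (\<lambda>t. unemb (v (t, 1)))" using \<phi>(2,3) unfolding e1 by simp_all
      qed (use vc h in \<open>auto simp: v_def emb_def\<close>)
      then show ?thesis by blast
    qed (auto simp: good_def)
  qed
  then obtain f where f: "\<And>c. good f c (f c)" by blast
  have cy: "cylspace C R n f 0" "cylspace C R n f 1" "smoothcell C R n (\<lambda>d t. unemb (f d (t, 1)))"
    using cyl[OF initial_refl, of f] f by auto
  interpret W0: cylspace C R n f 0 by (rule cy(1))
  interpret W1: cylspace C R n f 1 by (rule cy(2))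
  have e1: "W1.endatt = (\<lambda>d t. unemb (f d (t, 1)))" by (simp add: W1.endatt_def fun_eq_iff)
  have "A.tp C = W0.etp C"
  proof (rule ctop_cong)
    fix d t assume "d \<in> C" "t \<in> cubeB n d"
    then have "f d (t, 0) = emb 0 (att0 d t)" using f[of d] by (simp add: good_def cubeB_def)
    then show "att0 d t = W0.endatt d t" by (simp add: W0.endatt_def)
  qed
  then have "A.tp C homotopy_equivalent_space W1.etp C"
    using W0.end_equivalent W1.end_equivalent homotopy_equivalent_space_sym homotopy_eqv_trans by metis
  then show ?thesis using that cy(3) unfolding e1 by blast
qed

section \<open>Gathered complexes\<close>

text \<open>Joins the locality axiom with the constant plots, in the form in which pushouts and
  colimits describe their plots.\<close>

lemma diffeological_local:
  assumes X: "diffeological X" and U: "openin (euclid k) U" "p ` U \<subseteq> dcarrier X"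
    and loc: "\<And>u. u \<in> U \<Longrightarrow> \<exists>V. openin (euclid k) V \<and> u \<in> V \<and> V \<subseteq> U \<and>
      ((\<exists>y. \<forall>v\<in>V. p v = y) \<or> (\<exists>q. (k, V, q) \<in> dplots X \<and> (\<forall>v\<in>V. p v = q v)))"
  shows "(k, U, p) \<in> dplots X"
proof -
  note X2 = X[unfolded diffeological_def, THEN conjunct2]
  have eq: "(k, V, q) \<in> dplots X \<Longrightarrow> (\<And>v. v \<in> V \<Longrightarrow> q v = q' v) \<Longrightarrow> (k, V, q') \<in> dplots X" for V q q'
    by (rule X2[THEN conjunct1, rule_format]) auto
  have const: "openin (euclid k) V \<Longrightarrow> x \<in> dcarrier X \<Longrightarrow> (k, V, \<lambda>_. x) \<in> dplots X" for V x
    by (rule X2[THEN conjunct2, THEN conjunct1, rule_format]) auto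
  have glue: "\<forall>u\<in>U. \<exists>V. openin (euclid k) V \<and> u \<in> V \<and> V \<subseteq> U \<and> (k, V, p) \<in> dplots X \<Longrightarrow> (k, U, p) \<in> dplots X"
    by (rule X2[THEN conjunct2, THEN conjunct2, THEN conjunct1, rule_format]) (use U in simp)
  show ?thesis
  proof (rule glue, intro ballI)
    fix u assume u: "u \<in> U"
    obtain V where V: "openin (euclid k) V" "u \<in> V" "V \<subseteq> U"
      and d: "(\<exists>y. \<forall>v\<in>V. p v = y) \<or> (\<exists>q. (k, V, q) \<in> dplots X \<and> (\<forall>v\<in>V. p v = q v))"
      using loc[OF u] by (elim exE conjE) (rule that)
    from d have "(k, V, p) \<in> dplots X"
    proof
      assume "\<exists>y. \<forall>v\<in>V. p v = y"
      then have "\<And>v. v \<in> V \<Longrightarrow> p u = p v" using V(2) by metis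
      then show ?thesis using eq[OF const[OF V(1), of "p u"], of p] U(2) u by blast
    next
      assume "\<exists>q. (k, V, q) \<in> dplots X \<and> (\<forall>v\<in>V. p v = q v)"
      then obtain q where "(k, V, q) \<in> dplots X" "\<forall>v\<in>V. p v = q v" by blast
      then show ?thesis using eq[of V q p] by simp
    qed
    then show "\<exists>V. openin (euclid k) V \<and> u \<in> V \<and> V \<subseteq> U \<and> (k, V, p) \<in> dplots X" using V by blast
  qed
qed

lemma cell_diff_mono_plots: "B \<subseteq> B' \<Longrightarrow> (k, U, p) \<in> dplots (cell_diff n att B) \<Longrightarrow> (k, U, p) \<in> dplots (cell_diff n att B')"
  unfolding dplots_cell_diff using cpts_mono[of B B' "cubeK n" "cubeB n"] by (meson subset_iff)

lemma smooth_map_cell_diff_mono: "B \<subseteq> B' \<Longrightarrow> smooth_map (cell_diff n att B) (cell_diff n att B') (\<lambda>x. x)"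
  unfolding smooth_map_def by (auto simp: o_def cpts_mono intro: cell_diff_mono_plots dest: subsetD[OF cpts_mono])

section \<open>Cell diffeologies as pushouts and colimits\<close>

context smoothcell begin

lemma cell_diff_plot_cell:
  assumes "c \<in> B" "initial C R B" "openin (euclid k) V" "q ` V \<subseteq> cube (n c)" "smooth_map_eu k V (n c) q" "\<And>v. v \<in> V \<Longrightarrow> p v = \<Phi> c (q v)"
  shows "(k, V, p) \<in> dplots (cell_diff n att B)"
  unfolding dplots_cell_diff
proof (intro conjI ballI)
  have "\<Phi> c t \<in> pts B" if "t \<in> cube (n c)" for t
    using cellspace.\<Phi>_in[OF cellspace_initial[OF assms(2)] assms(1)] that by simp
  then show "p ` V \<subseteq> pts B" using assms(4,6) by (simp add: image_subset_iff)
  fix u assume "u \<in> V"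
  then show "\<exists>W d r. openin (euclid k) W \<and> u \<in> W \<and> W \<subseteq> V \<and> d \<in> B \<and> r ` W \<subseteq> cube (n d) \<and>
        smooth_map_eu k W (n d) r \<and> (\<forall>v\<in>W. p v = \<Phi> d (r v))"
    using assms by (intro exI[of _ V] exI[of _ c] exI[of _ q]) simp
qed (rule assms(3))

text \<open>A local lift to a cell of the larger stage is either a lift to \<open>c\<close>, hence
  through its cube, or a lift to an earlier cell, hence a plot of the smaller stage.\<close>

lemma cell_diff_pushout:
  assumes c: "c \<in> C"
  shows "diff_pushout (n c) (cell_diff n att (cbelow C R c)) (att c) (cell_diff n att (upto_cell c)) (\<lambda>x. x) (\<Phi> c)"
  unfolding diff_pushout_def
proof (intro conjI allI ballI)
  have up: "initial C R (upto_cell c)" by (rule initial_upto[OF c])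
  interpret U: cellspace "upto_cell c" R "cubeK n" "cubeB n" att by (rule cellspace_initial[OF up])
  show dU: "diffeological (cell_diff n att (upto_cell c))" by (rule diffeological_cell_diff_initial[OF up])
  show "smooth_map (bdry_diff (n c)) (cell_diff n att (cbelow C R c)) (att c)" by (rule att_smooth[OF c])
  show "smooth_map (cell_diff n att (cbelow C R c)) (cell_diff n att (upto_cell c)) (\<lambda>x. x)" by (rule smooth_map_cell_diff_mono) auto
  show smooth_at\<Phi>: "smooth_map (cube_diff (n c)) (cell_diff n att (upto_cell c)) (\<Phi> c)"
    unfolding smooth_map_def
  proof (intro conjI allI impI)
    show "\<Phi> c ` dcarrier (cube_diff (n c)) \<subseteq> dcarrier (cell_diff n att (upto_cell c))"
      using U.\<Phi>_in[of c] by (auto simp: cube_diff_def std_sub_def)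
    show "(k, U, \<Phi> c \<circ> p) \<in> dplots (cell_diff n att (upto_cell c))" if "(k, U, p) \<in> dplots (cube_diff (n c))" for k U p
      by (rule cell_diff_plot_cell[of c, OF _ up, of k U p]) (use that in \<open>auto simp: cube_diff_def std_sub_def\<close>)
  qed
  show "\<Phi> c t = att c t" if "t \<in> bdry (n c)" for t using that by (simp add: cmap_def cubeB_def)
  have int: "\<Phi> c t = (c, t)" if "t \<in> cube (n c) - bdry (n c)" for t using that by (simp add: cmap_def cubeB_def)
  show "inj_on (\<lambda>x. x) (dcarrier (cell_diff n att (cbelow C R c)))" by simp
  show "inj_on (\<Phi> c) (cube (n c) - bdry (n c))" by (rule inj_onI) (simp add: int)
  show "(\<lambda>x. x) ` dcarrier (cell_diff n att (cbelow C R c)) \<inter> \<Phi> c ` (cube (n c) - bdry (n c)) = {}"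
    using int not_below_self[of c] by (auto simp: cpts_def)
  show "dcarrier (cell_diff n att (upto_cell c)) = (\<lambda>x. x) ` dcarrier (cell_diff n att (cbelow C R c)) \<union> \<Phi> c ` cube (n c)"
  proof
    show "dcarrier (cell_diff n att (upto_cell c)) \<subseteq> (\<lambda>x. x) ` dcarrier (cell_diff n att (cbelow C R c)) \<union> \<Phi> c ` cube (n c)"
    proof
      fix x assume x: "x \<in> dcarrier (cell_diff n att (upto_cell c))"
      show "x \<in> (\<lambda>x. x) ` dcarrier (cell_diff n att (cbelow C R c)) \<union> \<Phi> c ` cube (n c)"
      proof (cases "fst x = c")
        case True
        then have "snd x \<in> cube (n c) - bdry (n c)" "x = (c, snd x)" using x by (auto simp: cpts_def cubeB_def)
        then have "x = \<Phi> c (snd x)" using int by simp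
        then show ?thesis using \<open>snd x \<in> cube (n c) - bdry (n c)\<close> by blast
      next
        case False then show ?thesis using x by (cases x) (auto simp: cpts_def)
      qed
    qed
    have "pts (cbelow C R c) \<subseteq> pts (upto_cell c)" by (rule cpts_mono) auto
    then show "(\<lambda>x. x) ` dcarrier (cell_diff n att (cbelow C R c)) \<union> \<Phi> c ` cube (n c) \<subseteq> dcarrier (cell_diff n att (upto_cell c))"
      using U.\<Phi>_in[of c] by auto
  qed
  fix k U p
  show "(k, U, p) \<in> dplots (cell_diff n att (upto_cell c)) \<longleftrightarrow>
        openin (euclid k) U \<and> p ` U \<subseteq> dcarrier (cell_diff n att (upto_cell c)) \<and>
        (\<forall>u\<in>U. \<exists>V. openin (euclid k) V \<and> u \<in> V \<and> V \<subseteq> U \<and>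
           ((\<exists>y. \<forall>v\<in>V. p v = y) \<or> lifts_through V k p (cell_diff n att (cbelow C R c)) (\<lambda>x. x) \<or> lifts_through V k p (cube_diff (n c)) (\<Phi> c)))"
    (is "?L \<longleftrightarrow> ?R")
  proof
    assume L: ?L
    show ?R
    proof (intro conjI ballI)
      show "openin (euclid k) U" "p ` U \<subseteq> dcarrier (cell_diff n att (upto_cell c))" using L by (simp_all add: dplots_cell_diff)
      fix u assume "u \<in> U"
      then obtain V d q where V: "openin (euclid k) V" "u \<in> V" "V \<subseteq> U" "d \<in> upto_cell c" "q ` V \<subseteq> cube (n d)"
        "smooth_map_eu k V (n d) q" "\<forall>v\<in>V. p v = \<Phi> d (q v)" using L unfolding dplots_cell_diff by meson
      have "lifts_through V k p (cell_diff n att (cbelow C R c)) (\<lambda>x. x) \<or> lifts_through V k p (cube_diff (n c)) (\<Phi> c)"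
      proof (cases "d = c")
        case True
        then show ?thesis using V unfolding lifts_through_cube by blast
      next
        case False
        then have "(k, V, p) \<in> dplots (cell_diff n att (cbelow C R c))"
          by (intro cell_diff_plot_cell[of d _ k V q]) (use V in auto)
        then show ?thesis unfolding lifts_through_def by blast
      qed
      then show "\<exists>V. openin (euclid k) V \<and> u \<in> V \<and> V \<subseteq> U \<and>
           ((\<exists>y. \<forall>v\<in>V. p v = y) \<or> lifts_through V k p (cell_diff n att (cbelow C R c)) (\<lambda>x. x) \<or> lifts_through V k p (cube_diff (n c)) (\<Phi> c))"
        using V by blast
    qed
  next
    assume R: ?R
    show ?L
    proof (rule diffeological_local[OF dU])
      fix u assume "u \<in> U"
      then obtain V where V: "openin (euclid k) V" "u \<in> V" "V \<subseteq> U"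
        and d: "(\<exists>y. \<forall>v\<in>V. p v = y) \<or> lifts_through V k p (cell_diff n att (cbelow C R c)) (\<lambda>x. x) \<or> lifts_through V k p (cube_diff (n c)) (\<Phi> c)"
        using R by blast
      have "\<exists>q. (k, V, q) \<in> dplots (cell_diff n att (upto_cell c)) \<and> (\<forall>v\<in>V. p v = q v)"
        if "lifts_through V k p (cell_diff n att (cbelow C R c)) (\<lambda>x. x)"
        using that cell_diff_mono_plots[of "cbelow C R c" "upto_cell c"] unfolding lifts_through_def by blast
      moreover have "\<exists>q. (k, V, q) \<in> dplots (cell_diff n att (upto_cell c)) \<and> (\<forall>v\<in>V. p v = q v)"
        if lift: "lifts_through V k p (cube_diff (n c)) (\<Phi> c)"
      proof -
        obtain q where q: "(k, V, q) \<in> dplots (cube_diff (n c))" "\<forall>v\<in>V. p v = \<Phi> c (q v)" using lift unfolding lifts_through_def by blast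
        then have "(k, V, \<Phi> c \<circ> q) \<in> dplots (cell_diff n att (upto_cell c))" using smooth_at\<Phi> unfolding smooth_map_def by blast
        then show ?thesis using q(2) by (intro exI[of _ "\<Phi> c \<circ> q"]) simp
      qed
      ultimately show "\<exists>V. openin (euclid k) V \<and> u \<in> V \<and> V \<subseteq> U \<and>
        ((\<exists>y. \<forall>v\<in>V. p v = y) \<or> (\<exists>q. (k, V, q) \<in> dplots (cell_diff n att (upto_cell c)) \<and> (\<forall>v\<in>V. p v = q v)))"
        using V d by blast
    qed (use R in auto)
  qed
qed

text \<open>A local lift involves one cell only, and that cell already belongs to some stage. All
  maps are inclusions, because the points are the same in every stage.\<close>

lemma cell_diff_colim:
  assumes cells: "\<And>a. a \<in> S \<Longrightarrow> initial C R (cells a)" and r: "\<And>a b. a \<in> S \<Longrightarrow> b \<in> S \<Longrightarrow> (a, b) \<in> r \<longleftrightarrow> cells a \<subseteq> cells b"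
    and lin: "\<And>a b. a \<in> S \<Longrightarrow> b \<in> S \<Longrightarrow> cells a \<subseteq> cells b \<or> cells b \<subseteq> cells a"
    and B: "(\<Union>a\<in>S. cells a) = B"
  shows "diff_colim S r (\<lambda>a. cell_diff n att (cells a)) (\<lambda>_ _ x. x) (cell_diff n att B) (\<lambda>_ x. x)"
proof -
  have BI: "initial C R B" using cells B unfolding initial_def by blast
  have dB: "diffeological (cell_diff n att B)" by (rule diffeological_cell_diff_initial[OF BI])
  show ?thesis unfolding diff_colim_def
  proof (intro conjI ballI allI impI)
    show "diffeological (cell_diff n att B)" by (rule dB)
    show "smooth_map (cell_diff n att (cells a)) (cell_diff n att B) (\<lambda>x. x)" if "a \<in> S" for a
      by (rule smooth_map_cell_diff_mono) (use that B in blast)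
    show "dcarrier (cell_diff n att B) = (\<Union>a\<in>S. (\<lambda>x. x) ` dcarrier (cell_diff n att (cells a)))"
      unfolding B[symmetric] by (auto simp: cpts_def)
    show "x = y \<longleftrightarrow> (\<exists>c\<in>S. (a, c) \<in> r \<and> (b, c) \<in> r \<and> x = y)" if "a \<in> S" "b \<in> S" for a b and x y :: "'c \<times> (nat \<Rightarrow> real)"
      using lin[OF that] r that by blast
    fix k U p
    show "(k, U, p) \<in> dplots (cell_diff n att B) \<longleftrightarrow> openin (euclid k) U \<and> p ` U \<subseteq> dcarrier (cell_diff n att B) \<and>
        (\<forall>u\<in>U. \<exists>V. openin (euclid k) V \<and> u \<in> V \<and> V \<subseteq> U \<and>
           ((\<exists>y. \<forall>v\<in>V. p v = y) \<or> (\<exists>a\<in>S. lifts_through V k p (cell_diff n att (cells a)) (\<lambda>x. x))))" (is "?L \<longleftrightarrow> ?R")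
    proof
      assume L: ?L
      show ?R
      proof (intro conjI ballI)
        show "openin (euclid k) U" "p ` U \<subseteq> dcarrier (cell_diff n att B)" using L by (simp_all add: dplots_cell_diff)
        fix u assume "u \<in> U"
        then obtain V d q where V: "openin (euclid k) V" "u \<in> V" "V \<subseteq> U" "d \<in> B" "q ` V \<subseteq> cube (n d)"
          "smooth_map_eu k V (n d) q" "\<forall>v\<in>V. p v = \<Phi> d (q v)" using L unfolding dplots_cell_diff by meson
        obtain a where a: "a \<in> S" "d \<in> cells a" using V(4) B by blast
        have "(k, V, p) \<in> dplots (cell_diff n att (cells a))"
          by (rule cell_diff_plot_cell[of d, OF a(2) cells[OF a(1)] V(1,5,6)]) (use V(7) in auto)
        then have "lifts_through V k p (cell_diff n att (cells a)) (\<lambda>x. x)" unfolding lifts_through_def by blast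
        then show "\<exists>V. openin (euclid k) V \<and> u \<in> V \<and> V \<subseteq> U \<and>
           ((\<exists>y. \<forall>v\<in>V. p v = y) \<or> (\<exists>a\<in>S. lifts_through V k p (cell_diff n att (cells a)) (\<lambda>x. x)))"
          using V(1-3) a(1) by blast
      qed
    next
      assume R: ?R
      show ?L
      proof (rule diffeological_local[OF dB])
        fix u assume "u \<in> U"
        then obtain V where V: "openin (euclid k) V" "u \<in> V" "V \<subseteq> U"
          and d: "(\<exists>y. \<forall>v\<in>V. p v = y) \<or> (\<exists>a\<in>S. lifts_through V k p (cell_diff n att (cells a)) (\<lambda>x. x))" using R by blast
        have "\<exists>q. (k, V, q) \<in> dplots (cell_diff n att B) \<and> (\<forall>v\<in>V. p v = q v)"
          if a: "a \<in> S" "lifts_through V k p (cell_diff n att (cells a)) (\<lambda>x. x)" for a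
        proof -
          obtain q where "(k, V, q) \<in> dplots (cell_diff n att (cells a))" "\<forall>v\<in>V. p v = q v"
            using a(2) unfolding lifts_through_def by blast
          moreover have "cells a \<subseteq> B" using a(1) B by blast
          ultimately show ?thesis using cell_diff_mono_plots by blast
        qed
        then have "(\<exists>y. \<forall>v\<in>V. p v = y) \<or> (\<exists>q. (k, V, q) \<in> dplots (cell_diff n att B) \<and> (\<forall>v\<in>V. p v = q v))"
          using d by (elim disjE bexE) simp_all
        then show "\<exists>V. openin (euclid k) V \<and> u \<in> V \<and> V \<subseteq> U \<and>
          ((\<exists>y. \<forall>v\<in>V. p v = y) \<or> (\<exists>q. (k, V, q) \<in> dplots (cell_diff n att B) \<and> (\<forall>v\<in>V. p v = q v)))"
          using V by (intro exI[of _ V]) simp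
      qed (use R in auto)
    qed
  qed simp_all
qed

text \<open>Stages are indexed by the points \<open>(c, 0)\<close>, standing for the union of the cells before c,
  together with one extra point standing for the union of all cells.\<close>
theorem gathered_cell_diff: "gathered_smooth_cell_complex (cell_diff n att C)"
proof -
  define z :: "nat \<Rightarrow> real" where "z = (\<lambda>_. 0)"
  \<comment> \<open>Indices have to be taken from the type of points. The constant 1 differs from
    \<open>z\<close>, so this index is none of the \<open>(c, z)\<close>.\<close>
  define top where "top = (undefined :: 'c, (\<lambda>_. 1) :: nat \<Rightarrow> real)"
  define J where "J = insert top ((\<lambda>c. (c, z)) ` C)"
  \<comment> \<open>\<open>R\<close> is irreflexive, so \<open>cbelow\<close> excludes
    \<open>c\<close>: the stage \<open>(c, z)\<close> comes just before \<open>c\<close> is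
    attached, and the successor index attaches it.\<close>
  define cells where "cells j = (if snd j = z then cbelow C R (fst j) else C)" for j :: "'c \<times> (nat \<Rightarrow> real)"
  define r where "r = {(i, j). i \<in> J \<and> j \<in> J \<and> cells i \<subseteq> cells j}"
  have zt: "snd top \<noteq> z" by (auto simp: top_def z_def fun_eq_iff)
  have cells_top: "cells top = C" using zt by (simp add: cells_def)
  have cells_c: "cells (c, z) = cbelow C R c" for c by (simp add: cells_def)
  have tot: "c = d \<or> (c, d) \<in> R \<or> (d, c) \<in> R" if "c \<in> C" "d \<in> C" for c d
    using totR that by (auto simp: total_on_def)
  have irr: "(c, c) \<notin> R" for c using wfR by simp
  have J_cases: "j = top \<or> (\<exists>c\<in>C. j = (c, z))" if "j \<in> J" for j using that by (auto simp: J_def)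
  have init: "initial C R (cells j)" for j by (simp add: cells_def)
  have cellsC: "cells j \<subseteq> C" for j by (auto simp: cells_def cbelow_def)
  have below_sub: "cbelow C R c \<subseteq> cbelow C R d" if "(c, d) \<in> R" for c d
    using that transR by (auto simp: cbelow_def dest: transD)
  have lin: "cells i \<subseteq> cells j \<or> cells j \<subseteq> cells i" if "i \<in> J" "j \<in> J" for i j
    using J_cases[OF that(1)] J_cases[OF that(2)] cellsC cells_top tot below_sub by (metis cells_c order_refl)
  have strict: "\<exists>c\<in>C. i = (c, z) \<and> c \<in> cells j" if ij: "i \<in> J" "j \<in> J" "cells i \<subseteq> cells j" "i \<noteq> j" for i j
  proof -
    consider "i = top" "j \<noteq> top" | c where "c \<in> C" "i = (c, z)" using J_cases[OF ij(1)] ij(4) by blast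
    then show ?thesis
    proof cases
      case 1
      then obtain d where "d \<in> C" "j = (d, z)" using J_cases[OF ij(2)] by blast
      then have "d \<in> cbelow C R d" using ij(3) 1 cells_top cells_c by blast
      then show ?thesis using irr by (simp add: cbelow_def)
    next
      case 2
      have "c \<in> cells j"
      proof (rule ccontr)
        assume n: "c \<notin> cells j"
        then obtain d where d: "d \<in> C" "j = (d, z)" using J_cases[OF ij(2)] cells_top 2 by blast
        then have "(c, d) \<notin> R" "c \<noteq> d" using n 2 ij(4) by (auto simp: cells_c cbelow_def)
        then have "(d, c) \<in> R" using tot[OF 2(1) d(1)] by blast
        then have "d \<in> cells i" using 2 d by (simp add: cells_c cbelow_def)
        then have "d \<in> cbelow C R d" using ij(3) d by (auto simp: cells_c)
        then show False using irr by (simp add: cbelow_def)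
      qed
      then show ?thesis using 2 by blast
    qed
  qed
  have inj: "i = j" if ij: "i \<in> J" "j \<in> J" "cells i = cells j" for i j
  proof (rule ccontr)
    assume "i \<noteq> j"
    then obtain c where c: "i = (c, z)" "c \<in> cells j" using strict[OF ij(1,2)] ij(3) by blast
    then have "c \<in> cbelow C R c" using ij(3) by (simp add: cells_c)
    then show False using irr by (simp add: cbelow_def)
  qed
  have Fr: "Field r = J" by (auto simp: r_def Field_def)
  have rJ: "(i, j) \<in> r \<longleftrightarrow> cells i \<subseteq> cells j" if "i \<in> J" "j \<in> J" for i j using that by (simp add: r_def)
  have cJ: "(c, z) \<in> J" if "c \<in> C" for c using that by (simp add: J_def)
  have wo: "Well_order r"
    unfolding well_order_on_def linear_order_on_def partial_order_on_def preorder_on_def Fr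
  proof (intro conjI)
    show "r \<subseteq> J \<times> J" by (auto simp: r_def)
    show "refl_on J r" by (auto simp: refl_on_def r_def)
    show "trans r" by (auto simp: trans_def r_def)
    show "antisym r" using inj by (auto simp: antisym_def r_def)
    show "total_on J r" using lin by (auto simp: total_on_def r_def)
    show "wf (r - Id)"
      unfolding wf_eq_minimal
    proof (intro allI impI)
      fix Q :: "('c \<times> (nat \<Rightarrow> real)) set" and x assume x: "x \<in> Q"
      show "\<exists>y\<in>Q. \<forall>i. (i, y) \<in> r - Id \<longrightarrow> i \<notin> Q"
      \<comment> \<open>By \<open>strict\<close> a proper predecessor always has the form
        \<open>(c, z)\<close>, so minimality is decided by \<open>R\<close>.\<close>
      proof (cases "\<exists>c\<in>C. (c, z) \<in> Q")
        case True
        then obtain c where c: "c \<in> {c \<in> C. (c, z) \<in> Q}" "\<And>d. (d, c) \<in> R \<Longrightarrow> d \<notin> {c \<in> C. (c, z) \<in> Q}"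
          using wfE_min[OF wfR, of _ "{c \<in> C. (c, z) \<in> Q}"] by blast
        have "i \<notin> Q" if i: "(i, (c, z)) \<in> r - Id" for i
        proof -
          have "i \<in> J" "(c, z) \<in> J" "cells i \<subseteq> cells (c, z)" "i \<noteq> (c, z)" using i by (auto simp: r_def)
          from strict[OF this] obtain d where "d \<in> C" "i = (d, z)" "(d, c) \<in> R" by (auto simp: cells_c cbelow_def)
          then show ?thesis using c(2) by blast
        qed
        then show ?thesis using c(1) by blast
      next
        case False
        have "i \<notin> Q" if i: "(i, x) \<in> r - Id" for i
          using strict[of i x] i False by (auto simp: r_def)
        then show ?thesis using x by blast
      qed
    qed
  qed
  have zero: "dcarrier (cell_diff n att (cells a)) = {}" if "is_zero r a" for a
  proof -
    have a: "a \<in> J" "\<And>j. j \<in> J \<Longrightarrow> cells a \<subseteq> cells j" using that unfolding is_zero_def Fr by (auto simp: r_def)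
    have "cells a = {}"
    proof (cases "C = {}")
      case False
      then obtain c where c: "c \<in> C" "\<And>d. (d, c) \<in> R \<Longrightarrow> d \<notin> C" using wfE_min[OF wfR, of _ C] by blast
      have "cells a \<subseteq> cbelow C R c" using a(2)[OF cJ[OF c(1)]] by (simp add: cells_c)
      then show ?thesis using c(2) by (auto simp: cbelow_def)
    qed (use cellsC in blast)
    then show ?thesis by (simp add: cpts_def)
  qed
  have succ: "\<exists>m \<phi> \<Psi>. diff_pushout m (cell_diff n att (cells a)) \<phi> (cell_diff n att (cells b)) (\<lambda>x. x) \<Psi> \<and> tame m \<phi>"
    if "is_succ r a b" for a b
  proof -
    have ab: "(a, b) \<in> r" "a \<noteq> b" "\<And>i. (a, i) \<in> r \<Longrightarrow> i \<noteq> a \<Longrightarrow> (b, i) \<in> r" using that unfolding is_succ_def by auto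
    then have J: "a \<in> J" "b \<in> J" "cells a \<subseteq> cells b" by (auto simp: r_def)
    obtain c where c: "c \<in> C" "a = (c, z)" "c \<in> cells b" using strict[OF J ab(2)] by blast
    have "cells b = upto_cell c"
    proof
      show "upto_cell c \<subseteq> cells b" using J(3) c by (simp add: cells_c)
      show "cells b \<subseteq> upto_cell c"
      proof
        fix d assume d: "d \<in> cells b"
        show "d \<in> upto_cell c"
        proof (rule ccontr)
          \<comment> \<open>A further cell \<open>d\<close> of stage \<open>b\<close> would have its
            own stage \<open>(d, z)\<close> strictly after \<open>a\<close>, which would then
            contain stage \<open>b\<close> and so \<open>d\<close> itself.\<close>
          assume n: "d \<notin> upto_cell c"
          have dC: "d \<in> C" using d cellsC by blast
          have "(c, d) \<in> R" using tot[OF c(1) dC] n dC by (auto simp: cbelow_def)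
          then have "(a, (d, z)) \<in> r" using below_sub cJ[OF dC] J(1) by (simp add: r_def cells_c c(2))
          moreover have "(d, z) \<noteq> a" using n c(2) by auto
          ultimately have "(b, (d, z)) \<in> r" by (rule ab(3))
          then have "d \<in> cbelow C R d" using d by (auto simp: r_def cells_c)
          then show False using irr by (simp add: cbelow_def)
        qed
      qed
    qed
    then show ?thesis using cell_diff_pushout[OF c(1)] att_tame[OF c(1)] c(2) cells_c by auto
  qed
  have limit: "diff_colim (below r b) r (\<lambda>a. cell_diff n att (cells a)) (\<lambda>_ _ x. x) (cell_diff n att (cells b)) (\<lambda>_ x. x)" if lim: "is_limit r b" for b
  proof (rule cell_diff_colim)
    have b: "b \<in> J" "\<not> (\<exists>a. is_succ r a b)" using lim unfolding is_limit_def Fr by auto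
    have bJ: "a \<in> J" "cells a \<subseteq> cells b" "a \<noteq> b" if "a \<in> below r b" for a using that by (auto simp: below_def r_def)
    show "initial C R (cells a)" if "a \<in> below r b" for a by (rule init)
    show "(a, a') \<in> r \<longleftrightarrow> cells a \<subseteq> cells a'" if "a \<in> below r b" "a' \<in> below r b" for a a' using rJ bJ that by blast
    show "cells a \<subseteq> cells a' \<or> cells a' \<subseteq> cells a" if "a \<in> below r b" "a' \<in> below r b" for a a' using lin bJ that by blast
    show "(\<Union>a\<in>below r b. cells a) = cells b"
    proof
      show "(\<Union>a\<in>below r b. cells a) \<subseteq> cells b" using bJ by blast
      show "cells b \<subseteq> (\<Union>a\<in>below r b. cells a)"
      proof
        fix d assume d: "d \<in> cells b"
        have dC: "d \<in> C" using d cellsC by blast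
        have "cbelow C R d \<subseteq> cells b" using init[of b] d by (auto simp: initial_def)
        moreover have "(d, z) \<noteq> b" using d irr by (auto simp: cells_c cbelow_def)
        ultimately have db: "((d, z), b) \<in> r" "(d, z) \<noteq> b" using cJ[OF dC] b(1) by (auto simp: r_def cells_c)
        \<comment> \<open>Since \<open>b\<close> does not succeed \<open>(d, z)\<close>, another
          index lies strictly between them, and its stage already contains \<open>d\<close>.\<close>
        then obtain i where i: "((d, z), i) \<in> r" "i \<noteq> (d, z)" "(b, i) \<notin> r" using b(2) unfolding is_succ_def by blast
        have iJ: "i \<in> J" using i(1) by (simp add: r_def)
        have "cells i \<subseteq> cells b" "i \<noteq> b" using i(3) lin[OF b(1) iJ] rJ[OF b(1) iJ] by auto
        then have "i \<in> below r b" using iJ b(1) by (simp add: below_def r_def)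
        moreover have "d \<in> cells i"
          using strict[OF cJ[OF dC] iJ] i(1,2) by (auto simp: r_def)
        ultimately show "d \<in> (\<Union>a\<in>below r b. cells a)" by blast
      qed
    qed
  qed
  have total: "diff_colim (Field r) r (\<lambda>a. cell_diff n att (cells a)) (\<lambda>_ _ x. x) (cell_diff n att C) (\<lambda>_ x. x)"
    unfolding Fr
  proof (rule cell_diff_colim)
    show "(\<Union>a\<in>J. cells a) = C" using cellsC cells_top by (auto simp: J_def)
  qed (use init rJ lin in auto)
  have "diff_seq r (\<lambda>a. cell_diff n att (cells a)) (\<lambda>_ _ x. x)"
    unfolding diff_seq_def
    using wo limit diffeological_cell_diff_initial[OF init] smooth_map_cell_diff_mono by (auto simp: r_def)
  then show ?thesis
    unfolding gathered_smooth_cell_complex_def using zero succ total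
    by (intro exI[of _ r] exI[of _ "\<lambda>a. cell_diff n att (cells a)"] exI[of _ "\<lambda>_ _ x. x"] exI[of _ "\<lambda>_ x. x"]) simp
qed

end

section \<open>Topological cell complexes\<close>

lemma openin_cpts:
  assumes "\<And>c t. c \<in> B \<Longrightarrow> t \<in> topspace (K c) \<Longrightarrow> cmap bd att c t \<in> cpts B K bd"
  shows "openin (ctop B K bd att) (cpts B K bd)"
  unfolding openin_ctop
proof (intro conjI ballI)
  fix c assume "c \<in> B"
  then have "{t \<in> topspace (K c). cmap bd att c t \<in> cpts B K bd} = topspace (K c)" using assms by auto
  then show "openin (K c) {t \<in> topspace (K c). cmap bd att c t \<in> cpts B K bd}" by (simp only: openin_topspace)
qed simp

definition cube_centre :: "nat \<Rightarrow> nat \<Rightarrow> real" where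
  "cube_centre m = (\<lambda>j. if j < m then 1/2 else 0)"

lemma cube_centre_interior: "cube_centre m \<in> cube m - bdry m"
  by (auto simp: cube_centre_def cube_def bdry_def)

lemma top_colimD:
  assumes "top_colim S r Z f L g"
  shows "a \<in> S \<Longrightarrow> continuous_map (Z a) L (g a)"
    and "a \<in> S \<Longrightarrow> b \<in> S \<Longrightarrow> (a, b) \<in> r \<Longrightarrow> x \<in> topspace (Z a) \<Longrightarrow> g b (f a b x) = g a x"
    and "topspace L = (\<Union>a\<in>S. g a ` topspace (Z a))"
    and "a \<in> S \<Longrightarrow> b \<in> S \<Longrightarrow> x \<in> topspace (Z a) \<Longrightarrow> y \<in> topspace (Z b) \<Longrightarrow>
        g a x = g b y \<longleftrightarrow> (\<exists>c\<in>S. (a, c) \<in> r \<and> (b, c) \<in> r \<and> f a c x = f b c y)"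
    and "openin L V \<longleftrightarrow> V \<subseteq> topspace L \<and> (\<forall>a\<in>S. openin (Z a) {x \<in> topspace (Z a). g a x \<in> V})"
  by (use assms[unfolded top_colim_def] in simp)+

section \<open>The cells of the stages of a topological complex\<close>

locale top_complex =
  fixes r :: "'i rel" and Z :: "'i \<Rightarrow> 'z topology" and f :: "'i \<Rightarrow> 'i \<Rightarrow> 'z \<Rightarrow> 'z"
    and X :: "'a topology" and g :: "'i \<Rightarrow> 'z \<Rightarrow> 'a"
  assumes complex: "top_cell_complex r Z f X g"
begin

abbreviation "lt a b \<equiv> (a, b) \<in> r \<and> a \<noteq> b"

lemma wo: "Well_order r" and f_cont: "(a, b) \<in> r \<Longrightarrow> continuous_map (Z a) (Z b) (f a b)"
  and f_id: "a \<in> Field r \<Longrightarrow> x \<in> topspace (Z a) \<Longrightarrow> f a a x = x"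
  and f_comp: "(a, b) \<in> r \<Longrightarrow> (b, c) \<in> r \<Longrightarrow> x \<in> topspace (Z a) \<Longrightarrow> f b c (f a b x) = f a c x"
  and lim: "is_limit r b \<Longrightarrow> top_colim (below r b) r Z f (Z b) (\<lambda>a. f a b)"
  and zero: "is_zero r a \<Longrightarrow> topspace (Z a) = {}"
  and colim: "top_colim (Field r) r Z f X g"
  and push: "is_succ r a b \<Longrightarrow> \<exists>n \<phi> \<Phi>. top_pushout n (Z a) \<phi> (Z b) (f a b) \<Phi>"
  using complex unfolding top_cell_complex_def top_seq_def by blast+

lemma r_refl: "a \<in> Field r \<Longrightarrow> (a, a) \<in> r"
  and r_trans: "(a, b) \<in> r \<Longrightarrow> (b, c) \<in> r \<Longrightarrow> (a, c) \<in> r"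
  and r_antisym: "(a, b) \<in> r \<Longrightarrow> (b, a) \<in> r \<Longrightarrow> a = b"
  and r_total: "a \<in> Field r \<Longrightarrow> b \<in> Field r \<Longrightarrow> (a, b) \<in> r \<or> (b, a) \<in> r"
  and r_wf: "wf (r - Id)"
  using wo unfolding well_order_on_def linear_order_on_def partial_order_on_def preorder_on_def
    refl_on_def trans_def antisym_def total_on_def by metis+

lemma r_Field: "(a, b) \<in> r \<Longrightarrow> a \<in> Field r \<and> b \<in> Field r"
  by (auto simp: Field_def)

lemma succ_exists:
  assumes "lt a b" shows "\<exists>s. is_succ r a s"
proof -
  obtain s where s: "s \<in> {c. lt a c}" "\<And>y. (y, s) \<in> r - Id \<Longrightarrow> y \<notin> {c. lt a c}"
    using wfE_min[OF r_wf, of b "{c. lt a c}"] assms by blast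
  have "(s, c) \<in> r" if "(a, c) \<in> r \<and> c \<noteq> a" for c
  proof -
    have "c \<noteq> s \<longrightarrow> (c, s) \<notin> r" using s(2)[of c] that by auto
    moreover have "s \<in> Field r" "c \<in> Field r" using r_Field that s(1) by blast+
    ultimately show ?thesis using r_total[of s c] r_refl[of s] by blast
  qed
  then show ?thesis using s(1) unfolding is_succ_def by blast
qed

definition sc where "sc a = (SOME b. is_succ r a b)"
text \<open>The cell glued in between \<open>a\<close> and its successor is indexed by
  \<open>a\<close>; all indices but a possible last one carry a cell.\<close>

definition cells where "cells = {a. \<exists>b. is_succ r a b}"

lemma sc: "a \<in> cells \<Longrightarrow> is_succ r a (sc a)"
  unfolding sc_def cells_def by (auto intro: someI_ex)

lemma sc_eq: "is_succ r a b \<Longrightarrow> sc a = b"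
proof -
  assume s: "is_succ r a b"
  then have "is_succ r a (sc a)" using sc by (auto simp: cells_def)
  with s have "(sc a, b) \<in> r" "(b, sc a) \<in> r" unfolding is_succ_def by metis+
  then show ?thesis by (rule r_antisym)
qed

lemma lt_cells: "lt a b \<Longrightarrow> a \<in> cells"
  unfolding cells_def using succ_exists by blast

lemma sc_lt: "a \<in> cells \<Longrightarrow> lt a (sc a)"
  using sc[of a] unfolding is_succ_def by blast

lemma sc_le: "lt a b \<Longrightarrow> (sc a, b) \<in> r"
  using sc[OF lt_cells, of a b] unfolding is_succ_def by blast

lemma stage_cases:
  assumes "b \<in> Field r"
  obtains "is_zero r b" "\<And>a. \<not> lt a b" | b' where "b' \<in> cells" "sc b' = b" | "is_limit r b"
proof (cases "\<exists>a. lt a b")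
  case True
  show ?thesis
  proof (cases "\<exists>b'. is_succ r b' b")
    case True then show ?thesis using that(2) sc_eq cells_def by blast
  next
    case False then show ?thesis using that(3) True assms unfolding is_limit_def by blast
  qed
next
  case False
  then have "is_zero r b" unfolding is_zero_def using r_total r_refl assms by metis
  then show ?thesis using that(1) False by blast
qed

lemma stage_induct [consumes 1, case_names base step limit]:
  assumes "b \<in> Field r"
    and z: "\<And>b. is_zero r b \<Longrightarrow> (\<And>a. \<not> lt a b) \<Longrightarrow> P b"
    and s: "\<And>b. b \<in> cells \<Longrightarrow> P b \<Longrightarrow> P (sc b)"
    and l: "\<And>b. is_limit r b \<Longrightarrow> (\<And>a. lt a b \<Longrightarrow> P a) \<Longrightarrow> P b"
  shows "P b"
proof -
  have "b \<in> Field r \<longrightarrow> P b" for b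
    using r_wf
  proof (induction b rule: wf_induct_rule)
    case (less b)
    have IH: "P a" if "lt a b" for a using less[of a] that r_Field by blast
    show ?case
    proof
      assume "b \<in> Field r"
      then show "P b"
      proof (cases rule: stage_cases)
        case 1 then show ?thesis by (rule z)
      next
        case (2 b') then show ?thesis using s[of b'] IH[of b'] sc_lt[of b'] by simp
      next
        case 3 then show ?thesis using l IH by blast
      qed
    qed
  qed
  then show ?thesis using assms(1) by blast
qed

definition attaching where
  "attaching a = (SOME p. top_pushout (fst p) (Z a) (fst (snd p)) (Z (sc a)) (f a (sc a)) (snd (snd p)))"
definition "dm a = fst (attaching a)"
definition "ph a = fst (snd (attaching a))"
definition "Ph a = snd (snd (attaching a))"

lemma pushout: "a \<in> cells \<Longrightarrow> top_pushout (dm a) (Z a) (ph a) (Z (sc a)) (f a (sc a)) (Ph a)"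
proof -
  assume "a \<in> cells"
  then obtain n \<phi> \<Phi> where "top_pushout n (Z a) \<phi> (Z (sc a)) (f a (sc a)) \<Phi>" using push sc by blast
  then have "\<exists>p. top_pushout (fst p) (Z a) (fst (snd p)) (Z (sc a)) (f a (sc a)) (snd (snd p))"
    by (intro exI[of _ "(n, \<phi>, \<Phi>)"]) simp
  from someI_ex[OF this] show ?thesis unfolding dm_def ph_def Ph_def attaching_def .
qed

lemma ph_cont: "a \<in> cells \<Longrightarrow> continuous_map (bdry_top (dm a)) (Z a) (ph a)"
  and Ph_cont: "a \<in> cells \<Longrightarrow> continuous_map (cube_top (dm a)) (Z (sc a)) (Ph a)"
  and Ph_bdry: "a \<in> cells \<Longrightarrow> t \<in> bdry (dm a) \<Longrightarrow> Ph a t = f a (sc a) (ph a t)"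
  and inj_step: "a \<in> cells \<Longrightarrow> inj_on (f a (sc a)) (topspace (Z a))"
  and inj_Ph: "a \<in> cells \<Longrightarrow> inj_on (Ph a) (cube (dm a) - bdry (dm a))"
  and disj_Ph: "a \<in> cells \<Longrightarrow> f a (sc a) ` topspace (Z a) \<inter> Ph a ` (cube (dm a) - bdry (dm a)) = {}"
  and top_succ: "a \<in> cells \<Longrightarrow> topspace (Z (sc a)) = f a (sc a) ` topspace (Z a) \<union> Ph a ` cube (dm a)"
  and open_succ: "a \<in> cells \<Longrightarrow> openin (Z (sc a)) V \<longleftrightarrow> V \<subseteq> topspace (Z (sc a)) \<and>
        openin (Z a) {x \<in> topspace (Z a). f a (sc a) x \<in> V} \<and> openin (cube_top (dm a)) {t \<in> cube (dm a). Ph a t \<in> V}"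
  by (use pushout[of a] in \<open>simp add: top_pushout_def\<close>)+

lemma ph_in: "a \<in> cells \<Longrightarrow> t \<in> bdry (dm a) \<Longrightarrow> ph a t \<in> topspace (Z a)"
  using continuous_map_image_subset_topspace[OF ph_cont] by (auto simp: bdry_top_def)

lemma Ph_in: "a \<in> cells \<Longrightarrow> t \<in> cube (dm a) \<Longrightarrow> Ph a t \<in> topspace (Z (sc a))"
  using continuous_map_image_subset_topspace[OF Ph_cont] by (auto simp: cube_top_def)

lemma f_in: "(a, b) \<in> r \<Longrightarrow> x \<in> topspace (Z a) \<Longrightarrow> f a b x \<in> topspace (Z b)"
  using continuous_map_image_subset_topspace[OF f_cont] by blast

text \<open>At a successor injectivity is part of the pushout. At a limit, points with equal image
  already agree at an earlier index, where the induction hypothesis applies.\<close>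

lemma f_inj:
  assumes "b \<in> Field r" shows "\<forall>a. (a, b) \<in> r \<longrightarrow> inj_on (f a b) (topspace (Z a))"
  using assms
proof (induct rule: stage_induct)
  case (base b)
  show ?case
  proof (intro allI impI)
    fix a assume a: "(a, b) \<in> r"
    then have "a = b" using base by blast
    then show "inj_on (f a b) (topspace (Z a))" using f_id r_Field[OF a] by (simp add: inj_on_def)
  qed
next
  case (step b)
  show ?case
  proof (intro allI impI inj_onI)
    fix a x y assume a: "(a, sc b) \<in> r" and xy: "x \<in> topspace (Z a)" "y \<in> topspace (Z a)" "f a (sc b) x = f a (sc b) y"
    show "x = y"
    proof (cases "a = sc b")
      case True then show ?thesis using xy f_id r_Field[OF a] by simp
    next
      case False
      have ab: "(a, b) \<in> r"
        using r_total[of a b] r_Field a sc_lt[OF step(1)] sc_le[of b a] r_antisym[of a "sc b"] False by blast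
      have bs: "(b, sc b) \<in> r" using sc_lt[OF step(1)] by blast
      have "f b (sc b) (f a b x) = f b (sc b) (f a b y)" using xy f_comp[OF ab bs] by simp
      then have "f a b x = f a b y" using inj_onD[OF inj_step[OF step(1)]] f_in[OF ab] xy by blast
      then show ?thesis using step(2) ab xy by (blast dest: inj_onD)
    qed
  qed
next
  case (limit b)
  note L = top_colimD(4)[OF lim[OF limit(1)]]
  show ?case
  proof (intro allI impI inj_onI)
    fix a x y assume a: "(a, b) \<in> r" and xy: "x \<in> topspace (Z a)" "y \<in> topspace (Z a)" "f a b x = f a b y"
    show "x = y"
    proof (cases "a = b")
      case True then show ?thesis using xy f_id r_Field[OF a] by simp
    next
      case False
      then have "a \<in> below r b" using a by (simp add: below_def)
      then obtain c where c: "c \<in> below r b" "(a, c) \<in> r" "f a c x = f a c y" using L xy by blast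
      then have "inj_on (f a c) (topspace (Z a))" using limit(2)[of c] by (simp add: below_def)
      then show ?thesis using c(3) xy by (blast dest: inj_onD)
    qed
  qed
qed

text \<open>The characteristic map of the cell attached after stage \<open>a\<close>, seen in a
  later stage \<open>b\<close>.\<close>

definition "ec a b t = f (sc a) b (Ph a t)"

lemma ec_cont: "lt a b \<Longrightarrow> continuous_map (cube_top (dm a)) (Z b) (ec a b)"
  using continuous_map_compose[OF Ph_cont[OF lt_cells] f_cont[OF sc_le]] by (simp add: ec_def[abs_def] o_def)

lemma f_ec: "lt a b \<Longrightarrow> (b, c) \<in> r \<Longrightarrow> t \<in> cube (dm a) \<Longrightarrow> f b c (ec a b t) = ec a c t"
  unfolding ec_def by (rule f_comp[OF sc_le _ Ph_in[OF lt_cells]])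

lemma ec_succ: "b \<in> cells \<Longrightarrow> t \<in> cube (dm b) \<Longrightarrow> ec b (sc b) t = Ph b t"
  unfolding ec_def using f_id Ph_in sc_lt r_Field by blast

lemma lt_succ: "b \<in> cells \<Longrightarrow> lt a b \<Longrightarrow> lt a (sc b)"
  using r_trans r_antisym sc_lt by metis

text \<open>The boundary of a newly attached cube is mapped into the previous stage, so interiors of
  cells alone suffice, by induction over the stages.\<close>

lemma cover:
  assumes "b \<in> Field r"
  shows "\<forall>x\<in>topspace (Z b). \<exists>a t. lt a b \<and> t \<in> cube (dm a) - bdry (dm a) \<and> x = ec a b t"
  using assms
proof (induct rule: stage_induct)
  case (base b) then show ?case using zero by simp
next
  case (step b)
  have old: "\<exists>a t. lt a (sc b) \<and> t \<in> cube (dm a) - bdry (dm a) \<and> f b (sc b) y = ec a (sc b) t" if y: "y \<in> topspace (Z b)" for y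
  proof -
    obtain a t where at: "lt a b" "t \<in> cube (dm a) - bdry (dm a)" "y = ec a b t" using step(2) y by blast
    then have "f b (sc b) y = ec a (sc b) t" using f_ec[of a b "sc b" t] sc_lt[OF step(1)] by blast
    then show ?thesis using at lt_succ[OF step(1)] by blast
  qed
  show ?case
  proof
    fix x assume x: "x \<in> topspace (Z (sc b))"
    then consider y where "y \<in> topspace (Z b)" "x = f b (sc b) y" | t where "t \<in> cube (dm b)" "x = Ph b t"
      using top_succ[OF step(1)] by blast
    then show "\<exists>a t. lt a (sc b) \<and> t \<in> cube (dm a) - bdry (dm a) \<and> x = ec a (sc b) t"
    proof cases
      case 1 then show ?thesis using old by blast
    next
      case t: 2
      show ?thesis
      proof (cases "t \<in> bdry (dm b)")
        case True then show ?thesis using old[OF ph_in[OF step(1) True]] Ph_bdry[OF step(1) True] t by simp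
      next
        case False
        then have "t \<in> cube (dm b) - bdry (dm b)" "x = ec b (sc b) t" using t ec_succ[OF step(1)] by auto
        then show ?thesis using sc_lt[OF step(1)] by blast
      qed
    qed
  qed
next
  case (limit b)
  have top: "topspace (Z b) = (\<Union>a\<in>below r b. f a b ` topspace (Z a))" by (rule top_colimD(3)[OF lim[OF limit(1)]])
  show ?case
  proof
    fix x assume "x \<in> topspace (Z b)"
    then obtain a y where a: "lt a b" "y \<in> topspace (Z a)" "x = f a b y" unfolding top below_def by blast
    then obtain a' t where t: "lt a' a" "t \<in> cube (dm a') - bdry (dm a')" "y = ec a' a t" using limit(2)[OF a(1)] by blast
    then have "x = ec a' b t" using a f_ec[of a' a b t] by blast
    moreover have "lt a' b" using t(1) a(1) r_trans r_antisym by metis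
    ultimately show "\<exists>a t. lt a b \<and> t \<in> cube (dm a) - bdry (dm a) \<and> x = ec a b t" using t(2) by blast
  qed
qed

text \<open>The interior of the later of two cells is disjoint from the stage before it, which
  contains the earlier cell; for equal cells, injectivity on the interior is part of the
  pushout.\<close>

lemma ec_inj_le:
  assumes "lt a b" "lt a' b" "t \<in> cube (dm a) - bdry (dm a)" "t' \<in> cube (dm a') - bdry (dm a')" "ec a b t = ec a' b t'" "(a, a') \<in> r"
  shows "a = a' \<and> t = t'"
proof (cases "a = a'")
  case True
  have "Ph a t = Ph a t'"
    using inj_onD[OF f_inj[of b, rule_format, OF _ sc_le[OF assms(1)]]] assms(3,4,5) True Ph_in[OF lt_cells[OF assms(1)]] r_Field assms(1)
    unfolding ec_def by blast
  then show ?thesis using inj_onD[OF inj_Ph[OF lt_cells[OF assms(1)]]] assms(3,4) True by blast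
next
  case False
  then have aa: "lt a a'" using assms(6) by blast
  have a'c: "a' \<in> cells" using lt_cells[OF assms(2)] .
  have y: "ec a a' t \<in> topspace (Z a')"
    using continuous_map_image_subset_topspace[OF ec_cont[OF aa]] assms(3) by (auto simp: cube_top_def)
  have a's: "(a', sc a') \<in> r" using sc_lt[OF a'c] by blast
  have "f (sc a') b (f a' (sc a') (ec a a' t)) = f a' b (ec a a' t)" by (rule f_comp[OF a's sc_le[OF assms(2)] y])
  also have "\<dots> = ec a b t" by (rule f_ec[OF aa]) (use assms in auto)
  also have "\<dots> = f (sc a') b (Ph a' t')" using assms(5) by (simp only: ec_def)
  finally have "f a' (sc a') (ec a a' t) = Ph a' t'"
    using inj_onD[OF f_inj[of b, rule_format, OF _ sc_le[OF assms(2)]]] f_in[OF a's y] Ph_in[OF a'c] assms(4) r_Field assms(2) by blast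
  then show ?thesis using disj_Ph[OF a'c] y assms(4) by blast
qed

lemma ec_inj:
  assumes "lt a b" "lt a' b" "t \<in> cube (dm a) - bdry (dm a)" "t' \<in> cube (dm a') - bdry (dm a')" "ec a b t = ec a' b t'"
  shows "a = a' \<and> t = t'"
proof (cases "(a, a') \<in> r")
  case True then show ?thesis using ec_inj_le[OF assms] by blast
next
  case False
  then have "(a', a) \<in> r" using r_total r_Field assms(1,2) by blast
  then show ?thesis using ec_inj_le[OF assms(2,1,4,3) assms(5)[symmetric]] by blast
qed

text \<open>Openness in a stage is tested on earlier stages and on the newest cube, hence by
  induction on cells alone. This turns the iterated construction into the one-step topology of
  \<open>ctop\<close>.\<close>

lemma ec_open:
  assumes "b \<in> Field r"
  shows "\<forall>V. V \<subseteq> topspace (Z b) \<longrightarrow> (\<forall>a. lt a b \<longrightarrow> openin (cube_top (dm a)) {t \<in> cube (dm a). ec a b t \<in> V}) \<longrightarrow> openin (Z b) V"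
  using assms
proof (induct rule: stage_induct)
  case (base b) then show ?case using zero by auto
next
  case (step b)
  show ?case
  proof (intro allI impI)
    fix V assume V: "V \<subseteq> topspace (Z (sc b))" "\<forall>a. lt a (sc b) \<longrightarrow> openin (cube_top (dm a)) {t \<in> cube (dm a). ec a (sc b) t \<in> V}"
    have bs: "(b, sc b) \<in> r" using sc_lt[OF step(1)] by blast
    have "openin (Z b) {x \<in> topspace (Z b). f b (sc b) x \<in> V}"
    proof (rule step(2)[rule_format])
      fix a assume a: "lt a b"
      have "ec a b t \<in> topspace (Z b)" if "t \<in> cube (dm a)" for t
        using continuous_map_image_subset_topspace[OF ec_cont[OF a]] that by (auto simp: cube_top_def)
      then have "{t \<in> cube (dm a). ec a b t \<in> {x \<in> topspace (Z b). f b (sc b) x \<in> V}} = {t \<in> cube (dm a). ec a (sc b) t \<in> V}"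
        using f_ec[OF a bs] by auto
      then show "openin (cube_top (dm a)) {t \<in> cube (dm a). ec a b t \<in> {x \<in> topspace (Z b). f b (sc b) x \<in> V}}"
        using V(2) lt_succ[OF step(1) a] by simp
    qed auto
    moreover have "{t \<in> cube (dm b). Ph b t \<in> V} = {t \<in> cube (dm b). ec b (sc b) t \<in> V}" using ec_succ[OF step(1)] by auto
    ultimately show "openin (Z (sc b)) V" using open_succ[OF step(1)] V sc_lt[OF step(1)] by simp
  qed
next
  case (limit b)
  have op: "openin (Z b) V \<longleftrightarrow> V \<subseteq> topspace (Z b) \<and> (\<forall>a\<in>below r b. openin (Z a) {x \<in> topspace (Z a). f a b x \<in> V})" for V
    by (rule top_colimD(5)[OF lim[OF limit(1)]])
  show ?case
  proof (intro allI impI)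
    fix V assume V: "V \<subseteq> topspace (Z b)" "\<forall>a. lt a b \<longrightarrow> openin (cube_top (dm a)) {t \<in> cube (dm a). ec a b t \<in> V}"
    have "openin (Z a) {x \<in> topspace (Z a). f a b x \<in> V}" if a: "a \<in> below r b" for a
    proof -
      have ab: "lt a b" using a by (simp add: below_def)
      show ?thesis
      proof (rule limit(2)[OF ab, rule_format])
        fix a' assume a': "lt a' a"
        have "ec a' a t \<in> topspace (Z a)" if "t \<in> cube (dm a')" for t
          using continuous_map_image_subset_topspace[OF ec_cont[OF a']] that by (auto simp: cube_top_def)
        then have "{t \<in> cube (dm a'). ec a' a t \<in> {x \<in> topspace (Z a). f a b x \<in> V}} = {t \<in> cube (dm a'). ec a' b t \<in> V}"
          using f_ec[OF a', of b] ab by auto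
        moreover have "lt a' b" using a' ab r_trans r_antisym by metis
        ultimately show "openin (cube_top (dm a')) {t \<in> cube (dm a'). ec a' a t \<in> {x \<in> topspace (Z a). f a b x \<in> V}}"
          using V(2) by simp
      qed auto
    qed
    then show "openin (Z b) V" using op V(1) by blast
  qed
qed

section \<open>The whole complex and the encoding of its cells\<close>

definition "cellmap a t = g (sc a) (Ph a t)"

lemma g_cont: "b \<in> Field r \<Longrightarrow> continuous_map (Z b) X (g b)"
  and g_f: "(a, b) \<in> r \<Longrightarrow> x \<in> topspace (Z a) \<Longrightarrow> g b (f a b x) = g a x"
  and top_X: "topspace X = (\<Union>a\<in>Field r. g a ` topspace (Z a))"
  and g_eq: "a \<in> Field r \<Longrightarrow> b \<in> Field r \<Longrightarrow> x \<in> topspace (Z a) \<Longrightarrow> y \<in> topspace (Z b) \<Longrightarrow>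
        g a x = g b y \<longleftrightarrow> (\<exists>c\<in>Field r. (a, c) \<in> r \<and> (b, c) \<in> r \<and> f a c x = f b c y)"
  and open_X: "openin X V \<longleftrightarrow> V \<subseteq> topspace X \<and> (\<forall>a\<in>Field r. openin (Z a) {x \<in> topspace (Z a). g a x \<in> V})"
  using top_colimD(1,3,4,5)[OF colim] top_colimD(2)[OF colim, of a b x] r_Field[of a b] by simp_all

lemma cell_Field: "a \<in> cells \<Longrightarrow> a \<in> Field r \<and> sc a \<in> Field r"
  using sc_lt r_Field by blast

lemma g_ec: "lt a b \<Longrightarrow> t \<in> cube (dm a) \<Longrightarrow> g b (ec a b t) = cellmap a t"
  unfolding ec_def cellmap_def by (rule g_f[OF sc_le Ph_in[OF lt_cells]])

lemma cellmap_cont: "a \<in> cells \<Longrightarrow> continuous_map (cube_top (dm a)) X (cellmap a)"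
  using continuous_map_compose[OF Ph_cont g_cont] cell_Field by (simp add: cellmap_def[abs_def] o_def)

lemma cellmap_in: "a \<in> cells \<Longrightarrow> t \<in> cube (dm a) \<Longrightarrow> cellmap a t \<in> topspace X"
  using continuous_map_image_subset_topspace[OF cellmap_cont] by (auto simp: cube_top_def)

lemma cellmap_cover_stage:
  assumes "b \<in> Field r" "y \<in> topspace (Z b)"
  shows "\<exists>a t. lt a b \<and> t \<in> cube (dm a) - bdry (dm a) \<and> g b y = cellmap a t"
proof -
  obtain a t where "lt a b" "t \<in> cube (dm a) - bdry (dm a)" "y = ec a b t" using cover[OF assms(1)] assms(2) by blast
  then show ?thesis using g_ec by blast
qed

lemma cellmap_cover: "x \<in> topspace X \<Longrightarrow> \<exists>a\<in>cells. \<exists>t\<in>cube (dm a) - bdry (dm a). x = cellmap a t"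
  unfolding top_X using cellmap_cover_stage lt_cells by blast

lemma cellmap_bdry:
  assumes "a \<in> cells" "t \<in> bdry (dm a)"
  shows "cellmap a t = g a (ph a t)"
  unfolding cellmap_def Ph_bdry[OF assms] using g_f[of a "sc a"] ph_in[OF assms] sc_lt[OF assms(1)] by blast

lemma cellmap_inj:
  assumes "a \<in> cells" "a' \<in> cells" "t \<in> cube (dm a) - bdry (dm a)" "t' \<in> cube (dm a') - bdry (dm a')" "cellmap a t = cellmap a' t'"
  shows "a = a' \<and> t = t'"
proof -
  obtain c where c: "(sc a, c) \<in> r" "(sc a', c) \<in> r" "f (sc a) c (Ph a t) = f (sc a') c (Ph a' t')"
    using assms(5) g_eq[of "sc a" "sc a'"] Ph_in cell_Field assms(1-4) unfolding cellmap_def by blast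
  have "lt a c" "lt a' c" using c sc_lt assms(1,2) r_trans r_antisym by metis+
  then show ?thesis using ec_inj[of a c a' t t'] c(3) assms(3,4) by (simp add: ec_def)
qed

lemma cellmap_open:
  assumes V: "V \<subseteq> topspace X" "\<And>a. a \<in> cells \<Longrightarrow> openin (cube_top (dm a)) {t \<in> cube (dm a). cellmap a t \<in> V}"
  shows "openin X V"
  unfolding open_X
proof (intro conjI ballI V(1))
  fix b assume b: "b \<in> Field r"
  show "openin (Z b) {x \<in> topspace (Z b). g b x \<in> V}"
  proof (rule ec_open[OF b, rule_format])
    fix a assume a: "lt a b"
    have "ec a b t \<in> topspace (Z b)" if "t \<in> cube (dm a)" for t
      using continuous_map_image_subset_topspace[OF ec_cont[OF a]] that by (auto simp: cube_top_def)
    then have "{t \<in> cube (dm a). ec a b t \<in> {x \<in> topspace (Z b). g b x \<in> V}} = {t \<in> cube (dm a). cellmap a t \<in> V}"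
      using g_ec[OF a] by auto
    then show "openin (cube_top (dm a)) {t \<in> cube (dm a). ec a b t \<in> {x \<in> topspace (Z b). g b x \<in> V}}"
      using V(2) lt_cells[OF a] by simp
  qed auto
qed

text \<open>Cells are named by the image of their centre, so that they are indexed by points of X.\<close>
definition "name a = cellmap a (cube_centre (dm a))"

lemma name_inj: "inj_on name cells"
  unfolding name_def using cellmap_inj cube_centre_interior by (blast intro: inj_onI)

definition "unname = inv_into cells name"
definition "nord = {(name a, name b) | a b. a \<in> cells \<and> b \<in> cells \<and> lt a b}"
definition "ndim c = dm (unname c)"
text \<open>Inverse to the characteristic maps on the interiors of cells, well defined by
  \<open>cellmap_inj\<close>.\<close>

definition "coords x = (SOME p. \<exists>a\<in>cells. \<exists>t\<in>cube (dm a) - bdry (dm a). p = (name a, t) \<and> cellmap a t = x)"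
text \<open>A boundary point is sent to the earlier cell whose interior contains its image, with its
  coordinate there.\<close>

definition "natt c t = coords (cellmap (unname c) t)"

lemma unname [simp]: "a \<in> cells \<Longrightarrow> unname (name a) = a"
  unfolding unname_def by (rule inv_into_f_f[OF name_inj])

lemma coords_cellmap: "a \<in> cells \<Longrightarrow> t \<in> cube (dm a) - bdry (dm a) \<Longrightarrow> coords (cellmap a t) = (name a, t)"
  unfolding coords_def
  by (rule some_equality) (use cellmap_inj in blast)+

lemma cmap_natt:
  assumes "a \<in> cells" "t \<in> cube (dm a)"
  shows "cmap (cubeB ndim) natt (name a) t = coords (cellmap a t)"
  using assms coords_cellmap[of a t] by (auto simp: cmap_def cubeB_def ndim_def natt_def)

lemma cbelow_name: "a \<in> cells \<Longrightarrow> cbelow (name ` cells) nord (name a) = name ` {b. lt b a}"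
proof -
  assume a: "a \<in> cells"
  show ?thesis
  proof
    show "cbelow (name ` cells) nord (name a) \<subseteq> name ` {b. lt b a}"
      using inj_onD[OF name_inj] a by (fastforce simp: cbelow_def nord_def)
    show "name ` {b. lt b a} \<subseteq> cbelow (name ` cells) nord (name a)"
      using lt_cells a by (fastforce simp: cbelow_def nord_def)
  qed
qed

lemma coords_stage:
  assumes "a \<in> Field r" "y \<in> topspace (Z a)"
  shows "coords (g a y) \<in> cpts (name ` {b. lt b a}) (cubeK ndim) (cubeB ndim)"
proof -
  obtain b t where bt: "lt b a" "t \<in> cube (dm b) - bdry (dm b)" "g a y = cellmap b t" using cellmap_cover_stage[OF assms] by blast
  have b: "b \<in> cells" using lt_cells[OF bt(1)] .
  then show ?thesis using coords_cellmap[OF b bt(2)] bt by (auto simp: cpts_def cubeB_def ndim_def)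
qed

text \<open>Continuity of \<open>natt\<close> is the point: it is the original attaching map into
  the stage \<open>Z a\<close> followed by \<open>coords\<close>, and the latter is continuous on
  stages by \<open>ec_open\<close>.\<close>

lemma cubecell_names: "cubecell (name ` cells) nord ndim natt"
proof (intro cubecell.intro cellspace.intro)
  have "nord \<subseteq> inv_image (r - Id) unname" by (auto simp: nord_def inv_image_def)
  then show "wf nord" using wf_subset[OF wf_inv_image[OF r_wf]] by blast
  show "trans nord"
  proof (rule transI)
    fix x y z assume "(x, y) \<in> nord" "(y, z) \<in> nord"
    then obtain a b b' c where *: "x = name a" "y = name b" "y = name b'" "z = name c" "a \<in> cells" "b \<in> cells" "b' \<in> cells" "c \<in> cells"
      "lt a b" "lt b' c" unfolding nord_def by blast
    then have "b = b'" using inj_onD[OF name_inj] by blast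
    then have "lt a c" using * r_trans r_antisym by metis
    then show "(x, z) \<in> nord" using * unfolding nord_def by blast
  qed
  show "total_on (name ` cells) nord"
    unfolding total_on_def nord_def using r_total cell_Field by blast
next
  fix c assume "c \<in> name ` cells"
  then obtain a where a: "a \<in> cells" "c = name a" by blast
  show "closedin (cubeK ndim c) (cubeB ndim c)" "t1_space (cubeK ndim c)" by (rule closedin_cubeK t1_cubeK)+
  let ?B = "name ` {b. lt b a}"
  have below: "cbelow (name ` cells) nord c = ?B" using cbelow_name a by simp
  have natt: "natt c t = coords (g a (ph a t))" if "t \<in> bdry (dm a)" for t
    using cellmap_bdry[OF a(1) that] by (simp add: natt_def a)
  have aF: "a \<in> Field r" using cell_Field a(1) by blast
  have in_B: "natt c t \<in> cpts ?B (cubeK ndim) (cubeB ndim)" if "t \<in> bdry (dm a)" for t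
    using coords_stage[OF aF ph_in[OF a(1) that]] natt[OF that] by simp
  then show "natt c t \<in> cpts (cbelow (name ` cells) nord c) (cubeK ndim) (cubeB ndim)" if "t \<in> cubeB ndim c" for t
    using that unfolding below by (simp add: cubeB_def ndim_def a)
  have bt: "subtopology (cubeK ndim c) (cubeB ndim c) = bdry_top (dm a)"
    using bdry_subset[of "dm a"] by (simp add: cubeK_def cubeB_def ndim_def a cube_top_def bdry_top_def subtopology_subtopology Int_absorb1)
  have op: "openin (ctop ?B (cubeK ndim) (cubeB ndim) natt) (cpts ?B (cubeK ndim) (cubeB ndim))"
  proof (rule openin_cpts)
    fix d t assume "d \<in> ?B" "t \<in> topspace (cubeK ndim d)"
    then obtain b where b: "lt b a" "d = name b" "t \<in> cube (dm b)" using lt_cells by (auto simp: ndim_def)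
    have "ec b a t \<in> topspace (Z a)"
      using continuous_map_image_subset_topspace[OF ec_cont[OF b(1)]] b(3) by (auto simp: cube_top_def)
    then have "coords (g a (ec b a t)) \<in> cpts ?B (cubeK ndim) (cubeB ndim)" by (rule coords_stage[OF aF])
    then show "cmap (cubeB ndim) natt d t \<in> cpts ?B (cubeK ndim) (cubeB ndim)"
      unfolding g_ec[OF b(1,3)] b(2) cmap_natt[OF lt_cells[OF b(1)] b(3)] .
  qed
  show "continuous_map (subtopology (cubeK ndim c) (cubeB ndim c)) (ctop (cbelow (name ` cells) nord c) (cubeK ndim) (cubeB ndim) natt) (natt c)"
    unfolding below bt continuous_map_def
  proof (intro conjI allI impI funcsetI)
    fix t assume "t \<in> topspace (bdry_top (dm a))"
    then show "natt c t \<in> topspace (ctop ?B (cubeK ndim) (cubeB ndim) natt)"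
      using in_B[of t] openin_subset[OF op] by (auto simp: bdry_top_def)
  next
    fix U assume U: "openin (ctop ?B (cubeK ndim) (cubeB ndim) natt) U"
    have "openin (Z a) {y \<in> topspace (Z a). coords (g a y) \<in> U}"
    proof (rule ec_open[OF aF, rule_format])
      fix b assume b: "lt b a"
      have "ec b a t \<in> topspace (Z a)" if "t \<in> cube (dm b)" for t
        using continuous_map_image_subset_topspace[OF ec_cont[OF b]] that by (auto simp: cube_top_def)
      then have "{t \<in> cube (dm b). ec b a t \<in> {y \<in> topspace (Z a). coords (g a y) \<in> U}} =
          {t \<in> topspace (cubeK ndim (name b)). cmap (cubeB ndim) natt (name b) t \<in> U}"
        using g_ec[OF b] cmap_natt[OF lt_cells[OF b]] lt_cells[OF b] by (auto simp: ndim_def)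
      moreover have "openin (cubeK ndim (name b)) {t \<in> topspace (cubeK ndim (name b)). cmap (cubeB ndim) natt (name b) t \<in> U}"
        using U b unfolding openin_ctop by blast
      ultimately show "openin (cube_top (dm b)) {t \<in> cube (dm b). ec b a t \<in> {y \<in> topspace (Z a). coords (g a y) \<in> U}}"
        using lt_cells[OF b] by (simp add: cubeK_def ndim_def)
    qed auto
    from openin_continuous_map_preimage[OF ph_cont[OF a(1)] this]
    have "openin (bdry_top (dm a)) {t \<in> topspace (bdry_top (dm a)). ph a t \<in> {y \<in> topspace (Z a). coords (g a y) \<in> U}}" .
    moreover have "{t \<in> topspace (bdry_top (dm a)). ph a t \<in> {y \<in> topspace (Z a). coords (g a y) \<in> U}} =
        {t \<in> topspace (bdry_top (dm a)). natt c t \<in> U}"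
      using ph_in[OF a(1)] natt by (auto simp: bdry_top_def)
    ultimately show "openin (bdry_top (dm a)) {t \<in> topspace (bdry_top (dm a)). natt c t \<in> U}" by simp
  qed
qed

text \<open>\<open>coords\<close> is a bijection that intertwines the characteristic maps, and on
  both sides a set is open when its preimages under these maps are.\<close>

lemma homeomorphic_names: "X homeomorphic_space ctop (name ` cells) (cubeK ndim) (cubeB ndim) natt"
proof -
  interpret N: cubecell "name ` cells" nord ndim natt by (rule cubecell_names)
  have co: "coords (cellmap a t) = N.\<Phi> (name a) t" if "a \<in> cells" "t \<in> cube (dm a)" for a t
    using cmap_natt[OF that] by simp
  have inj: "inj_on coords (topspace X)"
  proof (rule inj_onI)
    fix x y assume xy: "x \<in> topspace X" "y \<in> topspace X" "coords x = coords y"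
    obtain a t where a: "a \<in> cells" "t \<in> cube (dm a) - bdry (dm a)" "x = cellmap a t" using cellmap_cover[OF xy(1)] by blast
    obtain b s where b: "b \<in> cells" "s \<in> cube (dm b) - bdry (dm b)" "y = cellmap b s" using cellmap_cover[OF xy(2)] by blast
    have "(name a, t) = (name b, s)" using coords_cellmap[OF a(1,2)] coords_cellmap[OF b(1,2)] xy(3) a(3) b(3) by simp
    then show "x = y" using inj_onD[OF name_inj, of a b] a b by simp
  qed
  have im: "coords ` topspace X = N.pts (name ` cells)"
  proof
    show "coords ` topspace X \<subseteq> N.pts (name ` cells)"
    proof (intro image_subsetI)
      fix x assume "x \<in> topspace X"
      then obtain a t where a: "a \<in> cells" "t \<in> cube (dm a) - bdry (dm a)" "x = cellmap a t" using cellmap_cover by blast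
      then show "coords x \<in> N.pts (name ` cells)" using coords_cellmap[OF a(1,2)] by (auto simp: cpts_def cubeB_def ndim_def)
    qed
    show "N.pts (name ` cells) \<subseteq> coords ` topspace X"
    proof
      fix p assume "p \<in> N.pts (name ` cells)"
      then obtain a t where a: "a \<in> cells" "t \<in> cube (dm a) - bdry (dm a)" "p = (name a, t)" by (auto simp: cpts_def cubeB_def ndim_def)
      then have "p = coords (cellmap a t)" using coords_cellmap by simp
      then show "p \<in> coords ` topspace X" using cellmap_in[of a t] a by blast
    qed
  qed
  have open_iff: "openin X V \<longleftrightarrow> openin (N.tp (name ` cells)) (coords ` V)" if V: "V \<subseteq> topspace X" for V
  proof -
    have eq: "{t \<in> topspace (cubeK ndim (name a)). N.\<Phi> (name a) t \<in> coords ` V} = {t \<in> cube (dm a). cellmap a t \<in> V}" if a: "a \<in> cells" for a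
    proof -
      have "N.\<Phi> (name a) t \<in> coords ` V \<longleftrightarrow> cellmap a t \<in> V" if "t \<in> cube (dm a)" for t
        using co[OF a that] inj_on_image_mem_iff[OF inj cellmap_in[OF a that] V] by simp
      then show ?thesis using a by (auto simp: ndim_def)
    qed
    show ?thesis
    proof
      assume "openin X V"
      then have "openin (cube_top (dm a)) {t \<in> cube (dm a). cellmap a t \<in> V}" if "a \<in> cells" for a
        using openin_continuous_map_preimage[OF cellmap_cont[OF that]] by (simp add: cube_top_def)
      then show "openin (N.tp (name ` cells)) (coords ` V)"
        unfolding openin_ctop using V im eq by (auto simp: cubeK_def ndim_def)
    next
      assume o: "openin (N.tp (name ` cells)) (coords ` V)"
      show "openin X V"
      proof (rule cellmap_open[OF V])
        fix a assume a: "a \<in> cells"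
        then have "openin (cubeK ndim (name a)) {t \<in> topspace (cubeK ndim (name a)). N.\<Phi> (name a) t \<in> coords ` V}"
          using o unfolding openin_ctop by blast
        then show "openin (cube_top (dm a)) {t \<in> cube (dm a). cellmap a t \<in> V}" unfolding eq[OF a] using a by (simp add: cubeK_def ndim_def)
      qed
    qed
  qed
  have "homeomorphic_map X (N.tp (name ` cells)) coords"
  proof (rule bijective_open_imp_homeomorphic_map)
    show "continuous_map X (N.tp (name ` cells)) coords"
      unfolding continuous_map_def
    proof (intro conjI allI impI funcsetI)
      fix x assume "x \<in> topspace X" then show "coords x \<in> topspace (N.tp (name ` cells))" using im by auto
    next
      fix U assume U: "openin (N.tp (name ` cells)) U"
      then have "U \<subseteq> coords ` topspace X" using im openin_subset by fastforce
      then have "coords ` {x \<in> topspace X. coords x \<in> U} = U" by auto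
      then show "openin X {x \<in> topspace X. coords x \<in> U}" using open_iff[of "{x \<in> topspace X. coords x \<in> U}"] U by simp
    qed
    show "open_map X (N.tp (name ` cells)) coords"
      unfolding open_map_def using open_iff openin_subset by blast
  qed (use im inj in auto)
  then show ?thesis by (rule homeomorphic_map_imp_homeomorphic_space)
qed

end

theorem theorem3:
  fixes r :: "'i rel" and Z' :: "'i \<Rightarrow> 'z topology" and f' :: "'i \<Rightarrow> 'i \<Rightarrow> 'z \<Rightarrow> 'z"
    and X' :: "'a topology" and g' :: "'i \<Rightarrow> 'z \<Rightarrow> 'a"
  assumes "top_cell_complex r Z' f' X' g'"
  shows "\<exists>X :: ('a \<times> (nat \<Rightarrow> real)) diffeology.
           gathered_smooth_cell_complex X \<and> X' homotopy_equivalent_space (dtop X)"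
proof -
  interpret top_complex r Z' f' X' g' by (rule top_complex.intro[OF assms])
  obtain att where att: "smoothcell (name ` cells) nord ndim att"
    "ctop (name ` cells) (cubeK ndim) (cubeB ndim) natt homotopy_equivalent_space ctop (name ` cells) (cubeK ndim) (cubeB ndim) att"
    using smooth_replacement[OF cubecell_names] by blast
  interpret S: smoothcell "name ` cells" nord ndim att by (rule att(1))
  have "X' homotopy_equivalent_space dtop (cell_diff ndim att (name ` cells))"
    unfolding S.dtop_cell_diff
    using homotopy_eqv_trans[OF homeomorphic_imp_homotopy_equivalent_space[OF homeomorphic_names] att(2)] .
  then show ?thesis using S.gathered_cell_diff by blast
qed

end
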